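(* Let $M$ be a $C^1$-manifold without boundary, $\mu$ a $C^1$ measure on $M$, and $X_1,\dots,X_p$ ($p\ge0$) $C^1$-vector fields on $M$ (no assumption is made on the span of the vector fields). Let $\Omega\subset M$ be open and let $u\in S^1_0(\Omega)\cap C(\Omega)$. If $\omega$ is a connected component of $\{x\in\Omega:\ u(x)\ne0\}$, then $u|_\omega\in S^1_0(\omega)$.
   Context: A $C^1$ measure is a nonnegative Borel measure that in each chart is absolutely continuous with a positive $C^1$ density. Functions are real-valued. First-order differential operators $X_j^\star$ are defined by $\int_M\psi X_j\varphi\,d\mu=\int_M\varphi X_j^\star\psi\,d\mu$ for all $\varphi,\psi\in C^1_c(M)$. $S^1(M)$ is the set of all $u\in L^2(M)=L^2(M,\mu)$ for which there are $f_1,\dots,f_p\in L^2(M)$ with $\int_M uX_j^\star\varphi\,d\mu=\int_M\varphi f_j\,d\mu$ for all $\varphi\in C^1_c(M)$ and all $j$; one writes $X_ju:=f_j$. $S^1(M)$ carries the norm $\big(\sum_{j=1}^p\|X_ju\|_{L^2}^2+\|u\|_{L^2}^2\big)^{1/2}$, and $S^1_0(M)$ is the closure of $C^1_c(M)$ in $S^1(M)$. For an open subset $\Omega\subset M$, the spaces $S^1(\Omega)$, $S^1_0(\Omega)$ are defined in the same way with $M$ replaced by the manifold $\Omega$ (with the restricted measure and vector fields). *)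

theory Defs
  imports "HOL-Analysis.Analysis"
begin

text \<open>
  The manifold $M$ is the whole type \<open>'a\<close> (Hausdorff and second countable); the model space is
  \<open>'e\<close>. A chart \<open>(U, h)\<close> consists of its domain and its coordinate map; the values of \<open>h\<close>
  outside \<open>U\<close> are irrelevant.

  The tangent bundle of a $C^1$-manifold is only of class $C^0$, so $C^1$ regularity of vector
  fields and of densities is not invariant under $C^1$ changes of coordinates. It is therefore
  always understood with respect to the charts of a given atlas, which need not be maximal.

  An open set \<open>W\<close> is regarded as a manifold with the charts \<open>(U \<inter> W, h)\<close>, the restricted measure
  and the restricted vector fields; the function spaces below take \<open>W\<close> as a parameter, and
  \<open>W = UNIV\<close> gives the spaces on $M$.
\<close>

type_synonym ('a, 'e) chart = "'a set \<times> ('a \<Rightarrow> 'e)"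

definition C1_on :: "'e::euclidean_space set \<Rightarrow> ('e \<Rightarrow> 'f::euclidean_space) \<Rightarrow> bool" where
  "C1_on S f \<longleftrightarrow>
     (\<exists>f' :: 'e \<Rightarrow> 'e \<Rightarrow>\<^sub>L 'f.
        (\<forall>x\<in>S. (f has_derivative blinfun_apply (f' x)) (at x)) \<and> continuous_on S f')"

definition is_chart :: "('a::topological_space, 'e::euclidean_space) chart \<Rightarrow> bool" where
  "is_chart c \<longleftrightarrow>
     (case c of (U, h) \<Rightarrow> open U \<and> open (h ` U) \<and> (\<exists>g. homeomorphism U (h ` U) h g))"

definition C1_atlas :: "('a::{t2_space, second_countable_topology}, 'e::euclidean_space) chart set \<Rightarrow> bool" where
  "C1_atlas \<A> \<longleftrightarrow>
     (\<forall>c\<in>\<A>. is_chart c) \<and>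
     (\<Union>(U, h)\<in>\<A>. U) = UNIV \<and>
     (\<forall>(U, h)\<in>\<A>. \<forall>(V, k)\<in>\<A>. C1_on (h ` (U \<inter> V)) (k \<circ> inv_into U h))"

definition C1_fun :: "('a, 'e::euclidean_space) chart set \<Rightarrow> 'a set \<Rightarrow> ('a \<Rightarrow> real) \<Rightarrow> bool" where
  "C1_fun \<A> W f \<longleftrightarrow> (\<forall>(U, h)\<in>\<A>. C1_on (h ` (U \<inter> W)) (f \<circ> inv_into U h))"

text \<open>Functions with compact support in \<open>W\<close> are represented by their extension by zero.\<close>

definition C1c :: "('a::topological_space, 'e::euclidean_space) chart set \<Rightarrow> 'a set \<Rightarrow> ('a \<Rightarrow> real) set" where
  "C1c \<A> W = {f. C1_fun \<A> W f \<and> (\<exists>K. compact K \<and> K \<subseteq> W \<and> (\<forall>x. x \<notin> K \<longrightarrow> f x = 0))}"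

definition C1_measure :: "('a::topological_space, 'e::euclidean_space) chart set \<Rightarrow> 'a measure \<Rightarrow> bool" where
  "C1_measure \<A> \<mu> \<longleftrightarrow>
     sets \<mu> = sets borel \<and>
     (\<forall>(U, h)\<in>\<A>. \<exists>\<rho> :: 'e \<Rightarrow> real.
        C1_on (h ` U) \<rho> \<and> (\<forall>y\<in>h ` U. 0 < \<rho> y) \<and>
        distr (restrict_space \<mu> U) borel h
          = density lborel (\<lambda>y. ennreal (\<rho> y) * indicator (h ` U) y))"

text \<open>
  A vector field is given by its components: \<open>X c x\<close> is the coordinate vector of $X(x)$ in the
  chart \<open>c\<close>, and the components in different charts are related by the derivative of the
  coordinate change.
\<close>

type_synonym ('a, 'e) vfield = "('a, 'e) chart \<Rightarrow> 'a \<Rightarrow> 'e"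

definition vector_field :: "('a, 'e::euclidean_space) chart set \<Rightarrow> 'a set \<Rightarrow> ('a, 'e) vfield \<Rightarrow> bool" where
  "vector_field \<A> W X \<longleftrightarrow>
     (\<forall>(U, h)\<in>\<A>. \<forall>(V, k)\<in>\<A>. \<forall>x\<in>U \<inter> V \<inter> W.
        X (V, k) x = frechet_derivative (k \<circ> inv_into U h) (at (h x)) (X (U, h) x))"

definition C0_vector_field ::
    "('a::topological_space, 'e::euclidean_space) chart set \<Rightarrow> 'a set \<Rightarrow> ('a, 'e) vfield \<Rightarrow> bool" where
  "C0_vector_field \<A> W X \<longleftrightarrow>
     vector_field \<A> W X \<and> (\<forall>(U, h)\<in>\<A>. continuous_on (U \<inter> W) (X (U, h)))"

definition C1_vector_field ::
    "('a, 'e::euclidean_space) chart set \<Rightarrow> 'a set \<Rightarrow> ('a, 'e) vfield \<Rightarrow> bool" where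
  "C1_vector_field \<A> W X \<longleftrightarrow>
     vector_field \<A> W X \<and> (\<forall>(U, h)\<in>\<A>. C1_on (h ` (U \<inter> W)) (X (U, h) \<circ> inv_into U h))"

text \<open>
  The derivative $X f$, computed at each point in some chart around it; by the transformation
  law of the components, the choice does not matter.
\<close>

definition vf_deriv ::
    "('a, 'e::euclidean_space) chart set \<Rightarrow> ('a, 'e) vfield \<Rightarrow> ('a \<Rightarrow> real) \<Rightarrow> 'a \<Rightarrow> real" where
  "vf_deriv \<A> X f x =
     (let (U, h) = (SOME c. c \<in> \<A> \<and> x \<in> fst c)
      in frechet_derivative (f \<circ> inv_into U h) (at (h x)) (X (U, h) x))"

definition first_order_operator ::
    "('a::topological_space, 'e::euclidean_space) chart set \<Rightarrow> 'a set
      \<Rightarrow> (('a \<Rightarrow> real) \<Rightarrow> 'a \<Rightarrow> real) \<Rightarrow> bool" where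
  "first_order_operator \<A> W D \<longleftrightarrow>
     (\<exists>Y a. C0_vector_field \<A> W Y \<and> continuous_on W a \<and>
        (\<forall>\<phi>\<in>C1c \<A> W. \<forall>x\<in>W. D \<phi> x = vf_deriv \<A> Y \<phi> x + a x * \<phi> x))"

text \<open>
  The operator $X^\star$ on \<open>W\<close>. Since $X^\star\psi$ is continuous on \<open>W\<close>, the defining identity
  determines it there for every $\psi\in C^1_c(W)$, whichever operator is chosen.
\<close>

definition adjoint ::
    "('a::topological_space, 'e::euclidean_space) chart set \<Rightarrow> 'a measure \<Rightarrow> 'a set \<Rightarrow> ('a, 'e) vfield
      \<Rightarrow> ('a \<Rightarrow> real) \<Rightarrow> 'a \<Rightarrow> real" where
  "adjoint \<A> \<mu> W X =
     (SOME D. first_order_operator \<A> W D \<and>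
        (\<forall>\<phi>\<in>C1c \<A> W. \<forall>\<psi>\<in>C1c \<A> W.
           (LINT x:W|\<mu>. \<psi> x * vf_deriv \<A> X \<phi> x) = (LINT x:W|\<mu>. \<phi> x * D \<psi> x)))"

text \<open>
  Elements of $L^2(W)$ are represented by functions on the whole type, of which only the values
  on \<open>W\<close> matter; no quotient by equality almost everywhere is taken.
\<close>

definition L2 :: "'a measure \<Rightarrow> 'a set \<Rightarrow> ('a \<Rightarrow> real) set" where
  "L2 \<mu> W = {u. set_borel_measurable \<mu> W u \<and> set_integrable \<mu> W (\<lambda>x. (u x)\<^sup>2)}"

definition L2_norm_on :: "'a measure \<Rightarrow> 'a set \<Rightarrow> ('a \<Rightarrow> real) \<Rightarrow> real" where
  "L2_norm_on \<mu> W u = sqrt (LINT x:W|\<mu>. (u x)\<^sup>2)"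

definition is_weak_deriv ::
    "('a::topological_space, 'e::euclidean_space) chart set \<Rightarrow> 'a measure \<Rightarrow> 'a set \<Rightarrow> ('a, 'e) vfield
      \<Rightarrow> ('a \<Rightarrow> real) \<Rightarrow> ('a \<Rightarrow> real) \<Rightarrow> bool" where
  "is_weak_deriv \<A> \<mu> W X u f \<longleftrightarrow>
     f \<in> L2 \<mu> W \<and>
     (\<forall>\<phi>\<in>C1c \<A> W. (LINT x:W|\<mu>. u x * adjoint \<A> \<mu> W X \<phi> x) = (LINT x:W|\<mu>. \<phi> x * f x))"

definition weak_deriv ::
    "('a::topological_space, 'e::euclidean_space) chart set \<Rightarrow> 'a measure \<Rightarrow> 'a set \<Rightarrow> ('a, 'e) vfield
      \<Rightarrow> ('a \<Rightarrow> real) \<Rightarrow> 'a \<Rightarrow> real" where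
  "weak_deriv \<A> \<mu> W X u = (SOME f. is_weak_deriv \<A> \<mu> W X u f)"

definition S1 ::
    "('a::topological_space, 'e::euclidean_space) chart set \<Rightarrow> 'a measure \<Rightarrow> nat
      \<Rightarrow> (nat \<Rightarrow> ('a, 'e) vfield) \<Rightarrow> 'a set \<Rightarrow> ('a \<Rightarrow> real) set" where
  "S1 \<A> \<mu> p X W = {u \<in> L2 \<mu> W. \<forall>j<p. \<exists>f. is_weak_deriv \<A> \<mu> W (X j) u f}"

definition S1_norm ::
    "('a::topological_space, 'e::euclidean_space) chart set \<Rightarrow> 'a measure \<Rightarrow> nat
      \<Rightarrow> (nat \<Rightarrow> ('a, 'e) vfield) \<Rightarrow> 'a set \<Rightarrow> ('a \<Rightarrow> real) \<Rightarrow> real" where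
  "S1_norm \<A> \<mu> p X W u =
     sqrt ((\<Sum>j<p. (L2_norm_on \<mu> W (weak_deriv \<A> \<mu> W (X j) u))\<^sup>2) + (L2_norm_on \<mu> W u)\<^sup>2)"

definition S1_0 ::
    "('a::topological_space, 'e::euclidean_space) chart set \<Rightarrow> 'a measure \<Rightarrow> nat
      \<Rightarrow> (nat \<Rightarrow> ('a, 'e) vfield) \<Rightarrow> 'a set \<Rightarrow> ('a \<Rightarrow> real) set" where
  "S1_0 \<A> \<mu> p X W =
     {u \<in> S1 \<A> \<mu> p X W. \<forall>\<epsilon>>0. \<exists>\<phi>\<in>C1c \<A> W. S1_norm \<A> \<mu> p X W (\<lambda>x. u x - \<phi> x) < \<epsilon>}"

end

theory Submission
  imports Defs
begin

text \<open>
  Let $\varphi_n \in C^1_c(\Omega)$ tend to $u$ in $S^1(\Omega)$ and almost everywhere, and let $G$ be a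
  bounded $C^1$ function with bounded derivative that vanishes on $[-\epsilon, \epsilon]$. Since
  $\omega$ is relatively closed in $\{u \ne 0\}$, for every $H \in C^1_c(\Omega)$ the set
  $K = \omega \cap \{|u| \ge \epsilon\} \cap \mathrm{supp}\, H$ is compact. Hence there is a cutoff
  $\eta \in C^1_c(\omega)$ equal to $1$ near $K$, and $\eta H G(\varphi_m) \in C^1_c(\omega)$ converges,
  as $m \to \infty$, to $1_\omega H G(u)$ together with its derivatives: the terms with $X_j \eta$
  disappear in the limit because $G(u) = 0$ where $\eta$ varies. Taking $H = T(\varphi_n)$ with
  $T(0) = 0$ and $T = 1$ outside $(-\epsilon, \epsilon)$ gives $1_\omega G(u)$ as $n \to \infty$, and
  letting $G$ tend to the identity gives $1_\omega u$. No mollification is needed.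

  The weak formulation enters only through the existence of the adjoint (integration by parts) and
  the uniqueness of weak derivatives.
\<close>

section \<open>Calculus of C1 functions\<close>

text \<open>Cutting off directly fails: a cutoff \<eta> on \<omega> applied to the approximants
  leaves, in the limit, the error u X_j \<eta>, and no bound on X_j \<eta> is available as \<eta>
  exhausts \<omega>. The function u cannot be truncated before the approximation either, being
  merely continuous. Hence G acts on the C^1 functions \<phi>_m, and only the limit G(u) has the
  zeros that kill X_j \<eta>. The factor H is there because {|u| \<ge> \<epsilon>} need not be
  compact in \<Omega>. The order of the limits is forced: \<eta> depends on the support of H, hence
  on n, so m tends to infinity with n fixed, and bounds on X_j \<eta> never have to be uniform in n.
  All three limits use one tool: c_n s_n tends to c s in L2 if s_n tends to s in L2, the c_n are
  uniformly bounded, and c_n tends to c almost everywhere on {s \<noteq> 0}. This dictates the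
  bounds on G, G', T and T'; in the last limit the bound on G' must not depend on
  \<epsilon>.\<close>

lemma C1_on_subset:
  assumes "C1_on S f" "T \<subseteq> S"
  shows "C1_on T f"
proof -
  obtain f' where "\<forall>x\<in>S. (f has_derivative blinfun_apply (f' x)) (at x)" "continuous_on S f'"
    using assms(1) unfolding C1_on_def by blast
  then show ?thesis
    unfolding C1_on_def using assms(2) by (intro exI[of _ f']) (auto intro: continuous_on_subset)
qed

lemma C1_on_cong:
  assumes "C1_on S f" "open S" "\<And>x. x \<in> S \<Longrightarrow> f x = g x"
  shows "C1_on S g"
proof -
  obtain f' where f': "\<And>x. x \<in> S \<Longrightarrow> (f has_derivative blinfun_apply (f' x)) (at x)"
    and "continuous_on S f'"
    using assms(1) unfolding C1_on_def by blast
  moreover have "(g has_derivative blinfun_apply (f' x)) (at x)" if "x \<in> S" for x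
    using has_derivative_transform_within_open[OF f'[OF that] assms(2) that] assms(3) by blast
  ultimately show ?thesis unfolding C1_on_def by blast
qed

text \<open>The two derivative witnesses may differ off their respective sets, so neither serves on
  the union. The Frechet derivative of f, bundled as a bounded linear map, agrees with both by
  uniqueness, and continuity then glues over two open sets.\<close>

lemma C1_on_Un:
  assumes "C1_on S f" "C1_on T f" "open S" "open T"
  shows "C1_on (S \<union> T) f"
proof -
  define D where "D x = Blinfun (frechet_derivative f (at x))" for x
  obtain f' where f': "\<And>x. x \<in> S \<Longrightarrow> (f has_derivative blinfun_apply (f' x)) (at x)"
    and cf: "continuous_on S f'"
    using assms(1) unfolding C1_on_def by blast
  obtain g' where g': "\<And>x. x \<in> T \<Longrightarrow> (f has_derivative blinfun_apply (g' x)) (at x)"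
    and cg: "continuous_on T g'"
    using assms(2) unfolding C1_on_def by blast
  have D: "D x = A" if "(f has_derivative blinfun_apply A) (at x)" for x A
    using frechet_derivative_at[OF that] unfolding D_def by (metis blinfun_apply_inverse)
  have "continuous_on S D" "continuous_on T D"
    using continuous_on_cong[of S S D f'] continuous_on_cong[of T T D g'] cf cg D f' g' by auto
  then have "continuous_on (S \<union> T) D"
    using assms continuous_on_open_Un by blast
  moreover have "(f has_derivative blinfun_apply (D x)) (at x)" if "x \<in> S \<union> T" for x
    using that D f' g' by (metis Un_iff)
  ultimately show ?thesis unfolding C1_on_def by blast
qed

lemma C1_on_const [simp]: "C1_on S (\<lambda>_. c)"
  unfolding C1_on_def by (rule exI[of _ "\<lambda>_. 0"]) (simp add: zero_blinfun.rep_eq)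

lemma C1_on_add:
  assumes "C1_on S f" "C1_on S g"
  shows "C1_on S (\<lambda>x. f x + g x)"
proof -
  obtain f' where f': "\<forall>x\<in>S. (f has_derivative blinfun_apply (f' x)) (at x)" "continuous_on S f'"
    using assms(1) unfolding C1_on_def by blast
  obtain g' where g': "\<forall>x\<in>S. (g has_derivative blinfun_apply (g' x)) (at x)" "continuous_on S g'"
    using assms(2) unfolding C1_on_def by blast
  show ?thesis unfolding C1_on_def
    using f' g'
    by (intro exI[of _ "\<lambda>x. f' x + g' x"])
       (auto simp: plus_blinfun.rep_eq intro!: derivative_intros continuous_intros)
qed

lemma C1_on_mult:
  fixes f g :: "'e::euclidean_space \<Rightarrow> real"
  assumes "C1_on S f" "C1_on S g"
  shows "C1_on S (\<lambda>x. f x * g x)"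
proof -
  obtain f' where f': "\<forall>x\<in>S. (f has_derivative blinfun_apply (f' x)) (at x)" "continuous_on S f'"
    using assms(1) unfolding C1_on_def by blast
  obtain g' where g': "\<forall>x\<in>S. (g has_derivative blinfun_apply (g' x)) (at x)" "continuous_on S g'"
    using assms(2) unfolding C1_on_def by blast
  have c: "continuous_on S f" "continuous_on S g"
    using f' g' by (meson continuous_at_imp_continuous_on has_derivative_continuous)+
  show ?thesis unfolding C1_on_def
    using f' g' c
    by (intro exI[of _ "\<lambda>x. f x *\<^sub>R g' x + g x *\<^sub>R f' x"])
       (auto simp: plus_blinfun.rep_eq scaleR_blinfun.rep_eq fun_eq_iff algebra_simps
             intro!: derivative_eq_intros continuous_intros)
qed

lemma C1_on_compose:
  assumes "C1_on S g" "C1_on T f" "g ` S \<subseteq> T"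
  shows "C1_on S (f \<circ> g)"
proof -
  obtain g' where g': "\<And>x. x \<in> S \<Longrightarrow> (g has_derivative blinfun_apply (g' x)) (at x)" "continuous_on S g'"
    using assms(1) unfolding C1_on_def by blast
  obtain f' where f': "\<And>x. x \<in> T \<Longrightarrow> (f has_derivative blinfun_apply (f' x)) (at x)" "continuous_on T f'"
    using assms(2) unfolding C1_on_def by blast
  have c: "continuous_on S g"
    using g' by (meson continuous_at_imp_continuous_on has_derivative_continuous)
  have c2: "continuous_on S (\<lambda>x. f' (g x))"
    by (rule continuous_on_compose2[OF f'(2) c assms(3)])
  have "(f \<circ> g has_derivative blinfun_apply (f' (g x) o\<^sub>L g' x)) (at x)" if "x \<in> S" for x
    using diff_chain_at[OF g'(1)[OF that] f'(1)] assms(3) that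
    by (simp add: blinfun_compose.rep_eq image_subset_iff)
  moreover have "continuous_on S (\<lambda>x. f' (g x) o\<^sub>L g' x)"
    by (intro continuous_intros c2 g'(2))
  ultimately show ?thesis
    unfolding C1_on_def by (intro exI[of _ "\<lambda>x. f' (g x) o\<^sub>L g' x"]) simp
qed

lemma C1_on_linear:
  assumes "bounded_linear L"
  shows "C1_on S L"
  unfolding C1_on_def
  by (rule exI[of _ "\<lambda>_. Blinfun L"])
     (simp add: bounded_linear_Blinfun_apply assms bounded_linear_imp_has_derivative)

lemma C1_on_inner:
  assumes "C1_on S f"
  shows "C1_on S (\<lambda>x. f x \<bullet> b)"
  using C1_on_compose[OF assms C1_on_linear[of "\<lambda>y. y \<bullet> b" UNIV]]
  by (simp add: bounded_linear_inner_left o_def)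

lemma C1_on_real:
  fixes T :: "real \<Rightarrow> real"
  assumes "\<And>s. (T has_real_derivative T' s) (at s)" "continuous_on UNIV T'"
  shows "C1_on S T"
proof -
  have "(T has_derivative blinfun_apply (blinfun_mult_right (T' s))) (at s)" for s
    using assms(1)[of s] by (simp add: has_field_derivative_def mult_commute_abs)
  moreover have "continuous_on S (\<lambda>s. blinfun_mult_right (T' s))"
    by (intro bounded_linear.continuous_on[OF bounded_linear_blinfun_mult_right])
       (use assms(2) continuous_on_subset in blast)
  ultimately show ?thesis
    unfolding C1_on_def by (intro exI[of _ "\<lambda>s. blinfun_mult_right (T' s)"]) simp
qed

lemma C1_on_imp_continuous_on: "C1_on S f \<Longrightarrow> continuous_on S f"
  unfolding C1_on_def by (meson continuous_at_imp_continuous_on has_derivative_continuous)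

lemma C1_on_has_derivative:
  assumes "C1_on S f" "x \<in> S"
  shows "(f has_derivative frechet_derivative f (at x)) (at x)"
  using assms unfolding C1_on_def
  by (metis differentiableI frechet_derivative_works)

lemma C1_on_continuous_derivative:
  assumes "C1_on S f" "continuous_on S Z"
  shows "continuous_on S (\<lambda>x. frechet_derivative f (at x) (Z x))"
proof -
  obtain f' where f': "\<And>x. x \<in> S \<Longrightarrow> (f has_derivative blinfun_apply (f' x)) (at x)" "continuous_on S f'"
    using assms(1) unfolding C1_on_def by blast
  have "continuous_on S (\<lambda>x. blinfun_apply (f' x) (Z x))"
    by (intro continuous_intros f' assms)
  then show ?thesis
    using continuous_on_cong[of S S "\<lambda>x. blinfun_apply (f' x) (Z x)" "\<lambda>x. frechet_derivative f (at x) (Z x)"]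
      frechet_derivative_at[OF f'(1)] by auto
qed

section \<open>One-variable cutoffs and Euclidean bumps\<close>

lemma square_pos_part_derivative:
  "((\<lambda>s::real. (max 0 s)\<^sup>2) has_real_derivative 2 * max 0 s) (at s)"
proof -
  consider "s > 0" | "s < 0" | "s = 0" by linarith
  then show ?thesis
  proof cases
    case 1
    have "((\<lambda>s::real. s\<^sup>2) has_real_derivative 2 * max 0 s) (at s)"
      using 1 by (auto intro!: derivative_eq_intros)
    then show ?thesis
      by (rule has_field_derivative_transform_within_open[where S="{0<..}"]) (use 1 in auto)
  next
    case 2
    have "((\<lambda>s::real. 0) has_real_derivative 2 * max 0 s) (at s)"
      using 2 by (auto intro!: derivative_eq_intros)
    then show ?thesis
      by (rule has_field_derivative_transform_within_open[where S="{..<0}"]) (use 2 in auto)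
  next
    case 3
    have "((\<lambda>h::real. (max 0 h)\<^sup>2 / h) \<longlongrightarrow> 0) (at 0)"
    proof (rule Lim_null_comparison[where g = "\<lambda>h. \<bar>h\<bar>"])
      have "norm ((max 0 h)\<^sup>2 / h) \<le> \<bar>h\<bar>" for h :: real
        by (cases "h > 0") (auto simp: max_def power2_eq_square)
      then show "\<forall>\<^sub>F h in at (0::real). norm ((max 0 h)\<^sup>2 / h) \<le> \<bar>h\<bar>" by simp
      show "((\<lambda>h::real. \<bar>h\<bar>) \<longlongrightarrow> 0) (at 0)"
        by (intro tendsto_rabs_zero) (simp add: tendsto_ident_at)
    qed
    then show ?thesis
      using 3 by (simp add: DERIV_def)
  qed
qed

lemma square_pos_part_DERIV:
  assumes "(f has_real_derivative f') (at s)"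
  shows "((\<lambda>s. (max 0 (f s))\<^sup>2) has_real_derivative (2 * max 0 (f s)) * f') (at s)"
  using DERIV_chain2[OF square_pos_part_derivative assms] .

text \<open>The squared positive part is C^1 with an explicit derivative, which makes T elementary.
  Here T' = 4 m s / c^2 with 0 \<le> m \<le> 1, and m = 0 for |s| \<ge> c, whence the bound 4 / c.
  That bound keeps the coefficient of X_j \<phi>_n bounded when the compactly supported factor
  T(\<phi>_n) is removed.\<close>

lemma cutoff_real:
  fixes c :: real
  assumes "c > 0"
  obtains T T' :: "real \<Rightarrow> real" where
    "\<And>s. (T has_real_derivative T' s) (at s)" "continuous_on UNIV T'" "T 0 = 0"
    "\<And>s. 0 \<le> T s \<and> T s \<le> 1" "\<And>s. \<bar>s\<bar> \<ge> c \<Longrightarrow> T s = 1 \<and> T' s = 0" "\<And>s. \<bar>T' s\<bar> \<le> 4 / c"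
proof -
  define m where "m s = max 0 (1 - s\<^sup>2 / c\<^sup>2)" for s
  define T where "T s = 1 - (m s)\<^sup>2" for s
  define T' where "T' s = 4 * m s * s / c\<^sup>2" for s
  have m: "0 \<le> m s" "m s \<le> 1" for s unfolding m_def by auto
  have m0: "m s = 0" if "\<bar>s\<bar> \<ge> c" for s
  proof -
    have "c\<^sup>2 \<le> s\<^sup>2" using that assms by (simp add: abs_le_square_iff[symmetric])
    then show ?thesis unfolding m_def using assms by (simp add: field_simps)
  qed
  show ?thesis
  proof
    show "(T has_real_derivative T' s) (at s)" for s
      unfolding T_def m_def T'_def
      by (rule DERIV_cong[OF DERIV_diff[OF DERIV_const square_pos_part_DERIV[of _ "- 2 * s / c\<^sup>2"]]])
         (use assms in \<open>auto intro!: derivative_eq_intros simp: field_simps eval_nat_numeral\<close>)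
    show "continuous_on UNIV T'"
      unfolding T'_def m_def using assms by (intro continuous_intros) auto
    show "T 0 = 0" unfolding T_def m_def by simp
    show "0 \<le> T s \<and> T s \<le> 1" for s unfolding T_def using m[of s]
      by (simp add: power_le_one)
    show "T s = 1 \<and> T' s = 0" if "\<bar>s\<bar> \<ge> c" for s
      unfolding T_def T'_def using m0[OF that] by simp
    show "\<bar>T' s\<bar> \<le> 4 / c" for s
    proof (cases "\<bar>s\<bar> \<ge> c")
      case True then show ?thesis unfolding T'_def using m0 assms by simp
    next
      case False
      have "m s * \<bar>s\<bar> \<le> 1 * c" using m[of s] False by (intro mult_mono) auto
      then have "m s * \<bar>s\<bar> / c\<^sup>2 \<le> c / c\<^sup>2" by (intro divide_right_mono) auto
      then show ?thesis unfolding T'_def using m[of s] assms by (simp add: abs_mult power2_eq_square)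
    qed
  qed
qed

text \<open>The profile is a function of the squared distance, a polynomial in the coordinates,
  because the distance itself is not differentiable at the centre. Expanding the inner product over
  \<open>Basis\<close> reduces C^1 regularity to sums and products of affine functions.\<close>

lemma bump_euclidean:
  fixes c :: "'e::euclidean_space" and r :: real
  assumes "r > 0"
  obtains \<beta> :: "'e \<Rightarrow> real" where
    "C1_on UNIV \<beta>" "\<And>y. 0 \<le> \<beta> y \<and> \<beta> y \<le> 1" "\<beta> c = 1" "\<And>y. y \<notin> cball c r \<Longrightarrow> \<beta> y = 0"
proof -
  define \<beta> where "\<beta> y = (max 0 (1 - (y - c) \<bullet> (y - c) / r\<^sup>2))\<^sup>2" for y
  have 1: "C1_on UNIV (\<lambda>y::'e. y - c)"
    using C1_on_add[OF C1_on_linear[of "\<lambda>y. y"] C1_on_const[of UNIV "-c"]] by simp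
  have 2: "C1_on UNIV (\<lambda>y::'e. (y - c) \<bullet> b * ((y - c) \<bullet> b))" for b
    by (intro C1_on_mult C1_on_inner 1)
  have "C1_on UNIV (\<lambda>y::'e. \<Sum>b\<in>A. (y - c) \<bullet> b * ((y - c) \<bullet> b))" if "finite A" for A :: "'e set"
    using that by induction (auto intro!: C1_on_add 2)
  from this[of Basis] have 3: "C1_on UNIV (\<lambda>y::'e. (y - c) \<bullet> (y - c))"
    using euclidean_inner[of "_ - c" "_ - c"] by simp
  have 4: "C1_on UNIV (\<lambda>s::real. (max 0 (1 - s / r\<^sup>2))\<^sup>2)"
  proof (rule C1_on_real)
    show "((\<lambda>s. (max 0 (1 - s / r\<^sup>2))\<^sup>2) has_real_derivative
      2 * max 0 (1 - s / r\<^sup>2) * (- 1 / r\<^sup>2)) (at s)" for s :: real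
      using assms by (intro square_pos_part_DERIV)
         (auto intro!: derivative_eq_intros simp: field_simps eval_nat_numeral)
    show "continuous_on UNIV (\<lambda>s::real. 2 * max 0 (1 - s / r\<^sup>2) * (- 1 / r\<^sup>2))"
      using assms by (intro continuous_intros) auto
  qed
  show ?thesis
  proof
    show "C1_on UNIV \<beta>"
      using C1_on_compose[OF 3 4] unfolding \<beta>_def o_def by simp
    show "0 \<le> \<beta> y \<and> \<beta> y \<le> 1" for y
      unfolding \<beta>_def by (auto intro!: power_le_one)
    show "\<beta> c = 1" unfolding \<beta>_def by simp
    show "\<beta> y = 0" if "y \<notin> cball c r" for y
    proof -
      have "r\<^sup>2 \<le> (norm (y - c))\<^sup>2"
        using that assms by (intro power_mono) (auto simp: dist_norm norm_minus_commute)
      then show ?thesis unfolding \<beta>_def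
        using assms by (simp add: power2_norm_eq_inner field_simps)
    qed
  qed
qed

section \<open>Functions of class C1 on a manifold\<close>

locale C1_manifold =
  fixes \<A> :: "('a::{t2_space, second_countable_topology}, 'e::euclidean_space) chart set"
  assumes atlas: "C1_atlas \<A>"
begin

text \<open>\<open>is_chart\<close> only asserts that some continuous inverse exists, while
  functions and fields are pulled back by \<open>inv_into U h\<close>. Injectivity makes the two
  coincide on the image of U.\<close>

lemma chartD:
  assumes "(U, h) \<in> \<A>"
  shows "open U" "inj_on h U" "continuous_on U h" "continuous_on (h ` U) (inv_into U h)"
    and "open (h ` U)"
proof -
  obtain g where hom: "homeomorphism U (h ` U) h g" and "open U" "open (h ` U)"
    using assms atlas unfolding C1_atlas_def is_chart_def by fastforce
  then show "open U" "open (h ` U)" by auto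
  show i: "inj_on h U"
    using hom unfolding homeomorphism_def by (metis inj_on_inverseI)
  show "continuous_on U h" using hom unfolding homeomorphism_def by blast
  have "inv_into U h y = g y" if "y \<in> h ` U" for y
    using hom that i unfolding homeomorphism_def by auto
  then show "continuous_on (h ` U) (inv_into U h)"
    using hom unfolding homeomorphism_def by (metis (no_types, lifting) continuous_on_cong)
qed

lemma chart_inv [simp]: "(U, h) \<in> \<A> \<Longrightarrow> x \<in> U \<Longrightarrow> inv_into U h (h x) = x"
  using chartD(2) by simp

lemma chart_image_open:
  assumes "(U, h) \<in> \<A>" "open W"
  shows "open (h ` (U \<inter> W))"
proof -
  have "h ` (U \<inter> W) = h ` U \<inter> inv_into U h -` W"
    using assms(1) by auto
  then show ?thesis
    using continuous_open_preimage[OF chartD(4,5)[OF assms(1)] assms(2)] by simp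
qed

lemma ex_chart: obtains U h where "(U, h) \<in> \<A>" "x \<in> U"
proof -
  have "x \<in> (\<Union>(U, h)\<in>\<A>. U)"
    using atlas unfolding C1_atlas_def by simp
  then show ?thesis using that by auto
qed

lemma chart_change: "(U, h) \<in> \<A> \<Longrightarrow> (V, k) \<in> \<A> \<Longrightarrow> C1_on (h ` (U \<inter> V)) (k \<circ> inv_into U h)"
  using atlas unfolding C1_atlas_def by fast

lemma C1_funD: "C1_fun \<A> W f \<Longrightarrow> (U, h) \<in> \<A> \<Longrightarrow> C1_on (h ` (U \<inter> W)) (f \<circ> inv_into U h)"
  unfolding C1_fun_def by blast

lemma C1_fun_subset: "C1_fun \<A> W f \<Longrightarrow> V \<subseteq> W \<Longrightarrow> C1_fun \<A> V f"
  unfolding C1_fun_def by (fastforce elim: C1_on_subset)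

lemma C1_fun_cong:
  assumes "C1_fun \<A> W f" "open W" "\<And>x. x \<in> W \<Longrightarrow> f x = g x"
  shows "C1_fun \<A> W g"
proof -
  have "C1_on (h ` (U \<inter> W)) (g \<circ> inv_into U h)" if c: "(U, h) \<in> \<A>" for U h
    by (rule C1_on_cong[OF C1_funD[OF assms(1) c] chart_image_open[OF c assms(2)]])
       (use assms(3) c in auto)
  then show ?thesis unfolding C1_fun_def by blast
qed

lemma C1_fun_Un:
  assumes "C1_fun \<A> V f" "C1_fun \<A> W f" "open V" "open W"
  shows "C1_fun \<A> (V \<union> W) f"
proof -
  have "C1_on (h ` (U \<inter> (V \<union> W))) (f \<circ> inv_into U h)" if c: "(U, h) \<in> \<A>" for U h
    using C1_on_Un[OF C1_funD[OF assms(1) c] C1_funD[OF assms(2) c]] chart_image_open[OF c] assms(3,4)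
    by (simp add: Int_Un_distrib image_Un)
  then show ?thesis unfolding C1_fun_def by blast
qed

lemma C1_fun_const [simp]: "C1_fun \<A> W (\<lambda>_. c)"
  unfolding C1_fun_def by (auto simp: o_def)

lemma C1_fun_add: "C1_fun \<A> W f \<Longrightarrow> C1_fun \<A> W g \<Longrightarrow> C1_fun \<A> W (\<lambda>x. f x + g x)"
  unfolding C1_fun_def o_def by (fastforce intro: C1_on_add)

lemma C1_fun_mult: "C1_fun \<A> W f \<Longrightarrow> C1_fun \<A> W g \<Longrightarrow> C1_fun \<A> W (\<lambda>x. f x * g x)"
  unfolding C1_fun_def o_def by (fastforce intro: C1_on_mult)

lemma C1_fun_compose:
  assumes "C1_fun \<A> W f" "\<And>s. (T has_real_derivative T' s) (at s)" "continuous_on UNIV T'"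
  shows "C1_fun \<A> W (\<lambda>x. T (f x))"
proof -
  have "C1_on (h ` (U \<inter> W)) (T \<circ> (f \<circ> inv_into U h))" if c: "(U, h) \<in> \<A>" for U h
    by (rule C1_on_compose[OF C1_funD[OF assms(1) c] C1_on_real[of T T' UNIV]]) (use assms in auto)
  then show ?thesis unfolding C1_fun_def by (auto simp: o_def)
qed

lemma C1_fun_continuous:
  assumes "C1_fun \<A> W f" "open W"
  shows "continuous_on W f"
proof -
  have "continuous (at x) f" if "x \<in> W" for x
  proof -
    obtain U h where c: "(U, h) \<in> \<A>" "x \<in> U" by (rule ex_chart)
    have "continuous_on (h ` (U \<inter> W)) (f \<circ> inv_into U h)"
      using C1_on_imp_continuous_on[OF C1_funD[OF assms(1) c(1)]] .
    then have "continuous_on (U \<inter> W) (\<lambda>x. (f \<circ> inv_into U h) (h x))"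
      by (rule continuous_on_compose2) (use continuous_on_subset[OF chartD(3)[OF c(1)]] in auto)
    then have "continuous_on (U \<inter> W) f"
      by (rule continuous_on_eq) (use c in auto)
    then show ?thesis
      using continuous_on_eq_continuous_at open_Int chartD(1)[OF c(1)] assms(2) c(2) that by blast
  qed
  then show ?thesis by (simp add: continuous_at_imp_continuous_on)
qed

text \<open>W and the complement of K are open and cover the manifold; f is C^1 on the first and
  identically zero on the second.\<close>

lemma C1_fun_extend:
  assumes "C1_fun \<A> W f" "open W" "closed K" "K \<subseteq> W" "\<And>x. x \<notin> K \<Longrightarrow> f x = 0"
  shows "C1_fun \<A> UNIV f"
proof -
  have "C1_fun \<A> (- K) f"
    by (rule C1_fun_cong[of _ "\<lambda>_. 0"]) (use assms in auto)
  then have "C1_fun \<A> (W \<union> - K) f"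
    using assms by (intro C1_fun_Un) auto
  then show ?thesis using assms(4) by (metis Compl_subset_Compl_iff Un_commute compl_sup_top sup.absorb_iff2 sup_left_commute sup_top_right)
qed

text \<open>The manifold is Hausdorff, so compact supports are closed and extension by zero
  preserves C^1 regularity. Test functions on an open set thus become globally C^1, and products or
  composites can be formed without restricting to a common domain.\<close>

lemma C1c_iff:
  assumes "open W"
  shows "f \<in> C1c \<A> W \<longleftrightarrow>
    C1_fun \<A> UNIV f \<and> (\<exists>K. compact K \<and> K \<subseteq> W \<and> (\<forall>x. x \<notin> K \<longrightarrow> f x = 0))"
  unfolding C1c_def using C1_fun_extend[OF _ assms] C1_fun_subset[of UNIV f W]
  by (auto dest: compact_imp_closed)

lemma C1c_C1_fun: "open W \<Longrightarrow> f \<in> C1c \<A> W \<Longrightarrow> C1_fun \<A> V f"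
  by (rule C1_fun_subset[of UNIV]) (simp_all add: C1c_iff)

lemma C1c_support:
  assumes "f \<in> C1c \<A> W"
  obtains K where "compact K" "K \<subseteq> W" "\<And>x. x \<notin> K \<Longrightarrow> f x = 0"
  using assms unfolding C1c_def by auto

lemma C1c_outside: "f \<in> C1c \<A> W \<Longrightarrow> x \<notin> W \<Longrightarrow> f x = 0"
  using C1c_support by (metis subsetD)

lemma C1c_mono: "open V \<Longrightarrow> open W \<Longrightarrow> V \<subseteq> W \<Longrightarrow> C1c \<A> V \<subseteq> C1c \<A> W"
  by (simp add: C1c_iff subset_iff) blast

lemma zero_C1c [simp]: "(\<lambda>_. 0) \<in> C1c \<A> W"
  unfolding C1c_def by (auto intro: exI[of _ "{}"])

lemma C1c_add:
  assumes "open W" "f \<in> C1c \<A> W" "g \<in> C1c \<A> W"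
  shows "(\<lambda>x. f x + g x) \<in> C1c \<A> W"
proof -
  obtain K L where "compact K" "K \<subseteq> W" "\<And>x. x \<notin> K \<Longrightarrow> f x = 0"
    "compact L" "L \<subseteq> W" "\<And>x. x \<notin> L \<Longrightarrow> g x = 0"
    using assms C1c_support by metis
  then show ?thesis
    using assms by (auto simp: C1c_iff intro!: C1_fun_add exI[of _ "K \<union> L"])
qed

lemma C1c_mult:
  assumes "open W" "f \<in> C1c \<A> W" "C1_fun \<A> UNIV g"
  shows "(\<lambda>x. f x * g x) \<in> C1c \<A> W" "(\<lambda>x. g x * f x) \<in> C1c \<A> W"
  using assms by (auto simp: C1c_iff intro!: C1_fun_mult)

lemma C1c_compose:
  assumes "open W" "f \<in> C1c \<A> W" "\<And>s. (T has_real_derivative T' s) (at s)"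
    "continuous_on UNIV T'" "T 0 = 0"
  shows "(\<lambda>x. T (f x)) \<in> C1c \<A> W"
  using assms C1_fun_compose[of UNIV f T T'] by (auto simp: C1c_iff)

section \<open>Cutoffs, a partition of unity and an exhaustion on the manifold\<close>

lemma bump:
  assumes "open W" "x \<in> W"
  obtains b where "b \<in> C1c \<A> W" "\<And>y. 0 \<le> b y \<and> b y \<le> 1" "b x = 1"
proof -
  obtain U h where c: "(U, h) \<in> \<A>" "x \<in> U" by (rule ex_chart)
  have "open (h ` (U \<inter> W))" using chart_image_open c(1) assms(1) by blast
  then obtain r where r: "r > 0" "cball (h x) r \<subseteq> h ` (U \<inter> W)"
    using c assms(2) open_contains_cball by (metis IntI image_eqI)
  obtain \<beta> :: "'e \<Rightarrow> real" where \<beta>: "C1_on UNIV \<beta>" "\<And>y. 0 \<le> \<beta> y \<and> \<beta> y \<le> 1"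
    "\<beta> (h x) = 1" "\<And>y. y \<notin> cball (h x) r \<Longrightarrow> \<beta> y = 0"
    using bump_euclidean[OF r(1)] by blast
  define K where "K = inv_into U h ` cball (h x) r"
  define b where "b y = (if y \<in> U then \<beta> (h y) else 0)" for y
  have K: "compact K"
    unfolding K_def by (rule compact_continuous_image)
      (use continuous_on_subset[OF chartD(4)[OF c(1)]] r in auto)
  have KW: "K \<subseteq> U \<inter> W"
    unfolding K_def using r(2) c by auto
  have b0: "b y = 0" if "y \<notin> K" for y
  proof (cases "y \<in> U")
    case True
    then have "h y \<notin> cball (h x) r"
      using that c unfolding K_def by (metis chart_inv image_eqI)
    then show ?thesis unfolding b_def using \<beta>(4) by simp
  qed (simp add: b_def)
  \<comment> \<open>Read in another chart, b is \<beta> after the coordinate change, so the C^1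
    compatibility of the charts is exactly what is used; outside U, b is continued by zero from the
    compact set K.\<close>
  have "C1_on (k ` (V \<inter> U)) (b \<circ> inv_into V k)" if d: "(V, k) \<in> \<A>" for V k
  proof (rule C1_on_cong)
    show "C1_on (k ` (V \<inter> U)) (\<beta> \<circ> (h \<circ> inv_into V k))"
      by (rule C1_on_compose[OF chart_change[OF d c(1)] \<beta>(1)]) auto
    show "open (k ` (V \<inter> U))" using chart_image_open[OF d] chartD(1)[OF c(1)] .
  qed (use d in \<open>auto simp: b_def\<close>)
  then have "C1_fun \<A> U b" unfolding C1_fun_def by blast
  then have "C1_fun \<A> UNIV b"
    using C1_fun_extend chartD(1)[OF c(1)] compact_imp_closed[OF K] KW b0 by blast
  then have "b \<in> C1c \<A> W"
    using K KW b0 assms(1) by (auto simp: C1c_iff)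
  then show ?thesis
    by (rule that) (use \<beta> c in \<open>auto simp: b_def\<close>)
qed

text \<open>A bump may equal 1 only at its centre. Composing it with the one-variable cutoff of
  threshold 1/2 gives the value 1 on the open set where the bump exceeds 1/2.\<close>

lemma local_cutoff:
  assumes "open W" "x \<in> W"
  obtains \<eta> N where "\<eta> \<in> C1c \<A> W" "\<And>y. 0 \<le> \<eta> y \<and> \<eta> y \<le> 1" "open N" "x \<in> N" "\<And>y. y \<in> N \<Longrightarrow> \<eta> y = 1"
proof -
  obtain b where b: "b \<in> C1c \<A> W" "\<And>y. 0 \<le> b y \<and> b y \<le> 1" "b x = 1"
    using bump assms by blast
  obtain T T' :: "real \<Rightarrow> real" where T: "\<And>s. (T has_real_derivative T' s) (at s)"
    "continuous_on UNIV T'" "T 0 = 0" "\<And>s. 0 \<le> T s \<and> T s \<le> 1" "\<And>s. \<bar>s\<bar> \<ge> 1/2 \<Longrightarrow> T s = 1 \<and> T' s = 0"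
    using cutoff_real[of "1/2"] by (metis half_gt_zero zero_less_one)
  have "continuous_on UNIV b"
    using C1_fun_continuous[OF C1c_C1_fun[OF assms(1) b(1)] open_UNIV] .
  then have "open {y. 1/2 < b y}"
    by (intro open_Collect_less continuous_intros) auto
  then show ?thesis
    using T b by (intro that[of "\<lambda>y. T (b y)" "{y. 1/2 < b y}"] C1c_compose[OF assms(1) b(1) T(1-3)]) auto
qed

text \<open>The open set may depend on the point: a constant W yields a cutoff near a compact set,
  and W intersected with chart domains yields the pieces of a partition of unity.\<close>

lemma finite_local_cutoffs:
  assumes "compact K" "\<forall>x\<in>K. open (W x) \<and> x \<in> W x"
  shows "\<exists>I \<eta> N. finite I \<and> I \<subseteq> K \<and> K \<subseteq> (\<Union>i\<in>I. N i) \<and>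
    (\<forall>i\<in>I. \<eta> i \<in> C1c \<A> (W i) \<and> (\<forall>y. 0 \<le> \<eta> i y \<and> \<eta> i y \<le> 1) \<and> open (N i) \<and> (\<forall>y\<in>N i. \<eta> i y = 1))"
proof -
  have "\<forall>x\<in>K. \<exists>\<eta> N. \<eta> \<in> C1c \<A> (W x) \<and> (\<forall>y. 0 \<le> \<eta> y \<and> \<eta> y \<le> 1) \<and> open N \<and> x \<in> N \<and> (\<forall>y\<in>N. \<eta> y = 1)"
    using local_cutoff assms(2) by metis
  then obtain \<eta> N where *: "\<And>x. x \<in> K \<Longrightarrow> \<eta> x \<in> C1c \<A> (W x) \<and> (\<forall>y. 0 \<le> \<eta> x y \<and> \<eta> x y \<le> 1)
      \<and> open (N x) \<and> x \<in> N x \<and> (\<forall>y\<in>N x. \<eta> x y = 1)"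
    by metis
  obtain I where "I \<subseteq> K" "finite I" "K \<subseteq> (\<Union>i\<in>I. N i)"
    by (rule compactE_image[OF assms(1), of K N]) (use * in auto)
  then show ?thesis
    using * by (intro exI[of _ I] exI[of _ \<eta>] exI[of _ N]) auto
qed

lemma C1_fun_one_minus: "C1_fun \<A> W f \<Longrightarrow> C1_fun \<A> W (\<lambda>x. 1 - f x)"
  by (rule C1_fun_compose[of W f "\<lambda>s. 1 - s" "\<lambda>_. -1"])
     (auto intro!: derivative_eq_intros)

text \<open>For \<eta> i in [0, 1] this combination stays in [0, 1] and equals 1 as soon as one
  \<eta> i does, so cutoffs can be united without dividing by their sum. The induction rests on 1 -
  (1 - \<eta>) P = \<eta> + (1 - \<eta>) (1 - P).\<close>

lemma one_minus_prod_C1c: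
  assumes "open W" "finite I" "\<And>i. i \<in> I \<Longrightarrow> \<eta> i \<in> C1c \<A> W"
  shows "(\<lambda>x. 1 - (\<Prod>i\<in>I. 1 - \<eta> i x)) \<in> C1c \<A> W"
  using assms(2,3)
proof induction
  case (insert i I)
  have i: "\<eta> i \<in> C1c \<A> W" and I: "(\<lambda>x. 1 - (\<Prod>i\<in>I. 1 - \<eta> i x)) \<in> C1c \<A> W"
    using insert by auto
  have "(\<lambda>x. \<eta> i x + (1 - \<eta> i x) * (1 - (\<Prod>i\<in>I. 1 - \<eta> i x))) \<in> C1c \<A> W"
    by (rule C1c_add[OF assms(1) i C1c_mult(2)[OF assms(1) I C1_fun_one_minus[OF C1c_C1_fun[OF assms(1) i]]]])
  then show ?case using insert by (simp add: algebra_simps)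
qed simp

lemma one_minus_prod_bounds:
  fixes \<eta> :: "'i \<Rightarrow> real"
  assumes "\<And>i. i \<in> I \<Longrightarrow> 0 \<le> \<eta> i \<and> \<eta> i \<le> 1"
  shows "0 \<le> 1 - (\<Prod>i\<in>I. 1 - \<eta> i) \<and> 1 - (\<Prod>i\<in>I. 1 - \<eta> i) \<le> 1"
  using prod_nonneg[of I "\<lambda>i. 1 - \<eta> i"] prod_le_1[of I "\<lambda>i. 1 - \<eta> i"] assms by fastforce

lemma cutoff:
  assumes "compact K" "open W" "K \<subseteq> W"
  obtains \<eta> N where "\<eta> \<in> C1c \<A> W" "\<And>y. 0 \<le> \<eta> y \<and> \<eta> y \<le> 1" "open N" "K \<subseteq> N" "\<And>y. y \<in> N \<Longrightarrow> \<eta> y = 1"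
proof -
  have W: "\<forall>x\<in>K. open W \<and> x \<in> W" using assms by blast
  obtain I \<eta> N where *: "finite I" "I \<subseteq> K" "K \<subseteq> (\<Union>i\<in>I. N i)"
    and \<eta>: "\<forall>i\<in>I. \<eta> i \<in> C1c \<A> W \<and> (\<forall>y. 0 \<le> \<eta> i y \<and> \<eta> i y \<le> 1) \<and> open (N i) \<and> (\<forall>y\<in>N i. \<eta> i y = 1)"
    using finite_local_cutoffs[where W = "\<lambda>_. W", OF assms(1) W] by (elim exE conjE) (rule that)
  show ?thesis
  proof
    show "(\<lambda>x. 1 - (\<Prod>i\<in>I. 1 - \<eta> i x)) \<in> C1c \<A> W"
      using one_minus_prod_C1c[OF assms(2) *(1), of \<eta>] \<eta> by blast
    show "open (\<Union>i\<in>I. N i)" using \<eta> by blast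
    show "1 - (\<Prod>i\<in>I. 1 - \<eta> i y) = 1" if "y \<in> (\<Union>i\<in>I. N i)" for y
    proof -
      have "(\<Prod>i\<in>I. 1 - \<eta> i y) = 0"
        using that *(1) \<eta> by (intro prod_zero) auto
      then show ?thesis by simp
    qed
    show "0 \<le> 1 - (\<Prod>i\<in>I. 1 - \<eta> i y) \<and> 1 - (\<Prod>i\<in>I. 1 - \<eta> i y) \<le> 1" for y
      using \<eta> by (intro one_minus_prod_bounds) blast
  qed (rule *(3))
qed

text \<open>Partition of unity in the form of an induction rule: a function is peeled off as
  \<open>\<phi> = \<phi> \<eta> + \<phi> (1 - \<eta>)\<close>, one chart domain at a time.\<close>

lemma C1c_chart_induct:
  assumes "open W" "\<phi> \<in> C1c \<A> W"
    and zero: "P (\<lambda>_. 0)"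
    and add: "\<And>f g. f \<in> C1c \<A> W \<Longrightarrow> g \<in> C1c \<A> W \<Longrightarrow> P f \<Longrightarrow> P g \<Longrightarrow> P (\<lambda>x. f x + g x)"
    and chart: "\<And>U h f. (U, h) \<in> \<A> \<Longrightarrow> f \<in> C1c \<A> (W \<inter> U) \<Longrightarrow> P f"
  shows "P \<phi>"
proof -
  obtain K where K: "compact K" "K \<subseteq> W" "\<And>x. x \<notin> K \<Longrightarrow> \<phi> x = 0"
    using C1c_support[OF assms(2)] by metis
  have "\<exists>c. c \<in> \<A> \<and> x \<in> fst c" for x
    using ex_chart by (metis fst_conv)
  then obtain c where c: "\<And>x. c x \<in> \<A> \<and> x \<in> fst (c x)" by metis
  define U where "U x = fst (c x)" for x
  have U: "(U x, snd (c x)) \<in> \<A>" "x \<in> U x" for x using c unfolding U_def by auto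
  have WU: "\<forall>x\<in>K. open (W \<inter> U x) \<and> x \<in> W \<inter> U x"
    using assms(1) K(2) U chartD(1)[OF U(1)] by blast
  obtain I \<eta> N where *: "finite I" "I \<subseteq> K" "K \<subseteq> (\<Union>i\<in>I. N i)"
    and \<eta>I: "\<forall>i\<in>I. \<eta> i \<in> C1c \<A> (W \<inter> U i) \<and> (\<forall>y. 0 \<le> \<eta> i y \<and> \<eta> i y \<le> 1) \<and> open (N i) \<and> (\<forall>y\<in>N i. \<eta> i y = 1)"
    using finite_local_cutoffs[where W = "\<lambda>x. W \<inter> U x", OF K(1) WU] by (elim exE conjE) (rule that)
  \<comment> \<open>The induction keeps the property that wherever f is nonzero some \<eta> i with i
    in J equals 1. Multiplying by 1 - \<eta> i removes the points where \<eta> i = 1, so the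
    remainder has the property for the smaller set; for J empty the function is zero.\<close>
  have "f \<in> C1c \<A> W \<Longrightarrow> (\<And>x. f x \<noteq> 0 \<Longrightarrow> \<exists>i\<in>J. \<eta> i x = 1) \<Longrightarrow> P f"
    if "finite J" "J \<subseteq> I" for J f
    using that
  proof (induction J arbitrary: f)
    case empty
    then have "f = (\<lambda>_. 0)" by auto
    then show ?case using zero by simp
  next
    case (insert i J)
    have op: "open (W \<inter> U i)" using assms(1) chartD(1)[OF U(1)] by blast
    have \<eta>: "\<eta> i \<in> C1c \<A> (W \<inter> U i)" "\<eta> i \<in> C1c \<A> W"
      using insert.prems \<eta>I C1c_mono[OF op assms(1)] by auto
    have f: "C1_fun \<A> UNIV f" using C1c_C1_fun assms(1) insert.prems(1) by blast
    have 1: "(\<lambda>x. f x * \<eta> i x) \<in> C1c \<A> (W \<inter> U i)"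
      using C1c_mult(2)[OF op \<eta>(1) f] .
    have 2: "(\<lambda>x. f x * (1 - \<eta> i x)) \<in> C1c \<A> W"
      by (rule C1c_mult[OF assms(1) insert.prems(1) C1_fun_one_minus[OF C1c_C1_fun[OF assms(1) \<eta>(2)]]])
    have "P (\<lambda>x. f x * (1 - \<eta> i x))"
      by (rule insert.IH[OF 2]) (use insert in auto)
    moreover have "P (\<lambda>x. f x * \<eta> i x)" using chart[OF U(1) 1] .
    ultimately have "P (\<lambda>x. f x * \<eta> i x + f x * (1 - \<eta> i x))"
      using add 1 2 C1c_mono[OF op assms(1)] by blast
    then show ?case by (simp add: algebra_simps)
  qed
  moreover have "\<exists>i\<in>I. \<eta> i x = 1" if "\<phi> x \<noteq> 0" for x
  proof -
    have "x \<in> K" using K(3) that by blast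
    then show ?thesis using *(3) \<eta>I by blast
  qed
  ultimately show ?thesis using *(1) assms(2) by blast
qed

text \<open>Second countability reduces the neighbourhoods on which local cutoffs equal 1 to
  countably many (Lindelof), and the first n of these cutoffs are combined. The sequence tends to
  the indicator of W pointwise and boundedly, which lets test functions stand in for open sets under
  the integral.\<close>

lemma exhaustion:
  assumes "open W"
  obtains s :: "nat \<Rightarrow> 'a \<Rightarrow> real" where "\<And>n. s n \<in> C1c \<A> W" "\<And>n x. 0 \<le> s n x \<and> s n x \<le> 1"
    "\<And>x. x \<in> W \<Longrightarrow> \<forall>\<^sub>F n in sequentially. s n x = 1"
\<comment> \<open>The enumeration by natural numbers needs a nonempty index set, so the empty set is
  treated apart.\<close>
proof (cases "W = {}")
  case True
  then show ?thesis using that[of "\<lambda>_ _. 0"] by simp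
next
  case False
  have "\<forall>x\<in>W. \<exists>\<eta> N. \<eta> \<in> C1c \<A> W \<and> (\<forall>y. 0 \<le> \<eta> y \<and> \<eta> y \<le> 1) \<and> open N \<and> x \<in> N \<and> (\<forall>y\<in>N. \<eta> y = 1)"
    using local_cutoff assms by metis
  then obtain \<eta> N where *: "\<And>x. x \<in> W \<Longrightarrow> \<eta> x \<in> C1c \<A> W \<and> (\<forall>y. 0 \<le> \<eta> x y \<and> \<eta> x y \<le> 1)
      \<and> open (N x) \<and> x \<in> N x \<and> (\<forall>y\<in>N x. \<eta> x y = 1)"
    by metis
  obtain F where F: "F \<subseteq> N ` W" "countable F" "\<Union>F = \<Union>(N ` W)"
    using Lindelof[of "N ` W"] * by auto
  obtain C where C: "C \<subseteq> W" "countable C" "F = N ` C"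
    using F(1,2) by (metis countable_subset_image)
  have "W \<subseteq> \<Union>(N ` W)" using * by auto
  then have cover: "W \<subseteq> (\<Union>i\<in>C. N i)" using F(3) C(3) by simp
  then have "C \<noteq> {}" using False by auto
  then obtain e :: "nat \<Rightarrow> 'a" where e: "range e = C"
    using C(2) by (metis uncountable_def)
  define s where "s n x = 1 - (\<Prod>i<n. 1 - \<eta> (e i) x)" for n x
  have eW: "e i \<in> W" for i using e C(1) by auto
  show ?thesis
  proof
    show "s n \<in> C1c \<A> W" for n
      unfolding s_def using * eW by (intro one_minus_prod_C1c assms) auto
    show "0 \<le> s n x \<and> s n x \<le> 1" for n x
      unfolding s_def using * eW by (intro one_minus_prod_bounds) auto
    show "\<forall>\<^sub>F n in sequentially. s n x = 1" if xW: "x \<in> W" for x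
    proof -
      obtain i where i: "x \<in> N (e i)" using xW cover e by auto
      then have "\<eta> (e i) x = 1" using * eW by auto
      then have "s n x = 1" if "n > i" for n
        unfolding s_def using that prod_zero[of "{..<n}" "\<lambda>i. 1 - \<eta> (e i) x"] by auto
      then show ?thesis
        unfolding eventually_sequentially by (meson Suc_le_eq)
    qed
  qed
qed

section \<open>Derivatives along vector fields\<close>

text \<open>\<open>vf_deriv\<close> works in a chart picked by \<open>SOME\<close>. On passing to
  the given chart, the chain rule for f and the transformation law for the components of X both
  bring in the derivative of the same coordinate change, and the two expressions match.\<close>

lemma vf_deriv_chart:
  assumes X: "vector_field \<A> W X" and f: "C1_fun \<A> W f" and W: "open W"
    and c: "(U, h) \<in> \<A>" and x: "x \<in> U" "x \<in> W"
  shows "vf_deriv \<A> X f x = frechet_derivative (f \<circ> inv_into U h) (at (h x)) (X (U, h) x)"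
proof -
  define d where "d = (SOME c. c \<in> \<A> \<and> x \<in> fst c)"
  obtain V k where d: "d = (V, k)" by (cases d)
  have "d \<in> \<A> \<and> x \<in> fst d"
    unfolding d_def by (rule someI[of _ "(U, h)"]) (use c x in auto)
  then have Vk: "(V, k) \<in> \<A>" "x \<in> V" using d by auto
  have eq: "vf_deriv \<A> X f x = frechet_derivative (f \<circ> inv_into V k) (at (k x)) (X (V, k) x)"
    unfolding vf_deriv_def using d unfolding d_def by simp
  define \<tau> where "\<tau> = k \<circ> inv_into U h"
  have t: "\<tau> (h x) = k x" unfolding \<tau>_def using c x by simp
  have hx: "h x \<in> h ` (U \<inter> V)" using x Vk by auto
  have d1: "(\<tau> has_derivative frechet_derivative \<tau> (at (h x))) (at (h x))"
    unfolding \<tau>_def using C1_on_has_derivative[OF chart_change[OF c Vk(1)] hx] .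
  have "(f \<circ> inv_into V k has_derivative frechet_derivative (f \<circ> inv_into V k) (at (k x))) (at (k x))"
    using C1_on_has_derivative[OF C1_funD[OF f Vk(1)]] Vk x by blast
  then have d2: "(f \<circ> inv_into V k \<circ> \<tau> has_derivative
      frechet_derivative (f \<circ> inv_into V k) (at (k x)) \<circ> frechet_derivative \<tau> (at (h x))) (at (h x))"
    using diff_chain_at[OF d1, of "f \<circ> inv_into V k"] t by simp
  have "(f \<circ> inv_into U h has_derivative
      frechet_derivative (f \<circ> inv_into V k) (at (k x)) \<circ> frechet_derivative \<tau> (at (h x))) (at (h x))"
    by (rule has_derivative_transform_within_open[OF d2 chart_image_open[OF c chartD(1)[OF Vk(1)]] hx])
       (use c Vk in \<open>auto simp: \<tau>_def\<close>)
  then have "frechet_derivative (f \<circ> inv_into U h) (at (h x)) =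
      frechet_derivative (f \<circ> inv_into V k) (at (k x)) \<circ> frechet_derivative \<tau> (at (h x))"
    using frechet_derivative_at by metis
  moreover have "X (V, k) x = frechet_derivative \<tau> (at (h x)) (X (U, h) x)"
    using X c Vk x unfolding vector_field_def \<tau>_def by fastforce
  ultimately show ?thesis using eq by simp
qed

text \<open>The chart picked depends on the point alone, not on the field or the function. Sum,
  product and chain rules therefore reduce to one common chart and to the corresponding rules for
  Frechet derivatives.\<close>

lemma vf_deriv_some_chart:
  obtains U h where "(U, h) \<in> \<A>" "x \<in> U"
    "\<And>X f. vf_deriv \<A> X f x = frechet_derivative (f \<circ> inv_into U h) (at (h x)) (X (U, h) x)"
proof -
  define d where "d = (SOME c. c \<in> \<A> \<and> x \<in> fst c)"
  obtain V k where d: "d = (V, k)" by (cases d)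
  have "\<exists>c. c \<in> \<A> \<and> x \<in> fst c" using ex_chart by (metis fst_conv)
  then have "d \<in> \<A> \<and> x \<in> fst d"
    unfolding d_def by (rule someI_ex)
  then show ?thesis
    using that[of V k] d unfolding vf_deriv_def d_def by simp
qed

lemma C1_fun_derivative:
  assumes "C1_fun \<A> W f" "x \<in> W" "(U, h) \<in> \<A>" "x \<in> U"
  shows "(f \<circ> inv_into U h has_derivative frechet_derivative (f \<circ> inv_into U h) (at (h x))) (at (h x))"
  using C1_on_has_derivative[OF C1_funD] assms by blast

lemma vf_deriv_cong:
  assumes "open N" "x \<in> N" "\<And>y. y \<in> N \<Longrightarrow> f y = g y" "C1_fun \<A> N f"
  shows "vf_deriv \<A> X f x = vf_deriv \<A> X g x"
proof -
  obtain U h where c: "(U, h) \<in> \<A>" "x \<in> U"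
    and e: "\<And>X f. vf_deriv \<A> X f x = frechet_derivative (f \<circ> inv_into U h) (at (h x)) (X (U, h) x)"
    using vf_deriv_some_chart by blast
  have "(g \<circ> inv_into U h has_derivative frechet_derivative (f \<circ> inv_into U h) (at (h x))) (at (h x))"
    by (rule has_derivative_transform_within_open[OF C1_fun_derivative[OF assms(4,2) c]
          chart_image_open[OF c(1) assms(1)]])
       (use assms c in auto)
  from frechet_derivative_at[OF this, symmetric] show ?thesis using e by simp
qed

lemma vf_deriv_const [simp]: "vf_deriv \<A> X (\<lambda>_. c) x = 0"
proof -
  obtain U h where e: "\<And>X f. vf_deriv \<A> X f x = frechet_derivative (f \<circ> inv_into U h) (at (h x)) (X (U, h) x)"
    using vf_deriv_some_chart by blast
  show ?thesis using e by (simp add: o_def)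
qed

lemma vf_deriv_zero:
  assumes "closed K" "x \<notin> K" "\<And>x. x \<notin> K \<Longrightarrow> f x = 0"
  shows "vf_deriv \<A> X f x = 0"
  using vf_deriv_cong[of "- K" x "\<lambda>_. 0" f X] assms by auto

lemma vf_deriv_add:
  assumes "C1_fun \<A> W f" "C1_fun \<A> W g" "x \<in> W"
  shows "vf_deriv \<A> X (\<lambda>x. f x + g x) x = vf_deriv \<A> X f x + vf_deriv \<A> X g x"
proof -
  obtain U h where c: "(U, h) \<in> \<A>" "x \<in> U"
    and e: "\<And>X f. vf_deriv \<A> X f x = frechet_derivative (f \<circ> inv_into U h) (at (h x)) (X (U, h) x)"
    using vf_deriv_some_chart by blast
  from has_derivative_add[OF C1_fun_derivative[OF assms(1,3) c] C1_fun_derivative[OF assms(2,3) c]]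
  have "((\<lambda>x. f x + g x) \<circ> inv_into U h has_derivative (\<lambda>v.
      frechet_derivative (f \<circ> inv_into U h) (at (h x)) v + frechet_derivative (g \<circ> inv_into U h) (at (h x)) v))
      (at (h x))"
    by (simp add: o_def)
  from frechet_derivative_at[OF this, symmetric] show ?thesis using e by simp
qed

lemma vf_deriv_mult:
  assumes "C1_fun \<A> W f" "C1_fun \<A> W g" "x \<in> W"
  shows "vf_deriv \<A> X (\<lambda>x. f x * g x) x = f x * vf_deriv \<A> X g x + g x * vf_deriv \<A> X f x"
proof -
  obtain U h where c: "(U, h) \<in> \<A>" "x \<in> U"
    and e: "\<And>X f. vf_deriv \<A> X f x = frechet_derivative (f \<circ> inv_into U h) (at (h x)) (X (U, h) x)"
    using vf_deriv_some_chart by blast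
  from has_derivative_mult[OF C1_fun_derivative[OF assms(1,3) c] C1_fun_derivative[OF assms(2,3) c]]
  have "((\<lambda>x. f x * g x) \<circ> inv_into U h has_derivative (\<lambda>v.
      f x * frechet_derivative (g \<circ> inv_into U h) (at (h x)) v + frechet_derivative (f \<circ> inv_into U h) (at (h x)) v * g x))
      (at (h x))"
    using c by (simp add: o_def)
  from frechet_derivative_at[OF this, symmetric] show ?thesis using e by (simp add: mult.commute)
qed

lemma vf_deriv_compose:
  assumes "C1_fun \<A> W f" "x \<in> W" "(T has_real_derivative T') (at (f x))"
  shows "vf_deriv \<A> X (\<lambda>x. T (f x)) x = T' * vf_deriv \<A> X f x"
proof -
  obtain U h where c: "(U, h) \<in> \<A>" "x \<in> U"
    and e: "\<And>X f. vf_deriv \<A> X f x = frechet_derivative (f \<circ> inv_into U h) (at (h x)) (X (U, h) x)"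
    using vf_deriv_some_chart by blast
  have "(T has_derivative (*) T') (at ((f \<circ> inv_into U h) (h x)))"
    using assms(3) c by (simp add: has_field_derivative_def)
  from diff_chain_at[OF C1_fun_derivative[OF assms(1,2) c] this]
  have "((\<lambda>x. T (f x)) \<circ> inv_into U h has_derivative
      (*) T' \<circ> frechet_derivative (f \<circ> inv_into U h) (at (h x))) (at (h x))"
    by (simp add: o_def)
  from frechet_derivative_at[OF this, symmetric] show ?thesis using e by simp
qed

lemma C1_vector_field_imp_C0:
  assumes "C1_vector_field \<A> UNIV X"
  shows "C0_vector_field \<A> W X"
proof -
  have "continuous_on (U \<inter> W) (X (U, h))" if c: "(U, h) \<in> \<A>" for U h
  proof -
    have "C1_on (h ` U) (X (U, h) \<circ> inv_into U h)"
      using assms c unfolding C1_vector_field_def by auto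
    then have "continuous_on U (\<lambda>x. (X (U, h) \<circ> inv_into U h) (h x))"
      using continuous_on_compose2[OF C1_on_imp_continuous_on chartD(3)[OF c]] by blast
    then have "continuous_on U (X (U, h))"
      by (rule continuous_on_eq) (use c in auto)
    then show ?thesis using continuous_on_subset by blast
  qed
  moreover have "vector_field \<A> W X"
    using assms unfolding C1_vector_field_def vector_field_def by blast
  ultimately show ?thesis unfolding C0_vector_field_def by blast
qed

text \<open>The chart picked by \<open>vf_deriv\<close> may jump from point to point. Near x the
  expression is rewritten in one fixed chart, where it is a continuous derivative applied to
  continuous components.\<close>

lemma vf_deriv_continuous:
  assumes X: "C0_vector_field \<A> W X" and f: "C1_fun \<A> W f" and W: "open W"
  shows "continuous_on W (vf_deriv \<A> X f)"
proof -
  have "continuous (at x) (vf_deriv \<A> X f)" if "x \<in> W" for x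
  proof -
    obtain U h where c: "(U, h) \<in> \<A>" "x \<in> U" by (rule ex_chart)
    have X': "vector_field \<A> W X" "continuous_on (U \<inter> W) (X (U, h))"
      using X c unfolding C0_vector_field_def by auto
    have "inv_into U h ` (h ` (U \<inter> W)) \<subseteq> U \<inter> W" using c by auto
    then have "continuous_on (h ` (U \<inter> W)) (\<lambda>y. X (U, h) (inv_into U h y))"
      using continuous_on_compose2[OF X'(2)] continuous_on_subset[OF chartD(4)[OF c(1)]]
      by (metis inf_le1 image_mono)
    from C1_on_continuous_derivative[OF C1_funD[OF f c(1)] this]
    have "continuous_on (U \<inter> W) (\<lambda>x. frechet_derivative (f \<circ> inv_into U h) (at (h x)) (X (U, h) (inv_into U h (h x))))"
      by (rule continuous_on_compose2[of "h ` (U \<inter> W)" _ "U \<inter> W" h])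
         (use continuous_on_subset[OF chartD(3)[OF c(1)]] in auto)
    then have "continuous_on (U \<inter> W) (vf_deriv \<A> X f)"
      by (rule continuous_on_eq) (use c vf_deriv_chart[OF X'(1) f W c(1)] in auto)
    then show ?thesis
      using continuous_on_eq_continuous_at open_Int chartD(1)[OF c(1)] W c(2) that by blast
  qed
  then show ?thesis by (simp add: continuous_at_imp_continuous_on)
qed

end

section \<open>Integration by parts\<close>

lemma continuous_on_compact_bound:
  fixes f :: "'b::topological_space \<Rightarrow> real"
  assumes "compact K" "continuous_on S f" "K \<subseteq> S"
  obtains M where "\<And>y. y \<in> K \<Longrightarrow> \<bar>f y\<bar> \<le> M"
proof -
  have "bounded (f ` K)"
    using compact_continuous_image[OF continuous_on_subset[OF assms(2,3)] assms(1)] compact_imp_bounded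
    by blast
  then show ?thesis using that unfolding bounded_iff by auto
qed

text \<open>By translation invariance of Lebesgue measure, the difference quotients have integral zero.\<close>

lemma integral_directional_derivative:
  fixes g :: "'e::euclidean_space \<Rightarrow> real"
  assumes g: "C1_on UNIV g" and K: "compact K" and g0: "\<And>y. y \<notin> K \<Longrightarrow> g y = 0"
  shows "integrable lborel (\<lambda>y. frechet_derivative g (at y) b)"
    and "(LBINT y. frechet_derivative g (at y) b) = 0"
proof -
  define D where "D y = frechet_derivative g (at y) b" for y
  have dg: "(g has_derivative frechet_derivative g (at y)) (at y)" for y
    using C1_on_has_derivative[OF g] by simp
  have cD: "continuous_on UNIV D"
    unfolding D_def by (rule C1_on_continuous_derivative[OF g]) simp
  have cg: "continuous_on UNIV g" by (rule C1_on_imp_continuous_on[OF g])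
  have D0: "D y = 0" if "y \<notin> K" for y
  proof -
    have "((\<lambda>_. 0) has_derivative frechet_derivative g (at y)) (at y)"
      by (rule has_derivative_transform_within_open[OF dg, where s = "- K"])
         (use K that g0 in \<open>auto dest: compact_imp_closed\<close>)
    then have "frechet_derivative g (at y) = (\<lambda>_. 0)"
      using has_derivative_unique has_derivative_const by blast
    then show ?thesis unfolding D_def by simp
  qed
  obtain M where M: "\<And>y. y \<in> K \<Longrightarrow> \<bar>D y\<bar> \<le> M"
    using continuous_on_compact_bound[OF K cD subset_UNIV] by metis
  \<comment> \<open>The maximum with 0 covers the points outside K and an empty K, for which M may
    be negative.\<close>
  have M': "\<bar>D y\<bar> \<le> max 0 M" for y
    using M[of y] D0[of y] by (cases "y \<in> K") auto
  obtain R where R: "K \<subseteq> cball 0 R"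
    using compact_imp_bounded[OF K] unfolding bounded_iff by (auto simp: subset_iff)
  \<comment> \<open>Enlarging the ball by the norm of b makes every segment from y to y + b with y
    outside C miss K, so all difference quotients with step at most 1 are supported in one bounded
    set.\<close>
  define C where "C = cball (0::'e) (R + norm b)"
  have outC: "y + t *\<^sub>R b \<notin> K" if "y \<notin> C" "0 \<le> t" "t \<le> 1" for y t
  proof
    assume "y + t *\<^sub>R b \<in> K"
    then have "norm (y + t *\<^sub>R b) \<le> R" using R by auto
    moreover have "norm y \<le> norm (y + t *\<^sub>R b) + norm (t *\<^sub>R b)"
      using norm_triangle_ineq4[of "y + t *\<^sub>R b" "t *\<^sub>R b"] by simp
    moreover have "norm (t *\<^sub>R b) \<le> norm b"
      using that by (simp add: mult_left_le_one_le)
    ultimately show False using that(1) unfolding C_def by simp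
  qed
  have mC: "C \<in> sets lborel" "emeasure lborel C < \<infinity>"
    unfolding C_def using emeasure_bounded_finite[of "cball (0::'e) (R + norm b)"] by auto
  have outK: "y \<notin> K" if "y \<notin> C" for y using outC[OF that, of 0] by simp
  have ig: "integrable lborel g"
  proof -
    obtain B where B: "\<And>y. y \<in> K \<Longrightarrow> \<bar>g y\<bar> \<le> B"
      using continuous_on_compact_bound[OF K cg subset_UNIV] by metis
    have "\<bar>g y\<bar> \<le> max 0 B" for y using B[of y] g0[of y] by (cases "y \<in> K") auto
    then show ?thesis
      using mC borel_measurable_continuous_onI[OF cg] g0 outK
      by (intro integrableI_bounded_set[where A = C and B = "max 0 B"]) auto
  qed
  define t where "t n = 1 / real (Suc n)" for n
  have t: "0 < t n" "t n \<le> 1" for n unfolding t_def by auto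
  define q where "q n y = (g (y + t n *\<^sub>R b) - g y) / t n" for n y
  have line: "((\<lambda>s. g (y + s *\<^sub>R b)) has_real_derivative D (y + s *\<^sub>R b)) (at s)" for y s
  proof -
    have "((\<lambda>s. y + s *\<^sub>R b) has_derivative (\<lambda>s. s *\<^sub>R b)) (at s)"
      by (auto intro!: derivative_eq_intros)
    from diff_chain_at[OF this dg]
    have "((\<lambda>s. g (y + s *\<^sub>R b)) has_derivative (\<lambda>r. frechet_derivative g (at (y + s *\<^sub>R b)) (r *\<^sub>R b))) (at s)"
      by (simp add: o_def)
    moreover have "frechet_derivative g (at (y + s *\<^sub>R b)) (r *\<^sub>R b) = D (y + s *\<^sub>R b) * r" for r
      unfolding D_def using linear_cmul[OF has_derivative_linear[OF dg]] by (simp add: linear_scale[OF has_derivative_linear[OF dg]])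
    ultimately show ?thesis by (simp add: has_field_derivative_def)
  qed
  \<comment> \<open>The mean value theorem along the segment turns the bound on the derivative into
    a bound on the quotients that is uniform in n.\<close>
  have qb: "norm (q n y) \<le> indicator C y * max 0 M" for n y
  proof (cases "y \<in> C")
    case True
    have "\<exists>z>0. z < t n \<and> g (y + t n *\<^sub>R b) - g (y + 0 *\<^sub>R b) = (t n - 0) * D (y + z *\<^sub>R b)"
      by (rule MVT2) (use t line in auto)
    then obtain z where "g (y + t n *\<^sub>R b) - g y = t n * D (y + z *\<^sub>R b)" by auto
    then have "q n y = D (y + z *\<^sub>R b)" unfolding q_def using t[of n] by simp
    then show ?thesis using True M' by simp
  next
    case False
    then show ?thesis
      using outC[OF False, of "t n"] outK[OF False] g0 t[of n] unfolding q_def by simp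
  qed
  have qlim: "(\<lambda>n. q n y) \<longlonglongrightarrow> D y" for y
  proof -
    have "((\<lambda>s. (g (y + s *\<^sub>R b) - g y) / s) \<longlongrightarrow> D y) (at 0)"
      using line[of y 0] by (simp add: DERIV_def)
    moreover have "filterlim t (at 0) sequentially"
    proof -
      have "t \<longlonglongrightarrow> 0"
        using LIMSEQ_inverse_real_of_nat by (simp add: t_def[abs_def] inverse_eq_divide)
      moreover have "t n \<noteq> 0" for n using t(1)[of n] by linarith
      ultimately show ?thesis unfolding filterlim_at by auto
    qed
    ultimately show ?thesis unfolding q_def by (rule filterlim_compose)
  qed
  have shift: "integrable lborel (\<lambda>y. g (y + c))" "(LBINT y. g (y + c)) = (LBINT y. g y)" for c
  proof -
    have "integrable (distr lborel borel ((+) c)) g"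
      using ig by (simp add: lborel_distr_plus)
    then show "integrable lborel (\<lambda>y. g (y + c))"
      using borel_measurable_continuous_onI[OF cg]
      by (subst (asm) integrable_distr_eq) (auto simp: add.commute)
    have "(LBINT y. g y) = (\<integral>y. g y \<partial>(distr lborel borel ((+) c)))"
      by (simp add: lborel_distr_plus)
    also have "\<dots> = (LBINT y. g (c + y))"
      using borel_measurable_continuous_onI[OF cg] by (intro integral_distr) auto
    finally show "(LBINT y. g (y + c)) = (LBINT y. g y)" by (simp add: add.commute)
  qed
  have q0: "(LBINT y. q n y) = 0" for n
    unfolding q_def using shift ig by simp
  have iw: "integrable lborel (\<lambda>y. indicator C y * max 0 M)"
    using mC by (auto intro: integrable_mult_left simp: integrable_real_indicator)
  have mD: "D \<in> borel_measurable lborel" using borel_measurable_continuous_onI[OF cD] by simp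
  have mq: "q n \<in> borel_measurable lborel" for n
    unfolding q_def using shift(1) ig by (auto intro!: borel_measurable_integrable)
  have lim: "AE y in lborel. (\<lambda>n. q n y) \<longlonglongrightarrow> D y" using qlim by simp
  have bd: "AE y in lborel. norm (q n y) \<le> indicator C y * max 0 M" for n using qb by simp
  show "integrable lborel (\<lambda>y. frechet_derivative g (at y) b)"
    using integrable_dominated_convergence[OF mD mq iw lim bd] unfolding D_def .
  have "(\<lambda>n. LBINT y. q n y) \<longlonglongrightarrow> (LBINT y. D y)"
    by (rule integral_dominated_convergence[OF mD mq iw lim bd])
  then show "(LBINT y. frechet_derivative g (at y) b) = 0"
    using q0 LIMSEQ_unique[OF _ tendsto_const[of 0]] unfolding D_def by auto
qed

section \<open>The measure in charts\<close>

locale C1_measure_manifold = C1_manifold \<A>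
  for \<A> :: "('a::{t2_space, second_countable_topology}, 'e::euclidean_space) chart set" +
  fixes \<mu> :: "'a measure"
  assumes measure: "C1_measure \<A> \<mu>"
begin

lemma sets_mu [simp, measurable_cong]: "sets \<mu> = sets borel"
  using measure unfolding C1_measure_def by blast

lemma space_mu [simp]: "space \<mu> = UNIV"
  using sets_eq_imp_space_eq[OF sets_mu] by simp

lemma chart_density:
  assumes "(U, h) \<in> \<A>"
  obtains \<rho> :: "'e \<Rightarrow> real" where "C1_on (h ` U) \<rho>" "\<And>y. y \<in> h ` U \<Longrightarrow> 0 < \<rho> y"
    "distr (restrict_space \<mu> U) borel h = density lborel (\<lambda>y. ennreal (\<rho> y) * indicator (h ` U) y)"
  using measure assms unfolding C1_measure_def by fast

lemma chart_measurable:
  assumes "(U, h) \<in> \<A>"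
  shows "h \<in> measurable (restrict_space \<mu> U) borel"
proof -
  have "h \<in> measurable (restrict_space borel U) borel"
    using borel_measurable_continuous_on_restrict chartD(3)[OF assms] by blast
  then show ?thesis
    using measurable_cong_sets[OF sets_restrict_space_cong[OF sets_mu] refl] by blast
qed

lemma indicator_continuous_measurable:
  fixes f :: "'b::topological_space \<Rightarrow> real"
  assumes "open S" "continuous_on S f"
  shows "(\<lambda>y. indicator S y * f y) \<in> borel_measurable borel"
  using borel_measurable_continuous_on_indicator[OF _ assms(2)] assms(1) by simp

lemma emeasure_chart:
  assumes c: "(U, h) \<in> \<A>"
    and \<rho>: "C1_on (h ` U) \<rho>" "\<And>y. y \<in> h ` U \<Longrightarrow> 0 < \<rho> y"
      "distr (restrict_space \<mu> U) borel h = density lborel (\<lambda>y. ennreal (\<rho> y) * indicator (h ` U) y)"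
    and B: "B \<in> sets borel" "B \<subseteq> h ` U"
  shows "emeasure \<mu> (inv_into U h ` B) = (\<integral>\<^sup>+y. ennreal (indicator (h ` U) y * \<rho> y) * indicator B y \<partial>lborel)"
proof -
  have m: "(\<lambda>y. indicator (h ` U) y * \<rho> y) \<in> borel_measurable borel"
    using indicator_continuous_measurable[OF chartD(5)[OF c] C1_on_imp_continuous_on[OF \<rho>(1)]] .
  \<comment> \<open>The density \<rho> is arbitrary outside the image of U; with the indicator
    inside \<open>ennreal\<close> the real-valued factor is Borel on the whole space.\<close>
  have e: "ennreal (\<rho> y) * indicator (h ` U) y = ennreal (indicator (h ` U) y * \<rho> y)" for y
    by (auto simp: indicator_def)
  have U: "U \<in> sets \<mu>" using chartD(1)[OF c] by simp
  have eq: "inv_into U h ` B = h -` B \<inter> space (restrict_space \<mu> U)"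
  proof -
    have "x \<in> inv_into U h ` B" if "h x \<in> B" "x \<in> U" for x
      using that c by (metis chart_inv image_eqI)
    then show ?thesis using B(2) c by (auto simp: space_restrict_space)
  qed
  have "h -` B \<inter> space (restrict_space \<mu> U) \<in> sets (restrict_space \<mu> U)"
    using measurable_sets[OF chart_measurable[OF c] B(1)] .
  then have "emeasure \<mu> (h -` B \<inter> space (restrict_space \<mu> U)) =
      emeasure (restrict_space \<mu> U) (h -` B \<inter> space (restrict_space \<mu> U))"
    using U by (intro emeasure_restrict_space[symmetric]) (auto simp: space_restrict_space)
  also have "\<dots> = emeasure (distr (restrict_space \<mu> U) borel h) B"
    using emeasure_distr[OF chart_measurable[OF c] B(1)] by simp
  also have "\<dots> = (\<integral>\<^sup>+y. ennreal (indicator (h ` U) y * \<rho> y) * indicator B y \<partial>lborel)"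
    unfolding \<rho>(3) e using m B(1) by (intro emeasure_density) auto
  finally show ?thesis unfolding eq .
qed

lemma integral_chart:
  assumes c: "(U, h) \<in> \<A>"
    and \<rho>: "C1_on (h ` U) \<rho>" "\<And>y. y \<in> h ` U \<Longrightarrow> 0 < \<rho> y"
      "distr (restrict_space \<mu> U) borel h = density lborel (\<lambda>y. ennreal (\<rho> y) * indicator (h ` U) y)"
    and f: "continuous_on U f" "\<And>x. x \<notin> U \<Longrightarrow> f x = (0::real)"
  shows "(\<integral>x. f x \<partial>\<mu>) = (LBINT y. indicator (h ` U) y * \<rho> y * f (inv_into U h y))"
proof -
  define F where "F y = indicator (h ` U) y * f (inv_into U h y)" for y
  have m: "(\<lambda>y. indicator (h ` U) y * \<rho> y) \<in> borel_measurable borel"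
    using indicator_continuous_measurable[OF chartD(5)[OF c] C1_on_imp_continuous_on[OF \<rho>(1)]] .
  have "continuous_on (h ` U) (\<lambda>y. f (inv_into U h y))"
    by (rule continuous_on_compose2[OF f(1) chartD(4)[OF c]]) (use c in auto)
  then have mF: "F \<in> borel_measurable borel"
    unfolding F_def by (rule indicator_continuous_measurable[OF chartD(5)[OF c]])
  have e: "ennreal (\<rho> y) * indicator (h ` U) y = ennreal (indicator (h ` U) y * \<rho> y)" for y
    by (auto simp: indicator_def)
  have U: "U \<in> sets \<mu>" using chartD(1)[OF c] by simp
  have "(\<integral>x. f x \<partial>\<mu>) = (\<integral>x. indicator U x *\<^sub>R F (h x) \<partial>\<mu>)"
    by (rule Bochner_Integration.integral_cong) (use f(2) c in \<open>auto simp: F_def indicator_def\<close>)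
  also have "\<dots> = (\<integral>x. F (h x) \<partial>(restrict_space \<mu> U))"
    using U by (intro integral_restrict_space[symmetric]) auto
  also have "\<dots> = (\<integral>y. F y \<partial>(distr (restrict_space \<mu> U) borel h))"
    by (rule integral_distr[OF chart_measurable[OF c] mF, symmetric])
  also have "\<dots> = (LBINT y. (indicator (h ` U) y * \<rho> y) *\<^sub>R F y)"
    unfolding \<rho>(3) e using m mF \<rho>(2) by (intro integral_density) (auto simp: indicator_def less_imp_le)
  also have "\<dots> = (LBINT y. indicator (h ` U) y * \<rho> y * f (inv_into U h y))"
    by (rule Bochner_Integration.integral_cong) (auto simp: F_def indicator_def)
  finally show ?thesis .
qed

text \<open>Around each point a closed coordinate ball fits into the chart image, and the density is
  bounded on it. So every point has a neighbourhood of finite measure, and finitely many of these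
  cover K.\<close>

lemma finite_on_compact:
  assumes "compact K"
  shows "emeasure \<mu> K < \<infinity>"
proof -
  have "\<forall>x. \<exists>N. open N \<and> x \<in> N \<and> emeasure \<mu> N < \<infinity>"
  proof
    fix x
    obtain U h where c: "(U, h) \<in> \<A>" "x \<in> U" by (rule ex_chart)
    obtain \<rho> where \<rho>: "C1_on (h ` U) \<rho>" "\<And>y. y \<in> h ` U \<Longrightarrow> 0 < \<rho> y"
      "distr (restrict_space \<mu> U) borel h = density lborel (\<lambda>y. ennreal (\<rho> y) * indicator (h ` U) y)"
      using chart_density[OF c(1)] by metis
    obtain r where r: "r > 0" "cball (h x) r \<subseteq> h ` U"
      using chartD(5)[OF c(1)] c(2) open_contains_cball by (metis image_eqI)
    obtain M where M: "\<And>y. y \<in> cball (h x) r \<Longrightarrow> \<bar>\<rho> y\<bar> \<le> M"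
      using continuous_on_compact_bound[OF compact_cball C1_on_imp_continuous_on[OF \<rho>(1)] r(2)] by metis
    define N where "N = inv_into U h ` ball (h x) r"
    have br: "ball (h x) r \<subseteq> h ` U" using r(2) ball_subset_cball by blast
    have "N = U \<inter> h -` ball (h x) r"
    proof -
      have "y \<in> N" if "h y \<in> ball (h x) r" "y \<in> U" for y
        using that c unfolding N_def by (metis chart_inv image_eqI)
      then show ?thesis using br c unfolding N_def by auto
    qed
    then have "open N" "x \<in> N"
      using continuous_open_preimage[OF chartD(3,1)[OF c(1)]] c(2) r(1) by auto
    moreover have "emeasure \<mu> N < \<infinity>"
    proof -
      have "emeasure \<mu> N = (\<integral>\<^sup>+y. ennreal (indicator (h ` U) y * \<rho> y) * indicator (ball (h x) r) y \<partial>lborel)"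
        unfolding N_def by (rule emeasure_chart[OF c(1) \<rho> _ br]) auto
      also have "\<dots> \<le> (\<integral>\<^sup>+y. ennreal M * indicator (ball (h x) r) y \<partial>lborel)"
        using M by (intro nn_integral_mono) (force simp: indicator_def intro!: ennreal_leI dest: abs_le_D1)
      also have "\<dots> = ennreal M * emeasure lborel (ball (h x) r)"
        by (subst nn_integral_cmult_indicator) auto
      also have "\<dots> < \<infinity>"
        using emeasure_lborel_ball_finite[of "h x" r] by (simp add: ennreal_mult_less_top)
      finally show ?thesis .
    qed
    ultimately show "\<exists>N. open N \<and> x \<in> N \<and> emeasure \<mu> N < \<infinity>" by blast
  qed
  then obtain N where N: "\<And>x. open (N x) \<and> x \<in> N x \<and> emeasure \<mu> (N x) < \<infinity>"
    by metis
  obtain I where I: "finite I" "K \<subseteq> (\<Union>i\<in>I. N i)"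
    by (rule compactE_image[OF assms, of UNIV N]) (use N in auto)
  have "emeasure \<mu> K \<le> emeasure \<mu> (\<Union>i\<in>I. N i)"
    using I N by (intro emeasure_mono) auto
  also have "\<dots> \<le> (\<Sum>i\<in>I. emeasure \<mu> (N i))"
    using I N by (intro emeasure_subadditive_finite) auto
  also have "\<dots> < \<infinity>"
    using I(1) N by simp
  finally show ?thesis .
qed

text \<open>Positivity of the densities enters here: the part of a null open set in a chart has a
  Lebesgue negligible image, and that image is open. This upgrades almost everywhere equality of
  continuous functions to equality everywhere.\<close>

lemma open_null_empty:
  assumes "open S" "AE x in \<mu>. x \<notin> S"
  shows "S = {}"
proof (rule ccontr)
  assume "S \<noteq> {}"
  then obtain x where x: "x \<in> S" by blast
  obtain U h where c: "(U, h) \<in> \<A>" "x \<in> U" by (rule ex_chart)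
  obtain \<rho> where \<rho>: "C1_on (h ` U) \<rho>" "\<And>y. y \<in> h ` U \<Longrightarrow> 0 < \<rho> y"
    "distr (restrict_space \<mu> U) borel h = density lborel (\<lambda>y. ennreal (\<rho> y) * indicator (h ` U) y)"
    using chart_density[OF c(1)] by metis
  have oB: "open (h ` (U \<inter> S))" using chart_image_open[OF c(1) assms(1)] .
  have m: "(\<lambda>y. indicator (h ` U) y * \<rho> y) \<in> borel_measurable borel"
    using indicator_continuous_measurable[OF chartD(5)[OF c(1)] C1_on_imp_continuous_on[OF \<rho>(1)]] .
  have inv: "inv_into U h ` h ` (U \<inter> S) = U \<inter> S" using c by (force simp: image_iff)
  have "S \<in> null_sets \<mu>"
    using assms by (simp add: AE_iff_null_sets)
  then have "emeasure \<mu> (U \<inter> S) = 0"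
    using chartD(1)[OF c(1)] by (metis Int_commute null_setsD1 null_set_Int1 borel_open sets_mu)
  then have "(\<integral>\<^sup>+y. ennreal (indicator (h ` U) y * \<rho> y) * indicator (h ` (U \<inter> S)) y \<partial>lborel) = 0"
    using emeasure_chart[OF c(1) \<rho>, of "h ` (U \<inter> S)"] oB inv by auto
  then have "AE y in lborel. ennreal (indicator (h ` U) y * \<rho> y) * indicator (h ` (U \<inter> S)) y = 0"
    using m oB by (subst (asm) nn_integral_0_iff_AE) auto
  then have "AE y in lborel. y \<notin> h ` (U \<inter> S)"
    by eventually_elim (use \<rho>(2) in \<open>fastforce simp: indicator_def not_le[symmetric] ennreal_eq_0_iff split: if_splits\<close>)
  then have "h ` (U \<inter> S) \<in> null_sets lborel"
    using oB by (simp add: AE_iff_null_sets)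
  then have "negligible (h ` (U \<inter> S))"
    using negligible_iff_null_sets null_sets_completionI by blast
  then show False
    using open_not_negligible[OF oB] x c(2) by auto
qed

lemma sigma_finite_mu: "sigma_finite_measure \<mu>"
proof -
  obtain s :: "nat \<Rightarrow> 'a \<Rightarrow> real" where s: "\<And>n. s n \<in> C1c \<A> UNIV"
    "\<And>x. x \<in> UNIV \<Longrightarrow> \<forall>\<^sub>F n in sequentially. s n x = 1"
    using exhaustion[OF open_UNIV] by metis
  have "\<forall>n. \<exists>K. compact K \<and> (\<forall>x. x \<notin> K \<longrightarrow> s n x = 0)"
    using s(1) C1c_support by metis
  then obtain K where K: "\<And>n. compact (K n) \<and> (\<forall>x. x \<notin> K n \<longrightarrow> s n x = 0)" by metis
  have "x \<in> (\<Union>n. K n)" for x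
  proof -
    obtain n where "s n x = 1" using s(2)[of x] eventually_sequentially by auto
    then show ?thesis using K by (metis UNIV_I UN_iff zero_neq_one)
  qed
  then have 1: "(\<Union>n. K n) = space \<mu>" by auto
  have 2: "K n \<in> sets \<mu>" "emeasure \<mu> (K n) \<noteq> \<infinity>" for n
    using K finite_on_compact[of "K n"] compact_imp_closed[of "K n"] by auto
  show ?thesis
    by standard (use 1 2 in \<open>auto intro!: exI[of _ "range K"]\<close>)
qed

text \<open>Meant also for functions such as the derivative of a test function along a field, which
  are continuous with compact support but in general no longer C^1. Continuity is asked on W;
  closedness of K extends it by zero to the whole manifold.\<close>

lemma Cc:
  assumes "open W" "continuous_on W f" "compact K" "K \<subseteq> W" "\<And>x. x \<notin> K \<Longrightarrow> f x = (0::real)"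
  shows Cc_measurable: "f \<in> borel_measurable \<mu>"
    and Cc_bounded: "\<exists>B. \<forall>x. \<bar>f x\<bar> \<le> B"
    and Cc_integrable: "integrable \<mu> f"
    and Cc_square_integrable: "integrable \<mu> (\<lambda>x. (f x)\<^sup>2)"
proof -
  have "continuous_on (- K) f"
    by (rule continuous_on_eq[of _ "\<lambda>_. 0"]) (use assms(5) in auto)
  then have "continuous_on (W \<union> - K) f"
    using continuous_on_open_Un[OF assms(1) _ assms(2)] compact_imp_closed[OF assms(3)] by auto
  moreover have "W \<union> - K = UNIV" using assms(4) by auto
  ultimately have c: "continuous_on UNIV f" by simp
  show m: "f \<in> borel_measurable \<mu>"
    using borel_measurable_continuous_onI[OF c] measurable_cong_sets[OF sets_mu refl] by blast
  obtain B where B: "\<And>y. y \<in> K \<Longrightarrow> \<bar>f y\<bar> \<le> B"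
    using continuous_on_compact_bound[OF assms(3) c subset_UNIV] by metis
  have B': "\<bar>f y\<bar> \<le> max 0 B" for y
    using B[of y] assms(5)[of y] by (cases "y \<in> K") auto
  then show "\<exists>B. \<forall>x. \<bar>f x\<bar> \<le> B" by blast
  have K: "K \<in> sets \<mu>" using compact_imp_closed[OF assms(3)] by simp
  show "integrable \<mu> f"
    using m K finite_on_compact[OF assms(3)] B' assms(5)
    by (intro integrableI_bounded_set[where A = K and B = "max 0 B"]) auto
  have B2: "(f y)\<^sup>2 \<le> (max 0 B)\<^sup>2" for y
    using power_mono[OF B'[of y], of 2] by simp
  show "integrable \<mu> (\<lambda>x. (f x)\<^sup>2)"
    using m K finite_on_compact[OF assms(3)] B2 assms(5)
    by (intro integrableI_bounded_set[where A = K and B = "(max 0 B)\<^sup>2"]) auto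
qed

end

section \<open>Separation by test functions, divergence and adjoints\<close>

context C1_measure_manifold
begin

lemma C1c_Cc:
  assumes "open W" "f \<in> C1c \<A> W"
  shows "f \<in> borel_measurable \<mu>" "\<exists>B. \<forall>x. \<bar>f x\<bar> \<le> B" "integrable \<mu> f" "integrable \<mu> (\<lambda>x. (f x)\<^sup>2)"
proof -
  obtain K where K: "compact K" "K \<subseteq> W" "\<And>x. x \<notin> K \<Longrightarrow> f x = 0"
    using C1c_support[OF assms(2)] by metis
  have c: "continuous_on W f" using C1_fun_continuous[OF C1c_C1_fun[OF assms] assms(1)] .
  show "f \<in> borel_measurable \<mu>" "\<exists>B. \<forall>x. \<bar>f x\<bar> \<le> B" "integrable \<mu> f" "integrable \<mu> (\<lambda>x. (f x)\<^sup>2)"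
    by (rule Cc[OF assms(1) c K]; assumption)+
qed

lemma vf_deriv_outside:
  assumes "f \<in> C1c \<A> W" "x \<notin> W"
  shows "vf_deriv \<A> X f x = 0"
proof -
  obtain K where K: "compact K" "K \<subseteq> W" "\<And>x. x \<notin> K \<Longrightarrow> f x = 0"
    using C1c_support[OF assms(1)] by metis
  then show ?thesis using assms(2) by (intro vf_deriv_zero[OF compact_imp_closed[OF K(1)]]) auto
qed

lemma vf_deriv_Cc:
  assumes "open W" "f \<in> C1c \<A> W" "C1_vector_field \<A> UNIV X"
  shows "vf_deriv \<A> X f \<in> borel_measurable \<mu>" "\<exists>B. \<forall>x. \<bar>vf_deriv \<A> X f x\<bar> \<le> B"
    "integrable \<mu> (vf_deriv \<A> X f)" "integrable \<mu> (\<lambda>x. (vf_deriv \<A> X f x)\<^sup>2)"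
proof -
  obtain K where K: "compact K" "K \<subseteq> W" "\<And>x. x \<notin> K \<Longrightarrow> f x = 0"
    using C1c_support[OF assms(2)] by metis
  have z: "\<And>x. x \<notin> K \<Longrightarrow> vf_deriv \<A> X f x = 0"
    by (rule vf_deriv_zero[OF compact_imp_closed[OF K(1)] _ K(3)])
  have c: "continuous_on W (vf_deriv \<A> X f)"
    using vf_deriv_continuous[OF C1_vector_field_imp_C0[OF assms(3)] C1c_C1_fun[OF assms(1,2)] assms(1)] .
  show "vf_deriv \<A> X f \<in> borel_measurable \<mu>" "\<exists>B. \<forall>x. \<bar>vf_deriv \<A> X f x\<bar> \<le> B"
    "integrable \<mu> (vf_deriv \<A> X f)" "integrable \<mu> (\<lambda>x. (vf_deriv \<A> X f x)\<^sup>2)"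
    by (rule Cc[OF assms(1) c K(1,2) z]; assumption)+
qed

text \<open>The fundamental lemma of the calculus of variations. For a test function b, the integral
  of g b over an open set A is the limit of the integrals of g b s_n, with s_n an exhaustion of A,
  and b s_n is again a test function; so it vanishes. Open sets form an intersection-stable
  generator of the Borel sets, hence g b = 0 almost everywhere, and b runs through an exhaustion of
  W.\<close>

lemma C1c_separating:
  assumes W: "open W"
    and int: "\<And>b. b \<in> C1c \<A> W \<Longrightarrow> integrable \<mu> (\<lambda>x. g x * b x)"
    and zero: "\<And>b. b \<in> C1c \<A> W \<Longrightarrow> (\<integral>x. g x * b x \<partial>\<mu>) = 0"
  shows "AE x in \<mu>. x \<in> W \<longrightarrow> g x = (0::real)"
proof -
  interpret sigma_finite_measure \<mu> by (rule sigma_finite_mu)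
  have *: "AE x in \<mu>. g x * b x = 0" if b: "b \<in> C1c \<A> W" for b
  proof (rule density_zero[OF int[OF b]])
    fix A assume "A \<in> sets \<mu>"
    then have A: "A \<in> sigma_sets UNIV {S. open S}"
      by (simp add: sets_borel)
    have "Int_stable {S :: 'a set. open S}" "{S :: 'a set. open S} \<subseteq> Pow UNIV"
      by (auto simp: Int_stable_def)
    from this A show "(LINT x:A|\<mu>. g x * b x) = 0"
    proof (induction A rule: sigma_sets_induct_disjoint)
      case (basic A)
      then have A: "open A" by simp
      obtain s :: "nat \<Rightarrow> 'a \<Rightarrow> real" where s: "\<And>n. s n \<in> C1c \<A> A" "\<And>n x. 0 \<le> s n x \<and> s n x \<le> 1"
        "\<And>x. x \<in> A \<Longrightarrow> \<forall>\<^sub>F n in sequentially. s n x = 1"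
        using exhaustion[OF A] by metis
      have sb: "(\<lambda>x. b x * s n x) \<in> C1c \<A> W" for n
        using C1c_mult(1)[OF W b C1c_C1_fun[OF A s(1)]] .
      have m: "(\<lambda>x. g x * b x) \<in> borel_measurable \<mu>" using int[OF b] by blast
      have "(\<lambda>n. \<integral>x. g x * (b x * s n x) \<partial>\<mu>) \<longlonglongrightarrow> (\<integral>x. indicator A x *\<^sub>R (g x * b x) \<partial>\<mu>)"
      proof (rule integral_dominated_convergence[where w = "\<lambda>x. \<bar>g x * b x\<bar>"])
        show "(\<lambda>x. indicat_real A x *\<^sub>R (g x * b x)) \<in> borel_measurable \<mu>"
          using m A by (intro borel_measurable_scaleR borel_measurable_indicator) auto
        show "(\<lambda>x. g x * (b x * s n x)) \<in> borel_measurable \<mu>" for n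
          using int[OF sb] by blast
        show "integrable \<mu> (\<lambda>x. \<bar>g x * b x\<bar>)" using int[OF b] by (rule integrable_abs)
        show "AE x in \<mu>. (\<lambda>n. g x * (b x * s n x)) \<longlonglongrightarrow> indicat_real A x *\<^sub>R (g x * b x)"
        proof (rule AE_I2)
          fix x
          show "(\<lambda>n. g x * (b x * s n x)) \<longlonglongrightarrow> indicat_real A x *\<^sub>R (g x * b x)"
          proof (cases "x \<in> A")
            case True
            have "\<forall>\<^sub>F n in sequentially. g x * (b x * s n x) = g x * b x"
              using s(3)[OF True] by eventually_elim simp
            then show ?thesis using True tendsto_eventually by fastforce
          next
            case False
            then show ?thesis using C1c_outside[OF s(1) False] by simp
          qed
        qed
        show "AE x in \<mu>. norm (g x * (b x * s n x)) \<le> \<bar>g x * b x\<bar>" for n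
          using s(2)[of n] by (auto simp: abs_mult intro!: mult_left_mono mult_left_le)
      qed
      then show ?case
        using zero[OF sb] LIMSEQ_unique[OF _ tendsto_const[of 0]]
        unfolding set_lebesgue_integral_def by simp
    next
      case empty
      show ?case by (simp add: set_lebesgue_integral_def)
    next
      case (compl A)
      then have A: "A \<in> sets \<mu>" by (simp add: sets_borel)
      have "(LINT x:UNIV - A|\<mu>. g x * b x) = (\<integral>x. g x * b x - indicator A x *\<^sub>R (g x * b x) \<partial>\<mu>)"
        unfolding set_lebesgue_integral_def
        by (rule Bochner_Integration.integral_cong) (auto simp: indicator_def)
      also have "\<dots> = (\<integral>x. g x * b x \<partial>\<mu>) - (LINT x:A|\<mu>. g x * b x)"
        unfolding set_lebesgue_integral_def
        by (rule Bochner_Integration.integral_diff[OF int[OF b] integrable_mult_indicator[OF A int[OF b]]])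
      finally show ?case using compl zero[OF b] by simp
    next
      case (union A)
      then have A: "\<And>i. A i \<in> sets \<mu>" by (auto simp: sets_borel)
      have "(LINT x:(\<Union>i. A i)|\<mu>. g x * b x) = (\<Sum>i. (LINT x:(A i)|\<mu>. g x * b x))"
      proof (rule lebesgue_integral_countable_add[OF A])
        show "set_integrable \<mu> (\<Union> (range A)) (\<lambda>x. g x * b x)"
          unfolding set_integrable_def using A by (intro integrable_mult_indicator int[OF b]) auto
      qed (use union in \<open>auto simp: disjoint_family_on_def\<close>)
      then show ?case using union by simp
    qed
  qed
  obtain s :: "nat \<Rightarrow> 'a \<Rightarrow> real" where s: "\<And>n. s n \<in> C1c \<A> W"
    "\<And>x. x \<in> W \<Longrightarrow> \<forall>\<^sub>F n in sequentially. s n x = 1"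
    using exhaustion[OF W] by metis
  have "AE x in \<mu>. \<forall>n. g x * s n x = 0"
    unfolding AE_all_countable using *[OF s(1)] by blast
  then show ?thesis
  proof eventually_elim
    case (elim x)
    show ?case
    proof
      assume "x \<in> W"
      then obtain n where "s n x = 1" using s(2) by (auto simp: eventually_sequentially)
      then show "g x = 0" using elim by (metis mult.right_neutral)
    qed
  qed
qed

text \<open>In coordinates, \<open>a\<close> is minus the divergence of X with respect to \<mu>,
  namely -(1/\<rho>) times the sum over b of the partial derivatives of \<rho> Z_b. It comes from
  integrating the partial derivatives of \<phi> \<rho> Z_b, extended by zero, over the model space.
  C^1 regularity of both the density and the components is used here.\<close>

lemma local_divergence:
  assumes c: "(U, h) \<in> \<A>" and X: "C1_vector_field \<A> UNIV X"
  obtains a where "continuous_on U a"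
    "\<And>\<phi>. \<phi> \<in> C1c \<A> U \<Longrightarrow> (\<integral>x. vf_deriv \<A> X \<phi> x \<partial>\<mu>) = (\<integral>x. a x * \<phi> x \<partial>\<mu>)"
proof -
  obtain \<rho> where \<rho>: "C1_on (h ` U) \<rho>" "\<And>y. y \<in> h ` U \<Longrightarrow> 0 < \<rho> y"
    "distr (restrict_space \<mu> U) borel h = density lborel (\<lambda>y. ennreal (\<rho> y) * indicator (h ` U) y)"
    using chart_density[OF c] by metis
  have U: "open U" using chartD(1)[OF c] .
  define Z where "Z = X (U, h) \<circ> inv_into U h"
  have Z: "C1_on (h ` U) Z"
    using X c unfolding C1_vector_field_def Z_def by auto
  define r where "r b y = \<rho> y * (Z y \<bullet> b)" for b y
  have r: "C1_on (h ` U) (r b)" for b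
    unfolding r_def by (intro C1_on_mult \<rho>(1) C1_on_inner Z)
  define d where "d y = - (\<Sum>b\<in>Basis. frechet_derivative (r b) (at y) b) / \<rho> y" for y
  define a where "a x = d (h x)" for x
  have "continuous_on (h ` U) d"
    unfolding d_def using \<rho>(2)
    by (intro continuous_intros C1_on_continuous_derivative[OF r] C1_on_imp_continuous_on[OF \<rho>(1)]) fastforce
  then have ca: "continuous_on U a"
    unfolding a_def by (rule continuous_on_compose2[OF _ chartD(3)[OF c]]) simp
  have "(\<integral>x. vf_deriv \<A> X \<phi> x \<partial>\<mu>) = (\<integral>x. a x * \<phi> x \<partial>\<mu>)" if \<phi>: "\<phi> \<in> C1c \<A> U" for \<phi>
  proof -
    obtain K where K: "compact K" "K \<subseteq> U" "\<And>x. x \<notin> K \<Longrightarrow> \<phi> x = 0"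
      using C1c_support[OF \<phi>] by metis
    have vf: "vector_field \<A> U X"
      using X unfolding C1_vector_field_def vector_field_def by blast
    have c\<phi>: "continuous_on U \<phi>" using C1_fun_continuous[OF C1c_C1_fun[OF U \<phi>] U] .
    have cX: "continuous_on U (vf_deriv \<A> X \<phi>)"
      using vf_deriv_continuous[OF C1_vector_field_imp_C0[OF X] C1c_C1_fun[OF U \<phi>] U] .
    define f where "f = \<phi> \<circ> inv_into U h"
    have f: "C1_on (h ` U) f"
      unfolding f_def using C1_funD[OF C1c_C1_fun[OF U \<phi>, of U] c] by simp
    define g where "g b y = (if y \<in> h ` U then f y * r b y else 0)" for b y
    have K': "compact (h ` K)"
      using compact_continuous_image[OF continuous_on_subset[OF chartD(3)[OF c] K(2)] K(1)] .
    have g0: "g b y = 0" if "y \<notin> h ` K" for b y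
      using that K(3) c unfolding g_def f_def by (auto simp: image_iff)
    have g: "C1_on UNIV (g b)" for b
    proof -
      have "C1_on (h ` U) (g b)"
        by (rule C1_on_cong[OF C1_on_mult[OF f r[of b]] chartD(5)[OF c]]) (simp add: g_def)
      moreover have "C1_on (- h ` K) (g b)"
        by (rule C1_on_cong[of _ "\<lambda>_. 0"]) (use g0 K' in \<open>auto dest: compact_imp_closed\<close>)
      ultimately have "C1_on (h ` U \<union> - h ` K) (g b)"
        using chartD(5)[OF c] compact_imp_closed[OF K'] by (intro C1_on_Un) auto
      moreover have "h ` U \<union> - h ` K = UNIV" using K(2) by auto
      ultimately show ?thesis by simp
    qed
    have dg: "frechet_derivative (g b) (at y) b =
        f y * frechet_derivative (r b) (at y) b + frechet_derivative f (at y) b * r b y"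
      if y: "y \<in> h ` U" for b y
    proof -
      have "((\<lambda>y. f y * r b y) has_derivative
          (\<lambda>v. f y * frechet_derivative (r b) (at y) v + frechet_derivative f (at y) v * r b y)) (at y)"
        by (rule has_derivative_mult[OF C1_on_has_derivative[OF f y] C1_on_has_derivative[OF r y]])
      then have "(g b has_derivative
          (\<lambda>v. f y * frechet_derivative (r b) (at y) v + frechet_derivative f (at y) v * r b y)) (at y)"
        by (rule has_derivative_transform_within_open[OF _ chartD(5)[OF c] y]) (simp add: g_def)
      from frechet_derivative_at[OF this, symmetric] show ?thesis by simp
    qed
    have dg0: "frechet_derivative (g b) (at y) b = 0" if y: "y \<notin> h ` U" for b y
    proof -
      have "(g b has_derivative (\<lambda>_. 0)) (at y)"
        by (rule has_derivative_transform_within_open[OF has_derivative_const, where s = "- h ` K"])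
           (use g0 K' K(2) y in \<open>auto dest: compact_imp_closed\<close>)
      from frechet_derivative_at[OF this, symmetric] show ?thesis by simp
    qed
    \<comment> \<open>By the product rule the Euclidean divergence of \<phi> \<rho> Z is \<rho> (X
      \<phi> - a \<phi>), the minus sign being the one in the definition of a.\<close>
    have eq: "(\<Sum>b\<in>Basis. frechet_derivative (g b) (at y) b) =
      indicator (h ` U) y * \<rho> y * (vf_deriv \<A> X \<phi> (inv_into U h y) - a (inv_into U h y) * \<phi> (inv_into U h y))" for y
    proof (cases "y \<in> h ` U")
      case True
      then obtain x where x: "x \<in> U" "y = h x" by blast
      have lin: "linear (frechet_derivative f (at y))"
        using has_derivative_linear[OF C1_on_has_derivative[OF f True]] .
      have "vf_deriv \<A> X \<phi> x = frechet_derivative f (at y) (Z y)"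
        using vf_deriv_chart[OF vf C1c_C1_fun[OF U \<phi>] U c x(1) x(1)] x c unfolding f_def Z_def by simp
      also have "\<dots> = frechet_derivative f (at y) (\<Sum>b\<in>Basis. (Z y \<bullet> b) *\<^sub>R b)"
        by (simp add: euclidean_representation)
      also have "\<dots> = (\<Sum>b\<in>Basis. (Z y \<bullet> b) * frechet_derivative f (at y) b)"
        by (simp add: linear_sum[OF lin] linear_scale[OF lin])
      finally have 1: "\<rho> y * vf_deriv \<A> X \<phi> x = (\<Sum>b\<in>Basis. frechet_derivative f (at y) b * r b y)"
        by (simp add: r_def sum_distrib_left mult_ac)
      have 2: "\<rho> y * (a x * \<phi> x) = - (\<Sum>b\<in>Basis. f y * frechet_derivative (r b) (at y) b)"
        using \<rho>(2)[OF True] x c unfolding a_def d_def f_def by (simp add: sum_distrib_left field_simps)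
      show ?thesis
        using True 1 2 x c dg[OF True] by (simp add: sum.distrib right_diff_distrib)
    next
      case False
      then show ?thesis using dg0 by simp
    qed
    have Xz: "vf_deriv \<A> X \<phi> x = 0" if "x \<notin> K" for x
      by (rule vf_deriv_zero[OF compact_imp_closed[OF K(1)] that K(3)])
    have i1: "integrable \<mu> (vf_deriv \<A> X \<phi>)" by (rule Cc_integrable[OF U cX K(1,2) Xz])
    have ca\<phi>: "continuous_on U (\<lambda>x. a x * \<phi> x)" by (intro continuous_intros ca c\<phi>)
    have i2: "integrable \<mu> (\<lambda>x. a x * \<phi> x)"
      by (rule Cc_integrable[OF U ca\<phi> K(1,2)]) (simp add: K(3))
    have "(\<integral>x. vf_deriv \<A> X \<phi> x \<partial>\<mu>) - (\<integral>x. a x * \<phi> x \<partial>\<mu>) = (\<integral>x. vf_deriv \<A> X \<phi> x - a x * \<phi> x \<partial>\<mu>)"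
      by (rule Bochner_Integration.integral_diff[OF i1 i2, symmetric])
    also have "\<dots> = (LBINT y. indicator (h ` U) y * \<rho> y *
        (vf_deriv \<A> X \<phi> (inv_into U h y) - a (inv_into U h y) * \<phi> (inv_into U h y)))"
    proof (rule integral_chart[OF c \<rho>])
      show "continuous_on U (\<lambda>x. vf_deriv \<A> X \<phi> x - a x * \<phi> x)"
        by (intro continuous_intros cX ca c\<phi>)
      show "vf_deriv \<A> X \<phi> x - a x * \<phi> x = 0" if "x \<notin> U" for x
      proof -
        have "x \<notin> K" using that K(2) by blast
        then show ?thesis using Xz K(3) by simp
      qed
    qed
    also have "\<dots> = (LBINT y. \<Sum>b\<in>Basis. frechet_derivative (g b) (at y) b)"
      unfolding eq ..
    also have "\<dots> = (\<Sum>b\<in>Basis. LBINT y. frechet_derivative (g b) (at y) b)"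
      by (rule Bochner_Integration.integral_sum) (rule integral_directional_derivative(1)[OF g K' g0])
    also have "\<dots> = 0"
      using integral_directional_derivative(2)[OF g K' g0] by simp
    finally show ?thesis by simp
  qed
  then show ?thesis using that ca by blast
qed

text \<open>
  Coordinate changes are only $C^1$, so the coordinate formula for the divergence cannot be compared
  directly between charts. The local divergences agree on overlaps because they are continuous and
  have the same integrals against test functions.
\<close>

lemma divergence:
  assumes X: "C1_vector_field \<A> UNIV X"
  obtains a where "continuous_on UNIV a"
    "\<And>\<phi>. \<phi> \<in> C1c \<A> UNIV \<Longrightarrow> (\<integral>x. vf_deriv \<A> X \<phi> x \<partial>\<mu>) = (\<integral>x. a x * \<phi> x \<partial>\<mu>)"
proof -
  have "\<forall>c\<in>\<A>. \<exists>a. continuous_on (fst c) a \<and>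
      (\<forall>\<phi>\<in>C1c \<A> (fst c). (\<integral>x. vf_deriv \<A> X \<phi> x \<partial>\<mu>) = (\<integral>x. a x * \<phi> x \<partial>\<mu>))"
    using local_divergence[OF _ X] by (metis prod.collapse)
  then obtain A where A: "\<And>c. c \<in> \<A> \<Longrightarrow> continuous_on (fst c) (A c)"
    "\<And>c \<phi>. c \<in> \<A> \<Longrightarrow> \<phi> \<in> C1c \<A> (fst c) \<Longrightarrow> (\<integral>x. vf_deriv \<A> X \<phi> x \<partial>\<mu>) = (\<integral>x. A c x * \<phi> x \<partial>\<mu>)"
    by metis
  have op: "open (fst c)" if "c \<in> \<A>" for c using chartD(1) that by (metis prod.collapse)
  have agree: "A c x = A c' x" if c: "c \<in> \<A>" "c' \<in> \<A>" and x: "x \<in> fst c" "x \<in> fst c'" for c c' x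
  proof -
    define W where "W = fst c \<inter> fst c'"
    have W: "open W" unfolding W_def using op c by blast
    have cont: "continuous_on W (A c)" "continuous_on W (A c')"
      using A(1) c continuous_on_subset unfolding W_def by (metis inf_le1, metis inf_le2)
    have i: "integrable \<mu> (\<lambda>x. A c x * b x)" "integrable \<mu> (\<lambda>x. A c' x * b x)" if b: "b \<in> C1c \<A> W" for b
    proof -
      obtain K where K: "compact K" "K \<subseteq> W" "\<And>x. x \<notin> K \<Longrightarrow> b x = 0"
        using C1c_support[OF b] by metis
      have cb: "continuous_on W b" using C1_fun_continuous[OF C1c_C1_fun[OF W b] W] .
      show "integrable \<mu> (\<lambda>x. A c x * b x)"
        by (rule Cc_integrable[OF W continuous_on_mult[OF cont(1) cb] K(1,2)]) (simp add: K(3))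
      show "integrable \<mu> (\<lambda>x. A c' x * b x)"
        by (rule Cc_integrable[OF W continuous_on_mult[OF cont(2) cb] K(1,2)]) (simp add: K(3))
    qed
    have "AE x in \<mu>. x \<in> W \<longrightarrow> A c x - A c' x = 0"
    proof (rule C1c_separating[OF W])
      fix b assume b: "b \<in> C1c \<A> W"
      show "integrable \<mu> (\<lambda>x. (A c x - A c' x) * b x)"
        using i[OF b] by (simp add: left_diff_distrib)
      have "b \<in> C1c \<A> (fst c)" "b \<in> C1c \<A> (fst c')"
        using b C1c_mono[OF W op[OF c(1)]] C1c_mono[OF W op[OF c(2)]] unfolding W_def by blast+
      then show "(\<integral>x. (A c x - A c' x) * b x \<partial>\<mu>) = 0"
        using i[OF b] A(2)[OF c(1), of b] A(2)[OF c(2), of b] by (simp add: left_diff_distrib)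
    qed
    moreover have "open (W \<inter> (\<lambda>x. A c x - A c' x) -` (- {0}))"
      by (rule continuous_open_preimage[OF _ W]) (auto intro!: continuous_intros cont)
    moreover have "AE x in \<mu>. x \<notin> W \<inter> (\<lambda>x. A c x - A c' x) -` (- {0})"
      using calculation(1) by eventually_elim auto
    ultimately have "W \<inter> (\<lambda>x. A c x - A c' x) -` (- {0}) = {}"
      using open_null_empty by blast
    then show ?thesis using x unfolding W_def by auto
  qed
  define a where "a x = A (SOME c. c \<in> \<A> \<and> x \<in> fst c) x" for x
  have a: "a x = A c x" if "c \<in> \<A>" "x \<in> fst c" for c x
  proof -
    have "(SOME c. c \<in> \<A> \<and> x \<in> fst c) \<in> \<A> \<and> x \<in> fst (SOME c. c \<in> \<A> \<and> x \<in> fst c)"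
      by (rule someI[of _ c]) (use that in auto)
    then show ?thesis unfolding a_def using agree that by blast
  qed
  have "continuous (at x) a" for x
  proof -
    obtain U h where c: "(U, h) \<in> \<A>" "x \<in> U" by (rule ex_chart)
    have "continuous_on U a"
      using A(1)[OF c(1)] a[OF c(1)] by (simp cong: continuous_on_cong)
    then show ?thesis using c chartD(1)[OF c(1)] continuous_on_eq_continuous_at by blast
  qed
  then have ca: "continuous_on UNIV a" by (simp add: continuous_at_imp_continuous_on)
  have ia: "integrable \<mu> (\<lambda>x. a x * b x)" if b: "b \<in> C1c \<A> UNIV" for b
  proof -
    obtain K where K: "compact K" "K \<subseteq> UNIV" "\<And>x. x \<notin> K \<Longrightarrow> b x = 0"
      using C1c_support[OF b] by metis
    have cb: "continuous_on UNIV b" using C1_fun_continuous[OF C1c_C1_fun[OF open_UNIV b] open_UNIV] .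
    show ?thesis
      by (rule Cc_integrable[OF open_UNIV continuous_on_mult[OF ca cb] K(1,2)]) (simp add: K(3))
  qed
  \<comment> \<open>Both sides are additive in \<phi>, so decomposing the test function along chart
    domains reduces the global identity to the local ones.\<close>
  have "(\<integral>x. vf_deriv \<A> X \<phi> x \<partial>\<mu>) = (\<integral>x. a x * \<phi> x \<partial>\<mu>)" if "\<phi> \<in> C1c \<A> UNIV" for \<phi>
    using open_UNIV that
  proof (rule C1c_chart_induct)
    show "(\<integral>x. vf_deriv \<A> X (\<lambda>_. 0) x \<partial>\<mu>) = (\<integral>x. a x * 0 \<partial>\<mu>)" by simp
  next
    fix f g assume f: "f \<in> C1c \<A> UNIV" and g: "g \<in> C1c \<A> UNIV"
      and eq: "(\<integral>x. vf_deriv \<A> X f x \<partial>\<mu>) = (\<integral>x. a x * f x \<partial>\<mu>)"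
      "(\<integral>x. vf_deriv \<A> X g x \<partial>\<mu>) = (\<integral>x. a x * g x \<partial>\<mu>)"
    have "(\<integral>x. vf_deriv \<A> X (\<lambda>x. f x + g x) x \<partial>\<mu>) = (\<integral>x. vf_deriv \<A> X f x + vf_deriv \<A> X g x \<partial>\<mu>)"
      by (rule Bochner_Integration.integral_cong)
         (auto intro!: vf_deriv_add[of UNIV] C1c_C1_fun[OF open_UNIV f] C1c_C1_fun[OF open_UNIV g])
    also have "\<dots> = (\<integral>x. a x * f x \<partial>\<mu>) + (\<integral>x. a x * g x \<partial>\<mu>)"
      unfolding eq[symmetric]
      by (rule Bochner_Integration.integral_add[OF vf_deriv_Cc(3)[OF open_UNIV f X] vf_deriv_Cc(3)[OF open_UNIV g X]])
    also have "\<dots> = (\<integral>x. a x * (f x + g x) \<partial>\<mu>)"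
      using Bochner_Integration.integral_add[OF ia[OF f] ia[OF g]] by (simp add: distrib_left)
    finally show "(\<integral>x. vf_deriv \<A> X (\<lambda>x. f x + g x) x \<partial>\<mu>) = (\<integral>x. a x * (f x + g x) \<partial>\<mu>)" .
  next
    fix U h f assume c: "(U, h) \<in> \<A>" and "f \<in> C1c \<A> (UNIV \<inter> U)"
    then have f: "f \<in> C1c \<A> U" by simp
    have eq: "a x * f x = A (U, h) x * f x" for x
      using a[OF c] C1c_outside[OF f] by (cases "x \<in> U") auto
    show "(\<integral>x. vf_deriv \<A> X f x \<partial>\<mu>) = (\<integral>x. a x * f x \<partial>\<mu>)"
      unfolding eq using A(2)[OF c] f by simp
  qed
  then show ?thesis using that ca by blast
qed

text \<open>The operator is -X \<psi> + a \<psi> with \<open>a\<close> from the divergence lemma,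
  which is applied to the product \<psi> \<phi> and expanded by the Leibniz rule. One function
  \<open>a\<close> on the whole manifold serves every open W, since a test function on W is also one
  on the whole.\<close>

lemma adjoint_exists:
  assumes W: "open W" and X: "C1_vector_field \<A> UNIV X"
  shows "\<exists>D. first_order_operator \<A> W D \<and> (\<forall>\<phi>\<in>C1c \<A> W. \<forall>\<psi>\<in>C1c \<A> W.
    (LINT x:W|\<mu>. \<psi> x * vf_deriv \<A> X \<phi> x) = (LINT x:W|\<mu>. \<phi> x * D \<psi> x))"
proof -
  obtain a where ca: "continuous_on UNIV a"
    and a: "\<And>\<phi>. \<phi> \<in> C1c \<A> UNIV \<Longrightarrow> (\<integral>x. vf_deriv \<A> X \<phi> x \<partial>\<mu>) = (\<integral>x. a x * \<phi> x \<partial>\<mu>)"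
    using divergence[OF X] by metis
  define Y where "Y c x = - X c x" for c x
  define D where "D \<psi> x = vf_deriv \<A> Y \<psi> x + a x * \<psi> x" for \<psi> x
  have C0: "C0_vector_field \<A> W X" by (rule C1_vector_field_imp_C0[OF X])
  have "vector_field \<A> W Y"
  proof -
    have "Y (V, k) x = frechet_derivative (k \<circ> inv_into U h) (at (h x)) (Y (U, h) x)"
      if c: "(U, h) \<in> \<A>" "(V, k) \<in> \<A>" and x: "x \<in> U \<inter> V \<inter> W" for U h V k x
    proof -
      have "linear (frechet_derivative (k \<circ> inv_into U h) (at (h x)))"
        using has_derivative_linear[OF C1_on_has_derivative[OF chart_change[OF c]]] x by blast
      moreover have "X (V, k) x = frechet_derivative (k \<circ> inv_into U h) (at (h x)) (X (U, h) x)"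
        using C0 c x unfolding C0_vector_field_def vector_field_def by blast
      ultimately show ?thesis unfolding Y_def by (simp add: linear_neg)
    qed
    then show ?thesis unfolding vector_field_def by blast
  qed
  moreover have "continuous_on (U \<inter> W) (Y (U, h))" if c: "(U, h) \<in> \<A>" for U h
    using C0 c unfolding C0_vector_field_def Y_def by (auto intro!: continuous_intros)
  ultimately have "C0_vector_field \<A> W Y" unfolding C0_vector_field_def by blast
  moreover have "continuous_on W a" using ca continuous_on_subset by blast
  ultimately have "first_order_operator \<A> W D"
    unfolding first_order_operator_def D_def by blast
  moreover have "(LINT x:W|\<mu>. \<psi> x * vf_deriv \<A> X \<phi> x) = (LINT x:W|\<mu>. \<phi> x * D \<psi> x)"
    if \<phi>: "\<phi> \<in> C1c \<A> W" and \<psi>: "\<psi> \<in> C1c \<A> W" for \<phi> \<psi>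
  proof -
    have f: "C1_fun \<A> UNIV \<phi>" "C1_fun \<A> UNIV \<psi>" using C1c_C1_fun[OF W] \<phi> \<psi> by auto
    have p: "(\<lambda>x. \<psi> x * \<phi> x) \<in> C1c \<A> W" using C1c_mult(1)[OF W \<psi> f(1)] .
    then have p': "(\<lambda>x. \<psi> x * \<phi> x) \<in> C1c \<A> UNIV" using C1c_mono[OF W open_UNIV] by blast
    have Y: "vf_deriv \<A> Y \<psi> x = - vf_deriv \<A> X \<psi> x" for x
    proof -
      obtain U h where c: "(U, h) \<in> \<A>" "x \<in> U"
        and e: "\<And>X f. vf_deriv \<A> X f x = frechet_derivative (f \<circ> inv_into U h) (at (h x)) (X (U, h) x)"
        using vf_deriv_some_chart by blast
      have "linear (frechet_derivative (\<psi> \<circ> inv_into U h) (at (h x)))"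
        using has_derivative_linear[OF C1_fun_derivative[OF f(2) UNIV_I c]] .
      then show ?thesis unfolding e Y_def by (simp add: linear_neg)
    qed
    have prod: "vf_deriv \<A> X (\<lambda>x. \<psi> x * \<phi> x) x = \<psi> x * vf_deriv \<A> X \<phi> x + \<phi> x * vf_deriv \<A> X \<psi> x" for x
      by (rule vf_deriv_mult[OF f(2,1)]) simp
    obtain K where K: "compact K" "K \<subseteq> W" "\<And>x. x \<notin> K \<Longrightarrow> \<phi> x = 0"
      using C1c_support[OF \<phi>] by metis
    have cX: "continuous_on W (vf_deriv \<A> X \<psi>)"
      by (rule vf_deriv_continuous[OF C0 C1c_C1_fun[OF W \<psi>] W])
    have c: "continuous_on W \<phi>" "continuous_on W \<psi>" "continuous_on W a"
      using C1_fun_continuous[OF C1c_C1_fun[OF W] W] \<phi> \<psi> continuous_on_subset[OF ca] by auto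
    have i1: "integrable \<mu> (\<lambda>x. \<phi> x * vf_deriv \<A> X \<psi> x)"
      by (rule Cc_integrable[OF W continuous_on_mult[OF c(1) cX] K(1,2)]) (simp add: K(3))
    have i2: "integrable \<mu> (\<lambda>x. a x * (\<psi> x * \<phi> x))"
      by (rule Cc_integrable[OF W continuous_on_mult[OF c(3) continuous_on_mult[OF c(2,1)]] K(1,2)])
         (simp add: K(3))
    have i3: "integrable \<mu> (vf_deriv \<A> X (\<lambda>x. \<psi> x * \<phi> x))"
      by (rule vf_deriv_Cc(3)[OF W p X])
    have "(LINT x:W|\<mu>. \<psi> x * vf_deriv \<A> X \<phi> x) =
        (\<integral>x. vf_deriv \<A> X (\<lambda>x. \<psi> x * \<phi> x) x - \<phi> x * vf_deriv \<A> X \<psi> x \<partial>\<mu>)"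
      unfolding set_lebesgue_integral_def prod
      by (rule Bochner_Integration.integral_cong) (use C1c_outside[OF \<psi>] in \<open>auto simp: indicator_def\<close>)
    also have "\<dots> = (\<integral>x. a x * (\<psi> x * \<phi> x) \<partial>\<mu>) - (\<integral>x. \<phi> x * vf_deriv \<A> X \<psi> x \<partial>\<mu>)"
      unfolding a[OF p', symmetric] by (rule Bochner_Integration.integral_diff[OF i3 i1])
    also have "\<dots> = (\<integral>x. a x * (\<psi> x * \<phi> x) - \<phi> x * vf_deriv \<A> X \<psi> x \<partial>\<mu>)"
      by (rule Bochner_Integration.integral_diff[OF i2 i1, symmetric])
    also have "\<dots> = (LINT x:W|\<mu>. \<phi> x * D \<psi> x)"
      unfolding set_lebesgue_integral_def D_def Y
      by (rule Bochner_Integration.integral_cong)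
         (use C1c_outside[OF \<phi>] in \<open>auto simp: indicator_def algebra_simps\<close>)
    finally show ?thesis .
  qed
  ultimately show ?thesis by blast
qed

lemma adjoint_props:
  assumes W: "open W" and X: "C1_vector_field \<A> UNIV X"
  shows "first_order_operator \<A> W (adjoint \<A> \<mu> W X)"
    and "\<And>\<phi> \<psi>. \<phi> \<in> C1c \<A> W \<Longrightarrow> \<psi> \<in> C1c \<A> W \<Longrightarrow>
      (LINT x:W|\<mu>. \<psi> x * vf_deriv \<A> X \<phi> x) = (LINT x:W|\<mu>. \<phi> x * adjoint \<A> \<mu> W X \<psi> x)"
  using someI_ex[OF adjoint_exists[OF assms]] unfolding adjoint_def[symmetric] by blast+

text \<open>The chosen operator is specified on W only, whence the indicator. On W its form Y \<psi>
  + a \<psi> with continuous coefficients shows that the result is continuous and vanishes off the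
  support of \<psi>.\<close>

lemma adjoint_L2:
  assumes W: "open W" and X: "C1_vector_field \<A> UNIV X" and \<psi>: "\<psi> \<in> C1c \<A> W"
  shows "(\<lambda>x. indicator W x * adjoint \<A> \<mu> W X \<psi> x) \<in> borel_measurable \<mu>"
    and "integrable \<mu> (\<lambda>x. (indicator W x * adjoint \<A> \<mu> W X \<psi> x)\<^sup>2)"
proof -
  obtain Y a where Y: "C0_vector_field \<A> W Y" "continuous_on W a"
    and D: "\<And>x. x \<in> W \<Longrightarrow> adjoint \<A> \<mu> W X \<psi> x = vf_deriv \<A> Y \<psi> x + a x * \<psi> x"
    using adjoint_props(1)[OF W X] \<psi> unfolding first_order_operator_def by metis
  obtain K where K: "compact K" "K \<subseteq> W" "\<And>x. x \<notin> K \<Longrightarrow> \<psi> x = 0"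
    using C1c_support[OF \<psi>] by metis
  have "continuous_on W (\<lambda>x. vf_deriv \<A> Y \<psi> x + a x * \<psi> x)"
    by (intro continuous_intros vf_deriv_continuous[OF Y(1) C1c_C1_fun[OF W \<psi>] W] Y(2)
        C1_fun_continuous[OF C1c_C1_fun[OF W \<psi>] W])
  then have c: "continuous_on W (\<lambda>x. indicator W x * adjoint \<A> \<mu> W X \<psi> x)"
    by (rule continuous_on_eq) (simp add: D)
  have z: "indicator W x * adjoint \<A> \<mu> W X \<psi> x = 0" if "x \<notin> K" for x
  proof -
    have "vf_deriv \<A> Y \<psi> x = 0"
      by (rule vf_deriv_zero[OF compact_imp_closed[OF K(1)] that K(3)])
    then show ?thesis using K(3)[OF that] D by (cases "x \<in> W") auto
  qed
  show "(\<lambda>x. indicator W x * adjoint \<A> \<mu> W X \<psi> x) \<in> borel_measurable \<mu>"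
    by (rule Cc_measurable[OF W c K(1,2) z])
  show "integrable \<mu> (\<lambda>x. (indicator W x * adjoint \<A> \<mu> W X \<psi> x)\<^sup>2)"
    by (rule Cc_square_integrable[OF W c K(1,2) z])
qed

end

section \<open>Convergence in L2\<close>

definition sq_int :: "'a measure \<Rightarrow> ('a \<Rightarrow> real) \<Rightarrow> bool" where
  "sq_int M f \<longleftrightarrow> f \<in> borel_measurable M \<and> integrable M (\<lambda>x. (f x)\<^sup>2)"

text \<open>Squared distances of plain functions are used instead of a norm on classes; the
  inequality (a + b)^2 \<le> 2 a^2 + 2 b^2 then replaces the triangle inequality, at the price of
  factors 2.\<close>

definition L2_lim :: "'a measure \<Rightarrow> (nat \<Rightarrow> 'a \<Rightarrow> real) \<Rightarrow> ('a \<Rightarrow> real) \<Rightarrow> bool" where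
  "L2_lim M s f \<longleftrightarrow> (\<lambda>n. \<integral>x. (s n x - f x)\<^sup>2 \<partial>M) \<longlonglongrightarrow> 0"

lemma sum_square_le: "((a::real) + b)\<^sup>2 \<le> 2 * a\<^sup>2 + 2 * b\<^sup>2"
  using zero_le_power2[of "a - b"] by (simp add: power2_eq_square algebra_simps)

lemma sq_int_measurable: "sq_int M f \<Longrightarrow> f \<in> borel_measurable M"
  unfolding sq_int_def by blast

lemma sq_int_add:
  assumes "sq_int M f" "sq_int M g"
  shows "sq_int M (\<lambda>x. f x + g x)"
proof -
  have "integrable M (\<lambda>x. (f x + g x)\<^sup>2)"
  proof (rule Bochner_Integration.integrable_bound)
    show "integrable M (\<lambda>x. 2 * (f x)\<^sup>2 + 2 * (g x)\<^sup>2)"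
      using assms unfolding sq_int_def by auto
    show "(\<lambda>x. (f x + g x)\<^sup>2) \<in> borel_measurable M"
      using assms unfolding sq_int_def by auto
    show "AE x in M. norm ((f x + g x)\<^sup>2) \<le> norm (2 * (f x)\<^sup>2 + 2 * (g x)\<^sup>2)"
      using sum_square_le by (intro AE_I2) auto
  qed
  then show ?thesis using assms unfolding sq_int_def by auto
qed

lemma sq_int_mult_bounded:
  assumes "sq_int M f" "b \<in> borel_measurable M" "\<And>x. \<bar>b x\<bar> \<le> B"
  shows "sq_int M (\<lambda>x. b x * f x)"
proof -
  have "integrable M (\<lambda>x. (b x * f x)\<^sup>2)"
  proof (rule Bochner_Integration.integrable_bound)
    show "integrable M (\<lambda>x. B\<^sup>2 * (f x)\<^sup>2)"
      using assms unfolding sq_int_def by auto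
    show "(\<lambda>x. (b x * f x)\<^sup>2) \<in> borel_measurable M"
      using assms unfolding sq_int_def by auto
    have "(b x)\<^sup>2 \<le> B\<^sup>2" for x
      using power_mono[OF assms(3)[of x], of 2] by simp
    then show "AE x in M. norm ((b x * f x)\<^sup>2) \<le> norm (B\<^sup>2 * (f x)\<^sup>2)"
      by (intro AE_I2) (auto simp: power_mult_distrib intro!: mult_right_mono)
  qed
  then show ?thesis using assms unfolding sq_int_def by auto
qed

lemma sq_int_uminus: "sq_int M f \<Longrightarrow> sq_int M (\<lambda>x. - f x)"
  unfolding sq_int_def by auto

lemma sq_int_diff: "sq_int M f \<Longrightarrow> sq_int M g \<Longrightarrow> sq_int M (\<lambda>x. f x - g x)"
  using sq_int_add[OF _ sq_int_uminus, of M f g] by simp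

lemma sq_int_prod:
  assumes "sq_int M f" "sq_int M g"
  shows "integrable M (\<lambda>x. f x * g x)"
proof (rule Bochner_Integration.integrable_bound)
  show "integrable M (\<lambda>x. (f x)\<^sup>2 + (g x)\<^sup>2)"
    using assms unfolding sq_int_def by auto
  show "(\<lambda>x. f x * g x) \<in> borel_measurable M"
    using assms unfolding sq_int_def by auto
  have "\<bar>a * b\<bar> \<le> a\<^sup>2 + b\<^sup>2" for a b :: real
  proof -
    have "2 * \<bar>a\<bar> * \<bar>b\<bar> \<le> a\<^sup>2 + b\<^sup>2" using sum_squares_bound[of "\<bar>a\<bar>" "\<bar>b\<bar>"] by simp
    moreover have "0 \<le> \<bar>a\<bar> * \<bar>b\<bar>" by simp
    ultimately have "\<bar>a\<bar> * \<bar>b\<bar> \<le> a\<^sup>2 + b\<^sup>2" by linarith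
    then show ?thesis by (simp add: abs_mult)
  qed
  then show "AE x in M. norm (f x * g x) \<le> norm ((f x)\<^sup>2 + (g x)\<^sup>2)"
    by (intro AE_I2) auto
qed

lemma integral_sum_square_le:
  assumes "sq_int M f" "sq_int M g"
  shows "(\<integral>x. (f x + g x)\<^sup>2 \<partial>M) \<le> 2 * (\<integral>x. (f x)\<^sup>2 \<partial>M) + 2 * (\<integral>x. (g x)\<^sup>2 \<partial>M)"
proof -
  have "(\<integral>x. (f x + g x)\<^sup>2 \<partial>M) \<le> (\<integral>x. 2 * (f x)\<^sup>2 + 2 * (g x)\<^sup>2 \<partial>M)"
    using sq_int_add[OF assms] assms sum_square_le unfolding sq_int_def
    by (intro integral_mono) auto
  also have "\<dots> = 2 * (\<integral>x. (f x)\<^sup>2 \<partial>M) + 2 * (\<integral>x. (g x)\<^sup>2 \<partial>M)"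
    using assms unfolding sq_int_def by simp
  finally show ?thesis .
qed

lemma null_squeeze:
  fixes a b :: "nat \<Rightarrow> real"
  assumes "b \<longlonglongrightarrow> 0" "\<And>n. 0 \<le> a n" "\<And>n. a n \<le> b n"
  shows "a \<longlonglongrightarrow> 0"
  by (rule Lim_null_comparison[OF _ assms(1)]) (use assms(2,3) in auto)

lemma L2_lim_const [simp]: "L2_lim M (\<lambda>_. f) f"
  unfolding L2_lim_def by simp

lemma L2_lim_add:
  assumes "L2_lim M s f" "L2_lim M t g"
    and "\<And>n. sq_int M (s n)" "sq_int M f" "\<And>n. sq_int M (t n)" "sq_int M g"
  shows "L2_lim M (\<lambda>n x. s n x + t n x) (\<lambda>x. f x + g x)"
  unfolding L2_lim_def
proof (rule null_squeeze)
  show "(\<lambda>n. 2 * (\<integral>x. (s n x - f x)\<^sup>2 \<partial>M) + 2 * (\<integral>x. (t n x - g x)\<^sup>2 \<partial>M)) \<longlonglongrightarrow> 0"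
    using assms(1,2) unfolding L2_lim_def by (auto intro!: tendsto_eq_intros)
  show "(\<integral>x. (s n x + t n x - (f x + g x))\<^sup>2 \<partial>M)
      \<le> 2 * (\<integral>x. (s n x - f x)\<^sup>2 \<partial>M) + 2 * (\<integral>x. (t n x - g x)\<^sup>2 \<partial>M)" for n
    using integral_sum_square_le[OF sq_int_diff[OF assms(3)[of n] assms(4)] sq_int_diff[OF assms(5)[of n] assms(6)]]
    by (simp add: algebra_simps)
qed simp

text \<open>The error splits as \<open>b\<^sub>n (s\<^sub>n - f) + (b\<^sub>n - b) f\<close>; the second term is handled by dominated convergence.\<close>

lemma L2_lim_mult:
  fixes b :: "'a \<Rightarrow> real"
  assumes lim: "L2_lim M s f" and sq: "\<And>n. sq_int M (s n)" "sq_int M f"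
    and m: "\<And>n. c n \<in> borel_measurable M" "b \<in> borel_measurable M"
    and bd: "\<And>n x. \<bar>c n x\<bar> \<le> B" "\<And>x. \<bar>b x\<bar> \<le> B"
    and ae: "AE x in M. f x \<noteq> 0 \<longrightarrow> (\<lambda>n. c n x) \<longlonglongrightarrow> b x"
  shows "L2_lim M (\<lambda>n x. c n x * s n x) (\<lambda>x. b x * f x)"
  unfolding L2_lim_def
proof (rule null_squeeze)
  have d: "sq_int M (\<lambda>x. s n x - f x)" for n using sq_int_diff sq by blast
  have 1: "(\<lambda>n. \<integral>x. (c n x * (s n x - f x))\<^sup>2 \<partial>M) \<longlonglongrightarrow> 0"
  proof (rule null_squeeze)
    show "(\<lambda>n. B\<^sup>2 * (\<integral>x. (s n x - f x)\<^sup>2 \<partial>M)) \<longlonglongrightarrow> 0"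
      using lim unfolding L2_lim_def by (auto intro!: tendsto_eq_intros)
    have "(c n x)\<^sup>2 \<le> B\<^sup>2" for n x
      using power_mono[OF bd(1)[of n x], of 2] by simp
    then show "(\<integral>x. (c n x * (s n x - f x))\<^sup>2 \<partial>M) \<le> B\<^sup>2 * (\<integral>x. (s n x - f x)\<^sup>2 \<partial>M)" for n
      unfolding integral_mult_right_zero[symmetric]
      using sq_int_mult_bounded[OF d m(1) bd(1), of n n] d[of n] unfolding sq_int_def
      by (intro integral_mono) (auto simp: power_mult_distrib intro!: mult_right_mono)
  qed simp
  have db: "\<bar>c n x - b x\<bar> \<le> 2 * B" for n x using bd(1)[of n x] bd(2)[of x] by linarith
  have mdb: "(\<lambda>x. c n x - b x) \<in> borel_measurable M" for n using m by auto
  have 2: "(\<lambda>n. \<integral>x. ((c n x - b x) * f x)\<^sup>2 \<partial>M) \<longlonglongrightarrow> (\<integral>x. 0 \<partial>M)"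
  proof (rule integral_dominated_convergence[where w = "\<lambda>x. (2 * B)\<^sup>2 * (f x)\<^sup>2"])
    show "integrable M (\<lambda>x. (2 * B)\<^sup>2 * (f x)\<^sup>2)" using sq(2) unfolding sq_int_def by auto
    show "(\<lambda>x. ((c n x - b x) * f x)\<^sup>2) \<in> borel_measurable M" for n
      using mdb sq(2) unfolding sq_int_def by auto
    \<comment> \<open>Where f x = 0 the product is 0 whatever the coefficients do. This admits
      coefficients whose limit is known only where f does not vanish, such as G(u)/u with f =
      u.\<close>
    show "AE x in M. (\<lambda>n. ((c n x - b x) * f x)\<^sup>2) \<longlonglongrightarrow> 0"
      using ae
    proof eventually_elim
      case (elim x)
      show ?case
      proof (cases "f x = 0")
        case False
        then have "(\<lambda>n. ((c n x - b x) * f x)\<^sup>2) \<longlonglongrightarrow> ((b x - b x) * f x)\<^sup>2"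
          using elim by (intro tendsto_intros) auto
        then show ?thesis by simp
      qed simp
    qed
    show "AE x in M. norm (((c n x - b x) * f x)\<^sup>2) \<le> (2 * B)\<^sup>2 * (f x)\<^sup>2" for n
    proof (rule AE_I2)
      fix x
      have "(c n x - b x)\<^sup>2 \<le> (2 * B)\<^sup>2"
        using power_mono[OF db[of n x], of 2] by simp
      then show "norm (((c n x - b x) * f x)\<^sup>2) \<le> (2 * B)\<^sup>2 * (f x)\<^sup>2"
        by (auto simp: power_mult_distrib intro!: mult_right_mono)
    qed
  qed auto
  show "(\<lambda>n. 2 * (\<integral>x. (c n x * (s n x - f x))\<^sup>2 \<partial>M) + 2 * (\<integral>x. ((c n x - b x) * f x)\<^sup>2 \<partial>M)) \<longlonglongrightarrow> 0"
    using 1 2 by (auto intro!: tendsto_eq_intros)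
  show "(\<integral>x. (c n x * s n x - b x * f x)\<^sup>2 \<partial>M)
      \<le> 2 * (\<integral>x. (c n x * (s n x - f x))\<^sup>2 \<partial>M) + 2 * (\<integral>x. ((c n x - b x) * f x)\<^sup>2 \<partial>M)" for n
    using integral_sum_square_le[OF sq_int_mult_bounded[OF d m(1) bd(1)] sq_int_mult_bounded[OF sq(2) mdb db], of n n n]
    by (simp add: algebra_simps)
qed simp

text \<open>The inequality y z \<le> y^2/t + t z^2, integrated with positive weights t n tending to
  0, takes the place of Cauchy-Schwarz. The lemma carries the adjoint identity from test functions
  to their limits.\<close>

lemma L2_lim_weak:
  assumes lim: "L2_lim M s f" and sq: "\<And>n. sq_int M (s n)" "sq_int M f" "sq_int M a"
  shows "(\<lambda>n. \<integral>x. s n x * a x \<partial>M) \<longlonglongrightarrow> (\<integral>x. f x * a x \<partial>M)"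
proof -
  define I where "I n = (\<integral>x. (s n x - f x)\<^sup>2 \<partial>M)" for n
  \<comment> \<open>The square root balances the two error terms, giving I n / t n \<le> sqrt (I n);
    the summand 1/(n + 1) keeps t n positive when I n = 0.\<close>
  define t where "t n = sqrt (I n) + 1 / real (Suc n)" for n
  have I: "I n \<ge> 0" "I \<longlonglongrightarrow> 0" for n
    using lim unfolding I_def L2_lim_def by auto
  have t: "t n > 0" for n unfolding t_def using I(1) by (intro add_nonneg_pos) auto
  have sI: "(\<lambda>n. sqrt (I n)) \<longlonglongrightarrow> 0" using tendsto_real_sqrt[OF I(2)] by simp
  have tl: "t \<longlonglongrightarrow> 0"
    unfolding t_def using tendsto_add[OF sI LIMSEQ_inverse_real_of_nat] by (simp add: inverse_eq_divide)
  have d: "sq_int M (\<lambda>x. s n x - f x)" for n using sq_int_diff sq by blast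
  have le: "\<bar>(\<integral>x. s n x * a x \<partial>M) - (\<integral>x. f x * a x \<partial>M)\<bar> \<le> sqrt (I n) + t n * (\<integral>x. (a x)\<^sup>2 \<partial>M)" for n
  proof -
    have "(\<integral>x. s n x * a x \<partial>M) - (\<integral>x. f x * a x \<partial>M) = (\<integral>x. (s n x - f x) * a x \<partial>M)"
      using Bochner_Integration.integral_diff[OF sq_int_prod[OF sq(1)[of n] sq(3)] sq_int_prod[OF sq(2,3)]]
      by (simp add: left_diff_distrib)
    then have "\<bar>(\<integral>x. s n x * a x \<partial>M) - (\<integral>x. f x * a x \<partial>M)\<bar> \<le> (\<integral>x. \<bar>(s n x - f x) * a x\<bar> \<partial>M)"
      using integral_abs_bound[of M "\<lambda>x. (s n x - f x) * a x"] by simp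
    also have "\<dots> \<le> (\<integral>x. (s n x - f x)\<^sup>2 / t n + t n * (a x)\<^sup>2 \<partial>M)"
    proof (rule integral_mono)
      show "integrable M (\<lambda>x. \<bar>(s n x - f x) * a x\<bar>)"
        using sq_int_prod[OF d sq(3)] by (rule integrable_abs)
      show "integrable M (\<lambda>x. (s n x - f x)\<^sup>2 / t n + t n * (a x)\<^sup>2)"
        using d[of n] sq(3) unfolding sq_int_def by auto
      fix x
      define y z where "y = \<bar>s n x - f x\<bar>" and "z = \<bar>a x\<bar>"
      have "0 \<le> (y - t n * z)\<^sup>2 / t n" using t[of n] by simp
      also have "\<dots> = y\<^sup>2 / t n + t n * z\<^sup>2 - 2 * (y * z)"
        using t[of n] by (simp add: power2_eq_square field_simps)
      finally have "2 * (y * z) \<le> y\<^sup>2 / t n + t n * z\<^sup>2" by simp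
      moreover have "0 \<le> y * z" unfolding y_def z_def by simp
      ultimately have "y * z \<le> y\<^sup>2 / t n + t n * z\<^sup>2" by linarith
      then show "\<bar>(s n x - f x) * a x\<bar> \<le> (s n x - f x)\<^sup>2 / t n + t n * (a x)\<^sup>2"
        unfolding y_def z_def by (simp add: abs_mult)
    qed
    also have "\<dots> = I n / t n + t n * (\<integral>x. (a x)\<^sup>2 \<partial>M)"
      unfolding I_def using d[of n] sq(3) unfolding sq_int_def by simp
    also have "I n / t n \<le> sqrt (I n)"
    proof -
      have "I n = sqrt (I n) * sqrt (I n)" using I(1) by simp
      also have "\<dots> \<le> sqrt (I n) * t n" unfolding t_def using I(1) by (intro mult_left_mono) auto
      finally show ?thesis using t[of n] by (simp add: divide_le_eq)
    qed
    finally show ?thesis by simp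
  qed
  have "(\<lambda>n. (\<integral>x. s n x * a x \<partial>M) - (\<integral>x. f x * a x \<partial>M)) \<longlonglongrightarrow> 0"
  proof (rule Lim_null_comparison)
    show "\<forall>\<^sub>F n in sequentially. norm ((\<integral>x. s n x * a x \<partial>M) - (\<integral>x. f x * a x \<partial>M))
        \<le> sqrt (I n) + t n * (\<integral>x. (a x)\<^sup>2 \<partial>M)"
      using le by simp
    have "(\<lambda>n. sqrt (I n) + t n * (\<integral>x. (a x)\<^sup>2 \<partial>M)) \<longlonglongrightarrow> 0 + 0 * (\<integral>x. (a x)\<^sup>2 \<partial>M)"
      by (intro tendsto_intros sI tl)
    then show "(\<lambda>n. sqrt (I n) + t n * (\<integral>x. (a x)\<^sup>2 \<partial>M)) \<longlonglongrightarrow> 0" by simp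
  qed
  then show ?thesis by (simp add: LIM_zero_iff)
qed

section \<open>Smooth truncations of the identity\<close>

text \<open>The factor (r/D)^2 vanishes to second order at |s| = e, which makes B continuously
  differentiable, and it lies in [0, 1]. Dividing by 1 + e B^2 makes the result bounded, by |B|
  \<le> 1 + B^2 \<le> (1 + 1/e) (1 + e B^2). In B' the quotients r/D, s^2/D and (D - r)/D lie in
  [0, 1], so |B'| \<le> 1 + 4, and the outer factor (1 - e B^2)/(1 + e B^2)^2 has modulus at most 1.
  The bound 5 on G' is thus independent of e.\<close>

lemma smooth_truncation:
  fixes e :: real
  assumes e: "e > 0"
  defines "r \<equiv> \<lambda>s. max 0 (s\<^sup>2 - e\<^sup>2)" and "D \<equiv> \<lambda>s. s\<^sup>2 + e\<^sup>2"
  defines "B \<equiv> \<lambda>s. s * ((r s)\<^sup>2 / (D s)\<^sup>2)"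
  defines "B' \<equiv> \<lambda>s. (r s)\<^sup>2 / (D s)\<^sup>2 + 4 * s\<^sup>2 * r s * (D s - r s) / (D s) ^ 3"
  defines "G \<equiv> \<lambda>s. B s / (1 + e * (B s)\<^sup>2)"
  defines "G' \<equiv> \<lambda>s. (1 - e * (B s)\<^sup>2) / (1 + e * (B s)\<^sup>2)\<^sup>2 * B' s"
  shows "(G has_real_derivative G' s) (at s)" "continuous_on UNIV G'"
    "\<bar>s\<bar> \<le> e \<Longrightarrow> G s = 0 \<and> G' s = 0" "\<bar>G s\<bar> \<le> 1 + 1 / e" "\<bar>G s\<bar> \<le> \<bar>s\<bar>" "\<bar>G' s\<bar> \<le> 5"
proof -
  have D: "D s > 0" for s unfolding D_def using e by (simp add: add_nonneg_pos)
  have r: "0 \<le> r s" "r s \<le> D s" for s unfolding r_def D_def by auto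
  have N: "1 + e * (B s)\<^sup>2 > 0" for s using e by (simp add: add_pos_nonneg)
  have dB: "(B has_real_derivative B' s) (at s)" for s
  proof -
    have dr: "((\<lambda>s. (r s)\<^sup>2) has_real_derivative 2 * r s * (2 * s)) (at s)"
      unfolding r_def by (rule square_pos_part_DERIV) (auto intro!: derivative_eq_intros)
    have dD: "((\<lambda>s. (D s)\<^sup>2) has_real_derivative 2 * D s * (2 * s)) (at s)"
      unfolding D_def by (auto intro!: derivative_eq_intros)
    have "(B has_real_derivative (1 * ((r s)\<^sup>2 / (D s)\<^sup>2) +
        (2 * r s * (2 * s) * (D s)\<^sup>2 - (r s)\<^sup>2 * (2 * D s * (2 * s))) / ((D s)\<^sup>2 * (D s)\<^sup>2) * s)) (at s)"
      unfolding B_def using D[of s]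
      by (intro DERIV_mult DERIV_ident DERIV_divide dr dD) auto
    moreover have "1 * ((r s)\<^sup>2 / (D s)\<^sup>2) +
        (2 * r s * (2 * s) * (D s)\<^sup>2 - (r s)\<^sup>2 * (2 * D s * (2 * s))) / ((D s)\<^sup>2 * (D s)\<^sup>2) * s = B' s"
      unfolding B'_def using D[of s] by (simp add: field_simps eval_nat_numeral)
    ultimately show ?thesis by simp
  qed
  show "(G has_real_derivative G' s) (at s)" for s
  proof -
    have "((\<lambda>s. 1 + e * (B s)\<^sup>2) has_real_derivative e * (2 * B s * B' s)) (at s)"
      by (rule derivative_eq_intros dB refl | simp)+
    then have "(G has_real_derivative (B' s * (1 + e * (B s)\<^sup>2) - B s * (e * (2 * B s * B' s)))
        / ((1 + e * (B s)\<^sup>2) * (1 + e * (B s)\<^sup>2))) (at s)"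
      unfolding G_def using N[of s] by (intro DERIV_divide dB) auto
    moreover have "(B' s * (1 + e * (B s)\<^sup>2) - B s * (e * (2 * B s * B' s)))
        / ((1 + e * (B s)\<^sup>2) * (1 + e * (B s)\<^sup>2)) = G' s"
      unfolding G'_def by (simp add: power2_eq_square algebra_simps)
    ultimately show ?thesis by simp
  qed
  have cr: "continuous_on UNIV r" unfolding r_def by (intro continuous_intros)
  have cD: "continuous_on UNIV D" unfolding D_def by (intro continuous_intros)
  have cB: "continuous_on UNIV B" unfolding B_def
    by (intro continuous_intros cr cD) (use D in \<open>auto simp: less_imp_neq[symmetric]\<close>)
  have cB': "continuous_on UNIV B'" unfolding B'_def
    by (intro continuous_intros cr cD) (use D in \<open>auto simp: less_imp_neq[symmetric]\<close>)
  show "continuous_on UNIV G'" unfolding G'_def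
    by (intro continuous_intros cB cB') (use N in \<open>auto simp: less_imp_neq[symmetric]\<close>)
  show "G s = 0 \<and> G' s = 0" if "\<bar>s\<bar> \<le> e" for s
  proof -
    have "s\<^sup>2 \<le> e\<^sup>2" using that power_mono[of "\<bar>s\<bar>" e 2] by simp
    then have "r s = 0" unfolding r_def by simp
    then show ?thesis unfolding G_def G'_def B_def B'_def by simp
  qed
  have q: "0 \<le> r s / D s" "r s / D s \<le> 1" for s using r[of s] D[of s] by auto
  have Bs: "\<bar>B s\<bar> \<le> \<bar>s\<bar>" for s
  proof -
    have "(r s)\<^sup>2 / (D s)\<^sup>2 = (r s / D s)\<^sup>2" by (simp add: power_divide)
    also have "\<dots> \<le> 1" using q[of s] by (simp add: power_le_one)
    finally have "\<bar>s\<bar> * ((r s)\<^sup>2 / (D s)\<^sup>2) \<le> \<bar>s\<bar>" by (intro mult_left_le) auto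
    then show ?thesis unfolding B_def by (simp add: abs_mult)
  qed
  have GB: "\<bar>G s\<bar> \<le> \<bar>B s\<bar>" for s
  proof -
    have "\<bar>B s\<bar> * 1 \<le> \<bar>B s\<bar> * (1 + e * (B s)\<^sup>2)" using e by (intro mult_left_mono) auto
    then show ?thesis unfolding G_def using N[of s] by (simp add: abs_divide divide_le_eq)
  qed
  show "\<bar>G s\<bar> \<le> \<bar>s\<bar>" for s using GB Bs order_trans by blast
  show "\<bar>G s\<bar> \<le> 1 + 1 / e" for s
  proof -
    have "\<bar>B s\<bar> \<le> 1 + (B s)\<^sup>2"
      using zero_le_power2[of "\<bar>B s\<bar> - 1"] zero_le_power2[of "B s"]
      by (simp add: power2_eq_square algebra_simps)
    also have "\<dots> \<le> (1 + 1 / e) * (1 + e * (B s)\<^sup>2)"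
      using e by (simp add: algebra_simps)
    finally show ?thesis unfolding G_def using N[of s] by (simp add: abs_divide divide_le_eq)
  qed
  show "\<bar>G' s\<bar> \<le> 5" for s
  proof -
    have "4 * s\<^sup>2 * r s * (D s - r s) / (D s) ^ 3 = 4 * ((s\<^sup>2 / D s) * ((r s / D s) * ((D s - r s) / D s)))"
      using D[of s] by (simp add: field_simps eval_nat_numeral)
    moreover have "(s\<^sup>2 / D s) * ((r s / D s) * ((D s - r s) / D s)) \<le> 1 * (1 * 1)"
      using q[of s] r[of s] D[of s] by (intro mult_mono mult_nonneg_nonneg) (auto simp: D_def)
    moreover have "(r s)\<^sup>2 / (D s)\<^sup>2 \<le> 1"
      using q[of s] by (simp add: power_divide[symmetric] power_le_one)
    moreover have "0 \<le> (r s)\<^sup>2 / (D s)\<^sup>2" "0 \<le> 4 * s\<^sup>2 * r s * (D s - r s) / (D s) ^ 3"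
      using r[of s] D[of s] by auto
    ultimately have B': "\<bar>B' s\<bar> \<le> 5" unfolding B'_def by linarith
    have n: "(1 + e * (B s)\<^sup>2)\<^sup>2 \<ge> 1 + e * (B s)\<^sup>2"
      using mult_right_mono[of 1 "1 + e * (B s)\<^sup>2" "1 + e * (B s)\<^sup>2"] e N[of s]
      by (simp add: power2_eq_square)
    have "\<bar>1 - e * (B s)\<^sup>2\<bar> \<le> 1 + e * (B s)\<^sup>2" using e by (auto simp: abs_le_iff)
    then have "\<bar>(1 - e * (B s)\<^sup>2) / (1 + e * (B s)\<^sup>2)\<^sup>2\<bar> \<le> 1"
      using n N[of s] by (simp add: abs_divide divide_le_eq)
    then have "\<bar>G' s\<bar> \<le> 1 * 5"
      unfolding G'_def abs_mult using B' by (intro mult_mono) auto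
    then show ?thesis by simp
  qed
qed

text \<open>At s = 0 every G' k is 0, so the derivatives tend to 1 only away from 0; on \<omega> the
  function u has no zeros, and this suffices. The bounds by |s| and by 5 are uniform in k and drive
  the last limit, while 1 + 1 / e k serves for fixed k.\<close>

lemma smooth_truncations:
  obtains G G' :: "nat \<Rightarrow> real \<Rightarrow> real" and e :: "nat \<Rightarrow> real" where
    "\<And>k s. (G k has_real_derivative G' k s) (at s)" "\<And>k. continuous_on UNIV (G' k)"
    "\<And>k. e k > 0" "\<And>k s. \<bar>s\<bar> \<le> e k \<Longrightarrow> G k s = 0 \<and> G' k s = 0"
    "\<And>k s. \<bar>G k s\<bar> \<le> 1 + 1 / e k" "\<And>k s. \<bar>G k s\<bar> \<le> \<bar>s\<bar>" "\<And>k s. \<bar>G' k s\<bar> \<le> 5"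
    "\<And>s. s \<noteq> 0 \<Longrightarrow> (\<lambda>k. G k s) \<longlonglongrightarrow> s" "\<And>s. s \<noteq> 0 \<Longrightarrow> (\<lambda>k. G' k s) \<longlonglongrightarrow> 1"
proof -
  define e where "e k = inverse (real (Suc k))" for k
  define r where "r k s = max 0 (s\<^sup>2 - (e k)\<^sup>2)" for k s
  define D where "D k s = s\<^sup>2 + (e k)\<^sup>2" for k s
  define B where "B k s = s * ((r k s)\<^sup>2 / (D k s)\<^sup>2)" for k s
  define B' where "B' k s = (r k s)\<^sup>2 / (D k s)\<^sup>2 + 4 * s\<^sup>2 * r k s * (D k s - r k s) / (D k s) ^ 3" for k s
  define G where "G k s = B k s / (1 + e k * (B k s)\<^sup>2)" for k s
  define G' where "G' k s = (1 - e k * (B k s)\<^sup>2) / (1 + e k * (B k s)\<^sup>2)\<^sup>2 * B' k s" for k s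
  have e: "e k > 0" for k unfolding e_def by simp
  note defs = G_def[abs_def] G'_def[abs_def] B_def B'_def r_def D_def
  have el: "e \<longlonglongrightarrow> 0" unfolding e_def[abs_def] by (rule LIMSEQ_inverse_real_of_nat)
  show ?thesis
  proof (rule that[of G G' e])
    fix k s
    show "(G k has_real_derivative G' k s) (at s)" "continuous_on UNIV (G' k)"
      "\<bar>s\<bar> \<le> e k \<Longrightarrow> G k s = 0 \<and> G' k s = 0" "\<bar>G k s\<bar> \<le> 1 + 1 / e k" "\<bar>G k s\<bar> \<le> \<bar>s\<bar>" "\<bar>G' k s\<bar> \<le> 5"
      using smooth_truncation[OF e[of k]] unfolding defs by simp_all
  next
    fix s :: real assume s: "s \<noteq> 0"
    have "(\<lambda>k. max 0 (s\<^sup>2 - (e k)\<^sup>2)) \<longlonglongrightarrow> max 0 (s\<^sup>2 - 0\<^sup>2)"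
      by (intro tendsto_intros el)
    then have r: "(\<lambda>k. r k s) \<longlonglongrightarrow> s\<^sup>2" unfolding r_def by simp
    have "(\<lambda>k. s\<^sup>2 + (e k)\<^sup>2) \<longlonglongrightarrow> s\<^sup>2 + 0\<^sup>2" by (intro tendsto_intros el)
    then have D: "(\<lambda>k. D k s) \<longlonglongrightarrow> s\<^sup>2" unfolding D_def by simp
    have "(\<lambda>k. s * ((r k s)\<^sup>2 / (D k s)\<^sup>2)) \<longlonglongrightarrow> s * ((s\<^sup>2)\<^sup>2 / (s\<^sup>2)\<^sup>2)"
      by (intro tendsto_intros r D) (use s in auto)
    then have B: "(\<lambda>k. B k s) \<longlonglongrightarrow> s" unfolding B_def using s by simp
    have "(\<lambda>k. (r k s)\<^sup>2 / (D k s)\<^sup>2 + 4 * s\<^sup>2 * r k s * (D k s - r k s) / (D k s) ^ 3) \<longlonglongrightarrow>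
        (s\<^sup>2)\<^sup>2 / (s\<^sup>2)\<^sup>2 + 4 * s\<^sup>2 * s\<^sup>2 * (s\<^sup>2 - s\<^sup>2) / (s\<^sup>2) ^ 3"
      by (intro tendsto_intros r D) (use s in auto)
    then have B': "(\<lambda>k. B' k s) \<longlonglongrightarrow> 1" unfolding B'_def using s by simp
    have "(\<lambda>k. B k s / (1 + e k * (B k s)\<^sup>2)) \<longlonglongrightarrow> s / (1 + 0 * s\<^sup>2)"
      by (intro tendsto_intros B el) auto
    then show "(\<lambda>k. G k s) \<longlonglongrightarrow> s" unfolding G_def by simp
    have "(\<lambda>k. (1 - e k * (B k s)\<^sup>2) / (1 + e k * (B k s)\<^sup>2)\<^sup>2 * B' k s) \<longlonglongrightarrow>
        (1 - 0 * s\<^sup>2) / (1 + 0 * s\<^sup>2)\<^sup>2 * 1"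
      by (intro tendsto_intros B B' el) auto
    then show "(\<lambda>k. G' k s) \<longlonglongrightarrow> 1" unfolding G'_def by simp
  qed (rule e)
qed

section \<open>Weak derivatives and approximation by compactly supported functions\<close>

text \<open>Multiplying by the indicator turns functions on W into functions on the whole manifold,
  so that the spaces over \<Omega> and over \<omega> are handled in the single measure space
  \<mu>.\<close>

lemma L2_iff: "f \<in> L2 M W \<longleftrightarrow> sq_int M (\<lambda>x. indicator W x * f x)"
proof -
  have "(indicator W x * f x)\<^sup>2 = indicator W x * (f x)\<^sup>2" for x
    by (simp add: indicator_def)
  then show ?thesis
    unfolding L2_def sq_int_def set_borel_measurable_def set_integrable_def by simp
qed

lemma L2_norm_on_square: "(L2_norm_on M W f)\<^sup>2 = (\<integral>x. (indicator W x * f x)\<^sup>2 \<partial>M)"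
proof -
  have "(LINT x:W|M. (f x)\<^sup>2) = (\<integral>x. (indicator W x * f x)\<^sup>2 \<partial>M)"
    unfolding set_lebesgue_integral_def
    by (rule Bochner_Integration.integral_cong) (auto simp: indicator_def)
  then show ?thesis unfolding L2_norm_on_def by simp
qed

lemma set_integral_prod:
  fixes f g :: "'a \<Rightarrow> real"
  shows "(LINT x:W|M. f x * g x) = (\<integral>x. (indicator W x * f x) * (indicator W x * g x) \<partial>M)"
  unfolding set_lebesgue_integral_def
  by (rule Bochner_Integration.integral_cong) (auto simp: indicator_def)

context C1_measure_manifold
begin

lemma sq_int_C1c: "open W \<Longrightarrow> \<phi> \<in> C1c \<A> W \<Longrightarrow> sq_int \<mu> \<phi>"
  unfolding sq_int_def by (intro conjI) (rule C1c_Cc; assumption)+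

lemma sq_int_vf_deriv: "open W \<Longrightarrow> C1_vector_field \<A> UNIV X \<Longrightarrow> \<phi> \<in> C1c \<A> W \<Longrightarrow> sq_int \<mu> (vf_deriv \<A> X \<phi>)"
  unfolding sq_int_def by (intro conjI) (rule vf_deriv_Cc; assumption)+

lemma indicator_C1c: "\<phi> \<in> C1c \<A> W \<Longrightarrow> indicator W x * \<phi> x = \<phi> x"
  using C1c_outside[of \<phi> W x] by (auto simp: indicator_def)

lemma indicator_vf_deriv: "\<phi> \<in> C1c \<A> W \<Longrightarrow> indicator W x * vf_deriv \<A> X \<phi> x = vf_deriv \<A> X \<phi> x"
  using vf_deriv_outside[of \<phi> W x] by (auto simp: indicator_def)

text \<open>Two weak derivatives have equal integrals against every test function, so the separation
  property applies. This frees \<open>S1_norm\<close> from the choice made by \<open>SOME\<close> in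
  \<open>weak_deriv\<close>.\<close>

lemma weak_deriv_unique:
  assumes W: "open W" and f: "is_weak_deriv \<A> \<mu> W X u f" "is_weak_deriv \<A> \<mu> W X u g"
  shows "AE x in \<mu>. indicator W x * f x = indicator W x * g x"
proof -
  have sq: "sq_int \<mu> (\<lambda>x. indicator W x * f x)" "sq_int \<mu> (\<lambda>x. indicator W x * g x)"
    using f unfolding is_weak_deriv_def L2_iff by auto
  have "AE x in \<mu>. x \<in> W \<longrightarrow> indicator W x * f x - indicator W x * g x = 0"
  proof (rule C1c_separating[OF W])
    fix b assume b: "b \<in> C1c \<A> W"
    have i: "integrable \<mu> (\<lambda>x. indicator W x * f x * b x)" "integrable \<mu> (\<lambda>x. indicator W x * g x * b x)"
      using sq_int_prod[OF sq(1) sq_int_C1c[OF W b]] sq_int_prod[OF sq(2) sq_int_C1c[OF W b]] by auto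
    then show "integrable \<mu> (\<lambda>x. (indicator W x * f x - indicator W x * g x) * b x)"
      by (simp add: left_diff_distrib)
    have "(LINT x:W|\<mu>. b x * f x) = (LINT x:W|\<mu>. b x * g x)"
      using f b unfolding is_weak_deriv_def by metis
    then have "(\<integral>x. indicator W x * f x * b x \<partial>\<mu>) = (\<integral>x. indicator W x * g x * b x \<partial>\<mu>)"
      unfolding set_lebesgue_integral_def by (simp add: mult_ac)
    then show "(\<integral>x. (indicator W x * f x - indicator W x * g x) * b x \<partial>\<mu>) = 0"
      using i by (simp add: left_diff_distrib)
  qed
  then show ?thesis by eventually_elim (auto simp: indicator_def)
qed

text \<open>The defining identity of the adjoint says that the classical derivative of a test
  function is a weak one. The rest is linearity, products of two square-integrable functions being
  integrable.\<close>

lemma weak_deriv_diff_C1c: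
  assumes W: "open W" and X: "C1_vector_field \<A> UNIV X" and u: "u \<in> L2 \<mu> W"
    and f: "is_weak_deriv \<A> \<mu> W X u f" and \<phi>: "\<phi> \<in> C1c \<A> W"
  shows "is_weak_deriv \<A> \<mu> W X (\<lambda>x. u x - \<phi> x) (\<lambda>x. f x - vf_deriv \<A> X \<phi> x)"
proof -
  have sf: "sq_int \<mu> (\<lambda>x. indicator W x * f x)" using f unfolding is_weak_deriv_def L2_iff by auto
  have su: "sq_int \<mu> (\<lambda>x. indicator W x * u x)" using u unfolding L2_iff .
  have sX: "sq_int \<mu> (vf_deriv \<A> X \<phi>)" by (rule sq_int_vf_deriv[OF W X \<phi>])
  have s\<phi>: "sq_int \<mu> \<phi>" by (rule sq_int_C1c[OF W \<phi>])
  have "(\<lambda>x. f x - vf_deriv \<A> X \<phi> x) \<in> L2 \<mu> W"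
    using sq_int_diff[OF sf sX] unfolding L2_iff
    by (simp add: right_diff_distrib indicator_vf_deriv[OF \<phi>])
  moreover have "(LINT x:W|\<mu>. (u x - \<phi> x) * adjoint \<A> \<mu> W X \<psi> x)
      = (LINT x:W|\<mu>. \<psi> x * (f x - vf_deriv \<A> X \<phi> x))" if \<psi>: "\<psi> \<in> C1c \<A> W" for \<psi>
  proof -
    have sA: "sq_int \<mu> (\<lambda>x. indicator W x * adjoint \<A> \<mu> W X \<psi> x)"
      unfolding sq_int_def using adjoint_L2[OF W X \<psi>] by blast
    have s\<psi>: "sq_int \<mu> \<psi>" by (rule sq_int_C1c[OF W \<psi>])
    have 1: "(LINT x:W|\<mu>. u x * adjoint \<A> \<mu> W X \<psi> x) = (LINT x:W|\<mu>. \<psi> x * f x)"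
      using f \<psi> unfolding is_weak_deriv_def by blast
    have 2: "(LINT x:W|\<mu>. \<psi> x * vf_deriv \<A> X \<phi> x) = (LINT x:W|\<mu>. \<phi> x * adjoint \<A> \<mu> W X \<psi> x)"
      by (rule adjoint_props(2)[OF W X \<phi> \<psi>])
    show ?thesis
      using 1 2 sq_int_prod[OF su sA] sq_int_prod[OF s\<phi> sA] sq_int_prod[OF s\<psi> sf] sq_int_prod[OF s\<psi> sX]
      unfolding set_integral_prod
      by (simp add: left_diff_distrib right_diff_distrib indicator_C1c[OF \<phi>] indicator_C1c[OF \<psi>]
          indicator_vf_deriv[OF \<phi>])
  qed
  ultimately show ?thesis unfolding is_weak_deriv_def by blast
qed

end

section \<open>The closure of the test functions in concrete form\<close>

locale C1_vector_fields = C1_measure_manifold \<A> \<mu>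
  for \<A> :: "('a::{t2_space, second_countable_topology}, 'e::euclidean_space) chart set"
    and \<mu> :: "'a measure" +
  fixes p :: nat and X :: "nat \<Rightarrow> ('a, 'e) vfield"
  assumes fields: "\<And>j. j < p \<Longrightarrow> C1_vector_field \<A> UNIV (X j)"
begin

text \<open>The \<open>weak_deriv\<close> inside the norm is an arbitrary representative; by
  uniqueness it may be replaced by f j minus the classical derivative of \<phi>. From here on, norms
  of such differences are explicit integrals.\<close>

lemma S1_norm_diff_C1c:
  assumes W: "open W" and u: "u \<in> L2 \<mu> W" and f: "\<And>j. j < p \<Longrightarrow> is_weak_deriv \<A> \<mu> W (X j) u (f j)"
    and \<phi>: "\<phi> \<in> C1c \<A> W"
  shows "S1_norm \<A> \<mu> p X W (\<lambda>x. u x - \<phi> x) =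
    sqrt ((\<Sum>j<p. \<integral>x. (indicator W x * f j x - vf_deriv \<A> (X j) \<phi> x)\<^sup>2 \<partial>\<mu>)
      + (\<integral>x. (indicator W x * u x - \<phi> x)\<^sup>2 \<partial>\<mu>))"
proof -
  have "(\<integral>x. (indicator W x * weak_deriv \<A> \<mu> W (X j) (\<lambda>x. u x - \<phi> x) x)\<^sup>2 \<partial>\<mu>)
      = (\<integral>x. (indicator W x * f j x - vf_deriv \<A> (X j) \<phi> x)\<^sup>2 \<partial>\<mu>)" if j: "j < p" for j
  proof -
    define g where "g = weak_deriv \<A> \<mu> W (X j) (\<lambda>x. u x - \<phi> x)"
    have d: "is_weak_deriv \<A> \<mu> W (X j) (\<lambda>x. u x - \<phi> x) (\<lambda>x. f j x - vf_deriv \<A> (X j) \<phi> x)"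
      by (rule weak_deriv_diff_C1c[OF W fields[OF j] u f[OF j] \<phi>])
    have g: "is_weak_deriv \<A> \<mu> W (X j) (\<lambda>x. u x - \<phi> x) g"
      using someI[of "is_weak_deriv \<A> \<mu> W (X j) (\<lambda>x. u x - \<phi> x)", OF d]
      unfolding g_def weak_deriv_def .
    have "sq_int \<mu> (\<lambda>x. indicator W x * g x)"
      using g unfolding is_weak_deriv_def L2_iff by blast
    moreover have "sq_int \<mu> (\<lambda>x. indicator W x * f j x - vf_deriv \<A> (X j) \<phi> x)"
      using d unfolding is_weak_deriv_def L2_iff
      by (simp add: right_diff_distrib indicator_vf_deriv[OF \<phi>])
    moreover have "AE x in \<mu>. indicator W x * g x = indicator W x * f j x - vf_deriv \<A> (X j) \<phi> x"
      using weak_deriv_unique[OF W g d] by (simp add: right_diff_distrib indicator_vf_deriv[OF \<phi>])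
    ultimately show ?thesis
      unfolding g_def[symmetric] sq_int_def by (intro integral_cong_AE) auto
  qed
  then show ?thesis
    unfolding S1_norm_def L2_norm_on_square
    by (simp add: right_diff_distrib indicator_C1c[OF \<phi>])
qed

text \<open>The closure of $C^1_c(W)$, under the embedding of $\varphi$ as $(\varphi, X_1\varphi, \dots, X_p\varphi)$,
  in the product of $p + 1$ copies of $L^2$.\<close>

definition approximable :: "'a set \<Rightarrow> ('a \<Rightarrow> real) \<Rightarrow> (nat \<Rightarrow> 'a \<Rightarrow> real) \<Rightarrow> bool" where
  "approximable W v F \<longleftrightarrow> sq_int \<mu> v \<and> (\<forall>j<p. sq_int \<mu> (F j)) \<and>
    (\<forall>\<epsilon>>0. \<exists>\<phi>\<in>C1c \<A> W. (\<integral>x. (v x - \<phi> x)\<^sup>2 \<partial>\<mu>) < \<epsilon> \<and>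
      (\<forall>j<p. (\<integral>x. (F j x - vf_deriv \<A> (X j) \<phi> x)\<^sup>2 \<partial>\<mu>) < \<epsilon>))"

lemma approximable_C1c:
  assumes "open W" "\<phi> \<in> C1c \<A> W"
  shows "approximable W \<phi> (\<lambda>j. vf_deriv \<A> (X j) \<phi>)"
  unfolding approximable_def
  using assms sq_int_C1c sq_int_vf_deriv fields by (auto intro!: bexI[of _ \<phi>])

text \<open>Being a closure, the property passes to L2 limits; every limit passage of the argument
  is an application of this.\<close>

lemma approximable_lim:
  assumes W: "open W" and a: "\<And>n. approximable W (v n) (F n)" and sq: "sq_int \<mu> w" "\<And>j. j < p \<Longrightarrow> sq_int \<mu> (H j)"
    and lim: "L2_lim \<mu> v w" "\<And>j. j < p \<Longrightarrow> L2_lim \<mu> (\<lambda>n. F n j) (H j)"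
  shows "approximable W w H"
  unfolding approximable_def
proof (intro conjI allI impI sq)
  fix \<epsilon> :: real assume "\<epsilon> > 0"
  \<comment> \<open>Two errors below \<epsilon>/4, each doubled by the squared triangle inequality,
    add up to less than \<epsilon>.\<close>
  then have e: "\<epsilon> / 4 > 0" by simp
  have "\<forall>\<^sub>F n in sequentially. (\<integral>x. (v n x - w x)\<^sup>2 \<partial>\<mu>) < \<epsilon> / 4"
    using lim(1) e unfolding L2_lim_def by (rule order_tendstoD)
  moreover have "\<forall>\<^sub>F n in sequentially. \<forall>j\<in>{..<p}. (\<integral>x. (F n j x - H j x)\<^sup>2 \<partial>\<mu>) < \<epsilon> / 4"
    using order_tendstoD(2)[OF lim(2)[unfolded L2_lim_def] e] by (intro eventually_ball_finite) blast+
  ultimately have "\<forall>\<^sub>F n in sequentially. (\<integral>x. (v n x - w x)\<^sup>2 \<partial>\<mu>) < \<epsilon> / 4 \<and>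
      (\<forall>j\<in>{..<p}. (\<integral>x. (F n j x - H j x)\<^sup>2 \<partial>\<mu>) < \<epsilon> / 4)"
    by eventually_elim simp
  then obtain n where n: "(\<integral>x. (v n x - w x)\<^sup>2 \<partial>\<mu>) < \<epsilon> / 4"
    "\<And>j. j < p \<Longrightarrow> (\<integral>x. (F n j x - H j x)\<^sup>2 \<partial>\<mu>) < \<epsilon> / 4"
    by (auto simp: eventually_sequentially)
  obtain \<phi> where \<phi>: "\<phi> \<in> C1c \<A> W" "(\<integral>x. (v n x - \<phi> x)\<^sup>2 \<partial>\<mu>) < \<epsilon> / 4"
    "\<And>j. j < p \<Longrightarrow> (\<integral>x. (F n j x - vf_deriv \<A> (X j) \<phi> x)\<^sup>2 \<partial>\<mu>) < \<epsilon> / 4"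
    using a[of n] e unfolding approximable_def by meson
  have tri: "(\<integral>x. (h x - k x)\<^sup>2 \<partial>\<mu>) < \<epsilon>"
    if "sq_int \<mu> g" "sq_int \<mu> h" "sq_int \<mu> k" "(\<integral>x. (g x - h x)\<^sup>2 \<partial>\<mu>) < \<epsilon> / 4" "(\<integral>x. (g x - k x)\<^sup>2 \<partial>\<mu>) < \<epsilon> / 4"
    for g h k
  proof -
    have "(\<integral>x. (h x - k x)\<^sup>2 \<partial>\<mu>) \<le> 2 * (\<integral>x. (h x - g x)\<^sup>2 \<partial>\<mu>) + 2 * (\<integral>x. (g x - k x)\<^sup>2 \<partial>\<mu>)"
      using integral_sum_square_le[OF sq_int_diff[OF that(2,1)] sq_int_diff[OF that(1,3)]] by simp
    then show ?thesis using that(4,5) by (simp add: power2_commute)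
  qed
  have sa: "sq_int \<mu> (v n)" "\<And>j. j < p \<Longrightarrow> sq_int \<mu> (F n j)" using a[of n] unfolding approximable_def by auto
  show "\<exists>\<phi>\<in>C1c \<A> W. (\<integral>x. (w x - \<phi> x)\<^sup>2 \<partial>\<mu>) < \<epsilon> \<and>
      (\<forall>j<p. (\<integral>x. (H j x - vf_deriv \<A> (X j) \<phi> x)\<^sup>2 \<partial>\<mu>) < \<epsilon>)"
  proof (intro bexI[of _ \<phi>] conjI allI impI \<phi>(1))
    show "(\<integral>x. (w x - \<phi> x)\<^sup>2 \<partial>\<mu>) < \<epsilon>"
      by (rule tri[OF sa(1) sq(1) sq_int_C1c[OF W \<phi>(1)] n(1) \<phi>(2)])
    show "(\<integral>x. (H j x - vf_deriv \<A> (X j) \<phi> x)\<^sup>2 \<partial>\<mu>) < \<epsilon>" if j: "j < p" for j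
      by (rule tri[OF sa(2)[OF j] sq(2)[OF j] sq_int_vf_deriv[OF W fields[OF j] \<phi>(1)] n(2)[OF j] \<phi>(3)[OF j]])
  qed
qed

text \<open>The squared errors tend to 0 in L1, so a subsequence converges almost everywhere;
  passing to it keeps all L2 limits. Pointwise convergence matters because nonlinear expressions
  such as G(\<phi>_n), G'(\<phi>_n) and T'(\<phi>_n) enter as bounded coefficients.\<close>

lemma approximable_sequence:
  assumes W: "open W" and a: "approximable W v F"
  obtains \<phi> where "\<And>n. \<phi> n \<in> C1c \<A> W" "L2_lim \<mu> \<phi> v"
    "\<And>j. j < p \<Longrightarrow> L2_lim \<mu> (\<lambda>n. vf_deriv \<A> (X j) (\<phi> n)) (F j)"
    "AE x in \<mu>. (\<lambda>n. \<phi> n x) \<longlonglongrightarrow> v x"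
proof -
  have "\<forall>n. \<exists>\<phi>. \<phi> \<in> C1c \<A> W \<and> (\<integral>x. (v x - \<phi> x)\<^sup>2 \<partial>\<mu>) < inverse (real (Suc n)) \<and>
      (\<forall>j<p. (\<integral>x. (F j x - vf_deriv \<A> (X j) \<phi> x)\<^sup>2 \<partial>\<mu>) < inverse (real (Suc n)))"
    using a unfolding approximable_def Bex_def by simp
  from choice[OF this] obtain \<phi> where *: "\<forall>n. \<phi> n \<in> C1c \<A> W \<and>
      (\<integral>x. (v x - \<phi> n x)\<^sup>2 \<partial>\<mu>) < inverse (real (Suc n)) \<and>
      (\<forall>j<p. (\<integral>x. (F j x - vf_deriv \<A> (X j) (\<phi> n) x)\<^sup>2 \<partial>\<mu>) < inverse (real (Suc n)))" ..
  then have \<phi>: "\<phi> n \<in> C1c \<A> W" "(\<integral>x. (v x - \<phi> n x)\<^sup>2 \<partial>\<mu>) < inverse (real (Suc n))"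
    "j < p \<Longrightarrow> (\<integral>x. (F j x - vf_deriv \<A> (X j) (\<phi> n) x)\<^sup>2 \<partial>\<mu>) < inverse (real (Suc n))" for n j
    by simp_all
  have l1: "L2_lim \<mu> \<phi> v"
    unfolding L2_lim_def
    by (rule null_squeeze[OF LIMSEQ_inverse_real_of_nat]) (use \<phi>(2) in \<open>auto simp: power2_commute less_imp_le\<close>)
  have l2: "L2_lim \<mu> (\<lambda>n. vf_deriv \<A> (X j) (\<phi> n)) (F j)" if "j < p" for j
    unfolding L2_lim_def
    by (rule null_squeeze[OF LIMSEQ_inverse_real_of_nat]) (use \<phi>(3)[OF that] in \<open>auto simp: power2_commute less_imp_le\<close>)
  have sv: "sq_int \<mu> v" using a unfolding approximable_def by blast
  have "\<exists>r::nat\<Rightarrow>nat. strict_mono r \<and> (AE x in \<mu>. (\<lambda>n. (\<phi> (r n) x - v x)\<^sup>2) \<longlonglongrightarrow> 0)"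
  proof (rule tendsto_L1_AE_subseq)
    show "integrable \<mu> (\<lambda>x. (\<phi> n x - v x)\<^sup>2)" for n
      using sq_int_diff[OF sq_int_C1c[OF W \<phi>(1)] sv] unfolding sq_int_def by blast
    show "(\<lambda>n. \<integral>x. norm ((\<phi> n x - v x)\<^sup>2) \<partial>\<mu>) \<longlonglongrightarrow> 0"
      using l1 unfolding L2_lim_def by simp
  qed
  then obtain r :: "nat \<Rightarrow> nat" where r: "strict_mono r"
    "AE x in \<mu>. (\<lambda>n. (\<phi> (r n) x - v x)\<^sup>2) \<longlonglongrightarrow> 0" by blast
  show ?thesis
  proof
    show "\<phi> (r n) \<in> C1c \<A> W" for n using \<phi>(1) .
    show "L2_lim \<mu> (\<lambda>n. \<phi> (r n)) v"
      using LIMSEQ_subseq_LIMSEQ[OF l1[unfolded L2_lim_def] r(1)] unfolding L2_lim_def o_def .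
    show "L2_lim \<mu> (\<lambda>n. vf_deriv \<A> (X j) (\<phi> (r n))) (F j)" if "j < p" for j
      using LIMSEQ_subseq_LIMSEQ[OF l2[OF that, unfolded L2_lim_def] r(1)] unfolding L2_lim_def o_def .
    show "AE x in \<mu>. (\<lambda>n. \<phi> (r n) x) \<longlonglongrightarrow> v x"
      using r(2)
    proof eventually_elim
      case (elim x)
      then have "(\<lambda>n. sqrt ((\<phi> (r n) x - v x)\<^sup>2)) \<longlonglongrightarrow> sqrt 0" by (rule tendsto_real_sqrt)
      then show ?case by (simp add: tendsto_rabs_zero_iff LIM_zero_iff)
    qed
  qed
qed

lemma S1_0_imp_approximable:
  assumes W: "open W" and u: "u \<in> S1_0 \<A> \<mu> p X W"
  obtains F where "approximable W (\<lambda>x. indicator W x * u x) F"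
proof -
  have uL: "u \<in> L2 \<mu> W" and "\<forall>j<p. \<exists>f. is_weak_deriv \<A> \<mu> W (X j) u f"
    using u unfolding S1_0_def S1_def by auto
  then obtain f where f: "\<And>j. j < p \<Longrightarrow> is_weak_deriv \<A> \<mu> W (X j) u (f j)" by metis
  have "approximable W (\<lambda>x. indicator W x * u x) (\<lambda>j x. indicator W x * f j x)"
    unfolding approximable_def
  proof (intro conjI allI impI)
    show "sq_int \<mu> (\<lambda>x. indicator W x * u x)" using uL unfolding L2_iff .
    show "sq_int \<mu> (\<lambda>x. indicator W x * f j x)" if "j < p" for j
      using f[OF that] unfolding is_weak_deriv_def L2_iff by blast
    fix \<epsilon> :: real assume "\<epsilon> > 0"
    then have "sqrt \<epsilon> > 0" by simp
    then obtain \<phi> where \<phi>: "\<phi> \<in> C1c \<A> W" "S1_norm \<A> \<mu> p X W (\<lambda>x. u x - \<phi> x) < sqrt \<epsilon>"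
      using u unfolding S1_0_def by blast
    then have lt: "(\<Sum>j<p. \<integral>x. (indicator W x * f j x - vf_deriv \<A> (X j) \<phi> x)\<^sup>2 \<partial>\<mu>)
      + (\<integral>x. (indicator W x * u x - \<phi> x)\<^sup>2 \<partial>\<mu>) < \<epsilon>"
      using S1_norm_diff_C1c[OF W uL f \<phi>(1)] by simp
    have n: "0 \<le> (\<integral>x. (indicator W x * f j x - vf_deriv \<A> (X j) \<phi> x)\<^sup>2 \<partial>\<mu>)"
      "0 \<le> (\<integral>x. (indicator W x * u x - \<phi> x)\<^sup>2 \<partial>\<mu>)" for j by auto
    show "\<exists>\<phi>\<in>C1c \<A> W. (\<integral>x. (indicator W x * u x - \<phi> x)\<^sup>2 \<partial>\<mu>) < \<epsilon> \<and>
      (\<forall>j<p. (\<integral>x. (indicator W x * f j x - vf_deriv \<A> (X j) \<phi> x)\<^sup>2 \<partial>\<mu>) < \<epsilon>)"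
    proof (intro bexI[of _ \<phi>] conjI allI impI \<phi>(1))
      show "(\<integral>x. (indicator W x * u x - \<phi> x)\<^sup>2 \<partial>\<mu>) < \<epsilon>"
      proof -
        have "0 \<le> (\<Sum>j<p. \<integral>x. (indicator W x * f j x - vf_deriv \<A> (X j) \<phi> x)\<^sup>2 \<partial>\<mu>)"
          by (intro sum_nonneg n(1))
        then show ?thesis using lt by linarith
      qed
      show "(\<integral>x. (indicator W x * f j x - vf_deriv \<A> (X j) \<phi> x)\<^sup>2 \<partial>\<mu>) < \<epsilon>" if "j < p" for j
      proof -
        have "(\<integral>x. (indicator W x * f j x - vf_deriv \<A> (X j) \<phi> x)\<^sup>2 \<partial>\<mu>)
          \<le> (\<Sum>j<p. \<integral>x. (indicator W x * f j x - vf_deriv \<A> (X j) \<phi> x)\<^sup>2 \<partial>\<mu>)"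
          using that by (intro member_le_sum n(1)) auto
        then show ?thesis using lt n(2) by linarith
      qed
    qed
  qed
  then show ?thesis using that by blast
qed

text \<open>The adjoint identity holds for the approximating test functions and passes to the limit
  by weak convergence, so the limit of the classical derivatives is a weak derivative. Membership in
  \<open>S1\<close> is thus obtained, not assumed.\<close>

lemma approximable_imp_S1_0:
  assumes W: "open W" and a: "approximable W (\<lambda>x. indicator W x * u x) (\<lambda>j x. indicator W x * f j x)"
  shows "u \<in> S1_0 \<A> \<mu> p X W"
proof -
  have uL: "u \<in> L2 \<mu> W" and fL: "\<And>j. j < p \<Longrightarrow> f j \<in> L2 \<mu> W"
    using a unfolding approximable_def L2_iff by auto
  obtain \<phi> where \<phi>: "\<And>n. \<phi> n \<in> C1c \<A> W" "L2_lim \<mu> \<phi> (\<lambda>x. indicator W x * u x)"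
    "\<And>j. j < p \<Longrightarrow> L2_lim \<mu> (\<lambda>n. vf_deriv \<A> (X j) (\<phi> n)) (\<lambda>x. indicator W x * f j x)"
    using approximable_sequence[OF W a] by metis
  have f: "is_weak_deriv \<A> \<mu> W (X j) u (f j)" if j: "j < p" for j
    unfolding is_weak_deriv_def
  proof (intro conjI ballI fL[OF j])
    fix \<psi> assume \<psi>: "\<psi> \<in> C1c \<A> W"
    have sA: "sq_int \<mu> (\<lambda>x. indicator W x * adjoint \<A> \<mu> W (X j) \<psi> x)"
      unfolding sq_int_def using adjoint_L2[OF W fields[OF j] \<psi>] by blast
    have s\<psi>: "sq_int \<mu> \<psi>" by (rule sq_int_C1c[OF W \<psi>])
    have 1: "(\<lambda>n. \<integral>x. \<phi> n x * (indicator W x * adjoint \<A> \<mu> W (X j) \<psi> x) \<partial>\<mu>) \<longlonglongrightarrow>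
        (\<integral>x. (indicator W x * u x) * (indicator W x * adjoint \<A> \<mu> W (X j) \<psi> x) \<partial>\<mu>)"
      by (rule L2_lim_weak[OF \<phi>(2) sq_int_C1c[OF W \<phi>(1)] _ sA]) (use uL L2_iff in blast)
    have 2: "(\<lambda>n. \<integral>x. vf_deriv \<A> (X j) (\<phi> n) x * \<psi> x \<partial>\<mu>) \<longlonglongrightarrow> (\<integral>x. (indicator W x * f j x) * \<psi> x \<partial>\<mu>)"
      by (rule L2_lim_weak[OF \<phi>(3)[OF j] sq_int_vf_deriv[OF W fields[OF j] \<phi>(1)] _ s\<psi>])
         (use fL[OF j] L2_iff in blast)
    have eq: "(\<integral>x. \<phi> n x * (indicator W x * adjoint \<A> \<mu> W (X j) \<psi> x) \<partial>\<mu>) = (\<integral>x. vf_deriv \<A> (X j) (\<phi> n) x * \<psi> x \<partial>\<mu>)" for n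
      using adjoint_props(2)[OF W fields[OF j] \<phi>(1) \<psi>, of n] 
      unfolding set_integral_prod indicator_C1c[OF \<phi>(1)] indicator_C1c[OF \<psi>] indicator_vf_deriv[OF \<phi>(1)]
      by (simp add: mult.commute)
    have "(\<integral>x. (indicator W x * u x) * (indicator W x * adjoint \<A> \<mu> W (X j) \<psi> x) \<partial>\<mu>)
        = (\<integral>x. (indicator W x * f j x) * \<psi> x \<partial>\<mu>)"
      using LIMSEQ_unique[OF 1[unfolded eq] 2] .
    then show "(LINT x:W|\<mu>. u x * adjoint \<A> \<mu> W (X j) \<psi> x) = (LINT x:W|\<mu>. \<psi> x * f j x)"
      unfolding set_integral_prod indicator_C1c[OF \<psi>] by (simp add: mult.commute)
  qed
  have "\<exists>\<phi>\<in>C1c \<A> W. S1_norm \<A> \<mu> p X W (\<lambda>x. u x - \<phi> x) < \<epsilon>" if e: "\<epsilon> > 0" for \<epsilon>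
  proof -
    \<comment> \<open>The squared norm has p + 1 summands, each made smaller than d.\<close>
    define d where "d = \<epsilon>\<^sup>2 / (real p + 1)"
    have d: "d > 0" "(real p + 1) * d = \<epsilon>\<^sup>2"
      unfolding d_def using e by (auto simp: add_nonneg_pos)
    obtain \<phi> where \<phi>: "\<phi> \<in> C1c \<A> W" "(\<integral>x. (indicator W x * u x - \<phi> x)\<^sup>2 \<partial>\<mu>) < d"
      "\<And>j. j < p \<Longrightarrow> (\<integral>x. (indicator W x * f j x - vf_deriv \<A> (X j) \<phi> x)\<^sup>2 \<partial>\<mu>) < d"
      using a d(1) unfolding approximable_def by meson
    have "(\<Sum>j<p. \<integral>x. (indicator W x * f j x - vf_deriv \<A> (X j) \<phi> x)\<^sup>2 \<partial>\<mu>) \<le> (\<Sum>j<p. d)"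
      using \<phi>(3) by (intro sum_mono) (auto simp: less_imp_le)
    then have "(\<Sum>j<p. \<integral>x. (indicator W x * f j x - vf_deriv \<A> (X j) \<phi> x)\<^sup>2 \<partial>\<mu>)
      + (\<integral>x. (indicator W x * u x - \<phi> x)\<^sup>2 \<partial>\<mu>) < \<epsilon>\<^sup>2"
      using \<phi>(2) d(2) by (simp add: algebra_simps)
    then have lt: "sqrt ((\<Sum>j<p. \<integral>x. (indicator W x * f j x - vf_deriv \<A> (X j) \<phi> x)\<^sup>2 \<partial>\<mu>)
      + (\<integral>x. (indicator W x * u x - \<phi> x)\<^sup>2 \<partial>\<mu>)) < sqrt (\<epsilon>\<^sup>2)"
      by (simp only: real_sqrt_less_iff)
    have "S1_norm \<A> \<mu> p X W (\<lambda>x. u x - \<phi> x) =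
      sqrt ((\<Sum>j<p. \<integral>x. (indicator W x * f j x - vf_deriv \<A> (X j) \<phi> x)\<^sup>2 \<partial>\<mu>)
        + (\<integral>x. (indicator W x * u x - \<phi> x)\<^sup>2 \<partial>\<mu>))"
      by (rule S1_norm_diff_C1c[OF W uL _ \<phi>(1)]) (rule f)
    with lt have "S1_norm \<A> \<mu> p X W (\<lambda>x. u x - \<phi> x) < sqrt (\<epsilon>\<^sup>2)" by (simp only:)
    then show ?thesis using \<phi>(1) e by auto
  qed
  then show ?thesis
    unfolding S1_0_def S1_def using uL f by blast
qed

end

section \<open>Restriction to a component\<close>

lemma sq_int_dominated:
  assumes "sq_int M g" "f \<in> borel_measurable M" "\<And>x. \<bar>f x\<bar> \<le> \<bar>g x\<bar>"
  shows "sq_int M f"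
proof -
  have "integrable M (\<lambda>x. (f x)\<^sup>2)"
  proof (rule Bochner_Integration.integrable_bound)
    show "integrable M (\<lambda>x. (g x)\<^sup>2)" using assms(1) unfolding sq_int_def by blast
    show "(\<lambda>x. (f x)\<^sup>2) \<in> borel_measurable M" using assms(2) by auto
    show "AE x in M. norm ((f x)\<^sup>2) \<le> norm ((g x)\<^sup>2)"
      using assms(3) by (simp add: abs_le_square_iff)
  qed
  then show ?thesis using assms(2) unfolding sq_int_def by blast
qed

context C1_vector_fields
begin

text \<open>With H fixed, the set to be isolated inside \<omega> is compact, so a single cutoff
  \<eta> works for the whole sequence and the derivative of \<eta> H is one fixed L2 function.
  Relative closedness of \<omega> is expressed by the closed set C.\<close>

lemma cutoff_truncation_approximable:
  assumes \<Omega>: "open \<Omega>" and \<omega>: "open \<omega>" and C: "closed C" "\<omega> = {x \<in> \<Omega>. U x \<noteq> 0} \<inter> C"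
    and cU: "continuous_on \<Omega> U" and sq: "sq_int \<mu> U" "\<And>j. j < p \<Longrightarrow> sq_int \<mu> (F j)"
    and \<phi>: "\<And>n. \<phi> n \<in> C1c \<A> \<Omega>" "\<And>j. j < p \<Longrightarrow> L2_lim \<mu> (\<lambda>n. vf_deriv \<A> (X j) (\<phi> n)) (F j)"
      "AE x in \<mu>. (\<lambda>n. \<phi> n x) \<longlonglongrightarrow> U x"
    and G: "\<And>s. (G has_real_derivative G' s) (at s)" "continuous_on UNIV G'"
      "\<And>s. \<bar>s\<bar> \<le> e \<Longrightarrow> G s = 0 \<and> G' s = 0" "\<And>s. \<bar>G s\<bar> \<le> a" "\<And>s. \<bar>G' s\<bar> \<le> a'"
    and e: "e > 0" and H: "H \<in> C1c \<A> \<Omega>"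
  shows "approximable \<omega> (\<lambda>x. indicator \<omega> x * (H x * G (U x)))
    (\<lambda>j x. indicator \<omega> x * (H x * G' (U x) * F j x + G (U x) * vf_deriv \<A> (X j) H x))"
proof -
  obtain L where L: "compact L" "L \<subseteq> \<Omega>" "\<And>x. x \<notin> L \<Longrightarrow> H x = 0"
    using C1c_support[OF H] by metis
  \<comment> \<open>U is continuous on \<Omega> only, so closedness of the condition e \<le> |U| is
    obtained inside L, a compact subset of \<Omega>. Positivity of e keeps K within {U \<noteq> 0},
    and intersecting with C then places it in \<omega>.\<close>
  define K where "K = L \<inter> (L \<inter> U -` {s. e \<le> \<bar>s\<bar>} \<inter> C)"
  have cl: "closed (L \<inter> U -` {s. e \<le> \<bar>s\<bar>})"
    by (rule continuous_closed_preimage[OF continuous_on_subset[OF cU L(2)] compact_imp_closed[OF L(1)]])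
       (intro closed_Collect_le continuous_intros)
  have K: "compact K"
    unfolding K_def by (rule compact_Int_closed[OF L(1) closed_Int[OF cl C(1)]])
  have K\<omega>: "K \<subseteq> \<omega>" unfolding K_def C(2) using L(2) e by auto
  obtain \<eta> N where \<eta>: "\<eta> \<in> C1c \<A> \<omega>" "\<And>y. 0 \<le> \<eta> y \<and> \<eta> y \<le> 1" "open N" "K \<subseteq> N" "\<And>y. y \<in> N \<Longrightarrow> \<eta> y = 1"
    using cutoff[OF K \<omega> K\<omega>] by metis
  define \<psi> where "\<psi> x = \<eta> x * H x" for x
  have H1: "C1_fun \<A> V H" for V by (rule C1c_C1_fun[OF \<Omega> H])
  have \<psi>: "\<psi> \<in> C1c \<A> \<omega>" unfolding \<psi>_def by (rule C1c_mult(1)[OF \<omega> \<eta>(1) H1])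
  have \<psi>1: "C1_fun \<A> V \<psi>" for V by (rule C1c_C1_fun[OF \<omega> \<psi>])
  have \<phi>1: "C1_fun \<A> UNIV (\<phi> n)" for n by (rule C1c_C1_fun[OF \<Omega> \<phi>(1)])
  have G\<phi>: "C1_fun \<A> UNIV (\<lambda>x. G (\<phi> n x))" for n by (rule C1_fun_compose[OF \<phi>1 G(1,2)])
  have cG: "continuous_on UNIV G"
    using G(1) by (intro continuous_at_imp_continuous_on) (auto intro: DERIV_isCont)
  have m\<phi>: "\<phi> n \<in> borel_measurable \<mu>" for n by (rule C1c_Cc(1)[OF \<Omega> \<phi>(1)])
  have mU: "U \<in> borel_measurable \<mu>" by (rule sq_int_measurable[OF sq(1)])
  note mG = borel_measurable_continuous_on[OF cG] borel_measurable_continuous_on[OF G(2)]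
  have m\<psi>: "\<psi> \<in> borel_measurable \<mu>" by (rule C1c_Cc(1)[OF \<omega> \<psi>])
  obtain b where b: "\<And>x. \<bar>\<psi> x\<bar> \<le> b" using C1c_Cc(2)[OF \<omega> \<psi>] by blast
  have b0: "0 \<le> b" "0 \<le> a'" using b G(5) abs_ge_zero order_trans by blast+
  have s\<psi>: "sq_int \<mu> \<psi>" by (rule sq_int_C1c[OF \<omega> \<psi>])
  have bd: "\<bar>\<psi> x * G' s\<bar> \<le> b * a'" for x s
    unfolding abs_mult using b G(5) b0 by (intro mult_mono) auto
  have aeG: "AE x in \<mu>. (\<lambda>n. G (\<phi> n x)) \<longlonglongrightarrow> G (U x)"
    using \<phi>(3) by eventually_elim (rule continuous_on_tendsto_compose[OF cG], auto)
  have aeG': "AE x in \<mu>. (\<lambda>n. G' (\<phi> n x)) \<longlonglongrightarrow> G' (U x)"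
    using \<phi>(3) by eventually_elim (rule continuous_on_tendsto_compose[OF G(2)], auto)
  \<comment> \<open>U is merely continuous; the test functions \<phi> n inside G make v n an
    admissible C^1 function, and U returns in the limit.\<close>
  define v where "v n x = G (\<phi> n x) * \<psi> x" for n x
  have v: "v n \<in> C1c \<A> \<omega>" for n
    unfolding v_def by (rule C1c_mult(2)[OF \<omega> \<psi> G\<phi>])
  have Xv: "vf_deriv \<A> (X j) (v n) x = \<psi> x * G' (\<phi> n x) * vf_deriv \<A> (X j) (\<phi> n) x + G (\<phi> n x) * vf_deriv \<A> (X j) \<psi> x"
    for n j x
    unfolding v_def
    by (simp add: vf_deriv_mult[OF G\<phi> \<psi>1] vf_deriv_compose[OF \<phi>1 UNIV_I G(1)])
  have "approximable \<omega> (\<lambda>x. G (U x) * \<psi> x)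
      (\<lambda>j x. \<psi> x * G' (U x) * F j x + G (U x) * vf_deriv \<A> (X j) \<psi> x)"
  proof (rule approximable_lim[OF \<omega> approximable_C1c[OF \<omega> v]])
    show "sq_int \<mu> (\<lambda>x. G (U x) * \<psi> x)"
      by (rule sq_int_mult_bounded[OF s\<psi> mG(1)[OF mU] G(4)])
    show "L2_lim \<mu> v (\<lambda>x. G (U x) * \<psi> x)"
      unfolding v_def[abs_def]
      by (rule L2_lim_mult[OF L2_lim_const s\<psi> s\<psi> mG(1)[OF m\<phi>] mG(1)[OF mU] G(4) G(4)])
         (use aeG in eventually_elim, simp)
    fix j assume j: "j < p"
    have sX\<psi>: "sq_int \<mu> (vf_deriv \<A> (X j) \<psi>)" by (rule sq_int_vf_deriv[OF \<omega> fields[OF j] \<psi>])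
    have sX\<phi>: "sq_int \<mu> (vf_deriv \<A> (X j) (\<phi> n))" for n by (rule sq_int_vf_deriv[OF \<Omega> fields[OF j] \<phi>(1)])
    have m1: "(\<lambda>x. \<psi> x * G' (\<phi> n x)) \<in> borel_measurable \<mu>" for n
      by (rule borel_measurable_times[OF m\<psi> mG(2)[OF m\<phi>]])
    have m2: "(\<lambda>x. \<psi> x * G' (U x)) \<in> borel_measurable \<mu>"
      by (rule borel_measurable_times[OF m\<psi> mG(2)[OF mU]])
    have s1: "sq_int \<mu> (\<lambda>x. \<psi> x * G' (\<phi> n x) * vf_deriv \<A> (X j) (\<phi> n) x)" for n
      by (rule sq_int_mult_bounded[OF sX\<phi> m1 bd])
    have s2: "sq_int \<mu> (\<lambda>x. \<psi> x * G' (U x) * F j x)"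
      by (rule sq_int_mult_bounded[OF sq(2)[OF j] m2 bd])
    have s3: "sq_int \<mu> (\<lambda>x. G (\<phi> n x) * vf_deriv \<A> (X j) \<psi> x)" for n
      by (rule sq_int_mult_bounded[OF sX\<psi> mG(1)[OF m\<phi>] G(4)])
    have s4: "sq_int \<mu> (\<lambda>x. G (U x) * vf_deriv \<A> (X j) \<psi> x)"
      by (rule sq_int_mult_bounded[OF sX\<psi> mG(1)[OF mU] G(4)])
    show "sq_int \<mu> (\<lambda>x. \<psi> x * G' (U x) * F j x + G (U x) * vf_deriv \<A> (X j) \<psi> x)"
      by (rule sq_int_add[OF s2 s4])
    have l1: "L2_lim \<mu> (\<lambda>n x. \<psi> x * G' (\<phi> n x) * vf_deriv \<A> (X j) (\<phi> n) x) (\<lambda>x. \<psi> x * G' (U x) * F j x)"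
      by (rule L2_lim_mult[OF \<phi>(2)[OF j] sX\<phi> sq(2)[OF j] m1 m2 bd bd])
         (use aeG' in eventually_elim, auto intro: tendsto_mult_left)
    have l2: "L2_lim \<mu> (\<lambda>n x. G (\<phi> n x) * vf_deriv \<A> (X j) \<psi> x) (\<lambda>x. G (U x) * vf_deriv \<A> (X j) \<psi> x)"
      by (rule L2_lim_mult[OF L2_lim_const sX\<psi> sX\<psi> mG(1)[OF m\<phi>] mG(1)[OF mU] G(4) G(4)])
         (use aeG in eventually_elim, simp)
    show "L2_lim \<mu> (\<lambda>n. vf_deriv \<A> (X j) (v n)) (\<lambda>x. \<psi> x * G' (U x) * F j x + G (U x) * vf_deriv \<A> (X j) \<psi> x)"
      unfolding Xv[abs_def] by (rule L2_lim_add[OF l1 l2 s1 s2 s3 s4])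
  qed
  moreover have "G (U x) * \<psi> x = indicator \<omega> x * (H x * G (U x)) \<and>
      \<psi> x * G' (U x) * F j x + G (U x) * vf_deriv \<A> (X j) \<psi> x
      = indicator \<omega> x * (H x * G' (U x) * F j x + G (U x) * vf_deriv \<A> (X j) H x)" for j x
  proof -
    \<comment> \<open>Each case reconciles \<psi> with the indicator times H: off \<omega> and off L
      both sides vanish; for |U x| \<le> e the factors G and G' vanish; otherwise x lies in K,
      around which \<eta> = 1, so \<psi> and H have the same derivative.\<close>
    consider "x \<notin> \<omega>" | "\<bar>U x\<bar> \<le> e" | "x \<in> \<omega>" "\<bar>U x\<bar> > e" "x \<in> L" | "x \<notin> L" by linarith
    then show ?thesis
    proof cases
      case 1
      then show ?thesis
        using C1c_outside[OF \<psi> 1] vf_deriv_outside[OF \<psi> 1] by simp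
    next
      case 2
      then show ?thesis using G(3)[OF 2] by simp
    next
      case 3
      then have x: "x \<in> N" using \<eta>(4) C(2) unfolding K_def by auto
      have "vf_deriv \<A> (X j) \<psi> x = vf_deriv \<A> (X j) H x"
        by (rule vf_deriv_cong[OF \<eta>(3) x _ \<psi>1]) (simp add: \<psi>_def \<eta>(5))
      then show ?thesis using 3(1) \<eta>(5)[OF x] by (simp add: \<psi>_def)
    next
      case 4
      have "vf_deriv \<A> (X j) H x = 0"
        by (rule vf_deriv_zero[OF compact_imp_closed[OF L(1)] 4 L(3)])
      moreover have "vf_deriv \<A> (X j) \<psi> x = 0"
        by (rule vf_deriv_zero[OF compact_imp_closed[OF L(1)] 4]) (simp add: \<psi>_def L(3))
      ultimately show ?thesis using L(3)[OF 4] by (simp add: \<psi>_def)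
    qed
  qed
  ultimately show ?thesis by simp
qed

text \<open>The factor T(\<phi>_n) is itself a test function and tends to T(u), which is 1 wherever
  G(u) is nonzero. Its derivative T'(\<phi>_n) X_j \<phi>_n, multiplied by G(u), tends to G(u) T'(u)
  F_j = 0.\<close>

lemma truncation_approximable:
  assumes \<Omega>: "open \<Omega>" and \<omega>: "open \<omega>" and C: "closed C" "\<omega> = {x \<in> \<Omega>. U x \<noteq> 0} \<inter> C"
    and cU: "continuous_on \<Omega> U" and a: "approximable \<Omega> U F"
    and G: "\<And>s. (G has_real_derivative G' s) (at s)" "continuous_on UNIV G'"
      "\<And>s. \<bar>s\<bar> \<le> e \<Longrightarrow> G s = 0 \<and> G' s = 0" "\<And>s. \<bar>G s\<bar> \<le> b" "\<And>s. \<bar>G' s\<bar> \<le> b'" "\<And>s. \<bar>G s\<bar> \<le> \<bar>s\<bar>"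
    and e: "e > 0"
  shows "approximable \<omega> (\<lambda>x. indicator \<omega> x * G (U x)) (\<lambda>j x. indicator \<omega> x * (G' (U x) * F j x))"
proof -
  have sq: "sq_int \<mu> U" "\<And>j. j < p \<Longrightarrow> sq_int \<mu> (F j)" using a unfolding approximable_def by auto
  obtain \<phi> where \<phi>: "\<And>n. \<phi> n \<in> C1c \<A> \<Omega>" "\<And>j. j < p \<Longrightarrow> L2_lim \<mu> (\<lambda>n. vf_deriv \<A> (X j) (\<phi> n)) (F j)"
    "AE x in \<mu>. (\<lambda>n. \<phi> n x) \<longlonglongrightarrow> U x"
    using approximable_sequence[OF \<Omega> a] by metis
  obtain T T' :: "real \<Rightarrow> real" where T: "\<And>s. (T has_real_derivative T' s) (at s)"
    "continuous_on UNIV T'" "T 0 = 0" "\<And>s. 0 \<le> T s \<and> T s \<le> 1"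
    "\<And>s. \<bar>s\<bar> \<ge> e \<Longrightarrow> T s = 1 \<and> T' s = 0" "\<And>s. \<bar>T' s\<bar> \<le> 4 / e"
    using cutoff_real[OF e] by metis
  have H: "(\<lambda>x. T (\<phi> n x)) \<in> C1c \<A> \<Omega>" for n
    by (rule C1c_compose[OF \<Omega> \<phi>(1) T(1-3)])
  have \<phi>1: "C1_fun \<A> UNIV (\<phi> n)" for n by (rule C1c_C1_fun[OF \<Omega> \<phi>(1)])
  have XT: "vf_deriv \<A> (X j) (\<lambda>x. T (\<phi> n x)) x = T' (\<phi> n x) * vf_deriv \<A> (X j) (\<phi> n) x" for n j x
    by (rule vf_deriv_compose[OF \<phi>1 UNIV_I T(1)])
  note s1 = cutoff_truncation_approximable[OF \<Omega> \<omega> C cU sq \<phi> G(1-5) e H, unfolded XT]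
  have cont: "continuous_on UNIV G" "continuous_on UNIV T"
    using G(1) T(1) by (auto intro!: continuous_at_imp_continuous_on DERIV_isCont)
  have m\<phi>: "\<phi> n \<in> borel_measurable \<mu>" for n by (rule C1c_Cc(1)[OF \<Omega> \<phi>(1)])
  have mU: "U \<in> borel_measurable \<mu>" by (rule sq_int_measurable[OF sq(1)])
  have m\<omega>: "indicator \<omega> \<in> borel_measurable \<mu>" using \<omega> by (intro borel_measurable_indicator) simp
  note mT = borel_measurable_continuous_on[OF cont(2)] borel_measurable_continuous_on[OF T(2)]
    and mG = borel_measurable_continuous_on[OF cont(1) mU] borel_measurable_continuous_on[OF G(2) mU]
  have T1: "\<bar>T s\<bar> \<le> 1" for s using T(4)[of s] by simp
  have b0: "0 \<le> b" "0 \<le> b'" using G(4,5) abs_ge_zero order_trans by blast+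
  \<comment> \<open>Boundedness of G would not give square integrability on a set of infinite
    measure; |G s| \<le> |s| does.\<close>
  have s0: "sq_int \<mu> (\<lambda>x. indicator \<omega> x * G (U x))"
    by (rule sq_int_dominated[OF sq(1) borel_measurable_times[OF m\<omega> mG(1)]])
       (use G(6) in \<open>auto simp: indicator_def\<close>)
  have aeT: "AE x in \<mu>. (\<lambda>n. T (\<phi> n x)) \<longlonglongrightarrow> T (U x)"
    using \<phi>(3) by eventually_elim (rule continuous_on_tendsto_compose[OF cont(2)], auto)
  have aeT': "AE x in \<mu>. (\<lambda>n. T' (\<phi> n x)) \<longlonglongrightarrow> T' (U x)"
    using \<phi>(3) by eventually_elim (rule continuous_on_tendsto_compose[OF T(2)], auto)
  \<comment> \<open>T and G share the threshold e: for |s| \<le> e both G and G' vanish, and beyond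
    it T = 1 and T' = 0.\<close>
  have TG: "T s * G s = G s" "T s * G' s = G' s" "G s * T' s = 0" for s
    using G(3)[of s] T(5)[of s] by (cases "\<bar>s\<bar> \<le> e"; simp)+
  show ?thesis
  proof (rule approximable_lim[OF \<omega> s1 s0])
    have "L2_lim \<mu> (\<lambda>n x. T (\<phi> n x) * (indicator \<omega> x * G (U x))) (\<lambda>x. T (U x) * (indicator \<omega> x * G (U x)))"
      by (rule L2_lim_mult[OF L2_lim_const s0 s0 mT(1)[OF m\<phi>] mT(1)[OF mU] T1 T1])
         (use aeT in eventually_elim, simp)
    then show "L2_lim \<mu> (\<lambda>n x. indicator \<omega> x * (T (\<phi> n x) * G (U x))) (\<lambda>x. indicator \<omega> x * G (U x))"
      by (simp only: mult.left_commute[of "T _"] TG(1))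
    fix j assume j: "j < p"
    have m1: "(\<lambda>x. indicator \<omega> x * (G' (U x) * T (f x))) \<in> borel_measurable \<mu>" if "f \<in> borel_measurable \<mu>" for f
      by (intro borel_measurable_times m\<omega> mG(2) mT(1)[OF that])
    have m2: "(\<lambda>x. indicator \<omega> x * (G (U x) * T' (f x))) \<in> borel_measurable \<mu>" if "f \<in> borel_measurable \<mu>" for f
      by (intro borel_measurable_times m\<omega> mG(1) mT(2)[OF that])
    have bd1: "\<bar>indicator \<omega> x * (G' s * T t)\<bar> \<le> b'" for x s t
    proof -
      have "\<bar>G' s * T t\<bar> \<le> b' * 1" unfolding abs_mult using G(5) T1 b0 by (intro mult_mono) auto
      then show ?thesis using b0 by (auto simp: indicator_def)
    qed
    have bd2: "\<bar>indicator \<omega> x * (G s * T' t)\<bar> \<le> b * (4 / e)" for x s t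
    proof -
      have "\<bar>G s * T' t\<bar> \<le> b * (4 / e)" unfolding abs_mult using G(4) T(6) b0 by (intro mult_mono) auto
      then show ?thesis using b0 e by (auto simp: indicator_def)
    qed
    have sX\<phi>: "sq_int \<mu> (vf_deriv \<A> (X j) (\<phi> n))" for n by (rule sq_int_vf_deriv[OF \<Omega> fields[OF j] \<phi>(1)])
    note sF = sq(2)[OF j]
    have l1: "L2_lim \<mu> (\<lambda>n x. indicator \<omega> x * (G' (U x) * T (\<phi> n x)) * F j x)
        (\<lambda>x. indicator \<omega> x * (G' (U x) * T (U x)) * F j x)"
      by (rule L2_lim_mult[OF L2_lim_const sF sF m1[OF m\<phi>] m1[OF mU] bd1 bd1])
         (use aeT in eventually_elim, auto intro!: tendsto_mult_left)
    have l2: "L2_lim \<mu> (\<lambda>n x. indicator \<omega> x * (G (U x) * T' (\<phi> n x)) * vf_deriv \<A> (X j) (\<phi> n) x)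
        (\<lambda>x. indicator \<omega> x * (G (U x) * T' (U x)) * F j x)"
      by (rule L2_lim_mult[OF \<phi>(2)[OF j] sX\<phi> sF m2[OF m\<phi>] m2[OF mU] bd2 bd2])
         (use aeT' in eventually_elim, auto intro!: tendsto_mult_left)
    have eq: "indicator \<omega> x * (G' (U x) * T (U x)) * F j x + indicator \<omega> x * (G (U x) * T' (U x)) * F j x
        = indicator \<omega> x * (G' (U x) * F j x)" for x
      by (simp add: TG(3) mult.commute[of "G' (U x)"] TG(2))
    have "L2_lim \<mu> (\<lambda>n x. indicator \<omega> x * (G' (U x) * T (\<phi> n x)) * F j x
          + indicator \<omega> x * (G (U x) * T' (\<phi> n x)) * vf_deriv \<A> (X j) (\<phi> n) x)
        (\<lambda>x. indicator \<omega> x * (G' (U x) * F j x))"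
      unfolding eq[symmetric]
      by (rule L2_lim_add[OF l1 l2 sq_int_mult_bounded[OF sF m1[OF m\<phi>] bd1] sq_int_mult_bounded[OF sF m1[OF mU] bd1]
            sq_int_mult_bounded[OF sX\<phi> m2[OF m\<phi>] bd2] sq_int_mult_bounded[OF sF m2[OF mU] bd2]])
    then show "L2_lim \<mu> (\<lambda>n x. indicator \<omega> x * (T (\<phi> n x) * G' (U x) * F j x + G (U x) * (T' (\<phi> n x) * vf_deriv \<A> (X j) (\<phi> n) x)))
        (\<lambda>x. indicator \<omega> x * (G' (U x) * F j x))"
      by (simp add: algebra_simps)
    have mi: "(\<lambda>x. indicator \<omega> x * G' (U x)) \<in> borel_measurable \<mu>"
      by (intro borel_measurable_times m\<omega> mG(2))
    have "\<bar>indicator \<omega> x * G' (U x)\<bar> \<le> b'" for x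
      using G(5)[of "U x"] b0 by (auto simp: indicator_def)
    then have "sq_int \<mu> (\<lambda>x. indicator \<omega> x * G' (U x) * F j x)"
      by (rule sq_int_mult_bounded[OF sF mi])
    then show "sq_int \<mu> (\<lambda>x. indicator \<omega> x * (G' (U x) * F j x))"
      by (simp add: mult.assoc)
  qed
qed

lemma component_approximable:
  assumes \<Omega>: "open \<Omega>" and \<omega>: "open \<omega>" and C: "closed C" "\<omega> = {x \<in> \<Omega>. U x \<noteq> 0} \<inter> C"
    and cU: "continuous_on \<Omega> U" and a: "approximable \<Omega> U F"
  shows "approximable \<omega> (\<lambda>x. indicator \<omega> x * U x) (\<lambda>j x. indicator \<omega> x * F j x)"
proof -
  have sq: "sq_int \<mu> U" "\<And>j. j < p \<Longrightarrow> sq_int \<mu> (F j)" using a unfolding approximable_def by auto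
  obtain G G' e where G: "\<And>k s. (G k has_real_derivative G' k s) (at s)" "\<And>k. continuous_on UNIV (G' k)"
    "\<And>k. e k > (0::real)" "\<And>k s. \<bar>s\<bar> \<le> e k \<Longrightarrow> G k s = 0 \<and> G' k s = 0"
    "\<And>k s. \<bar>G k s\<bar> \<le> 1 + 1 / e k" "\<And>k s. \<bar>G k s\<bar> \<le> \<bar>s\<bar>" "\<And>k s. \<bar>G' k s\<bar> \<le> 5"
    "\<And>s. s \<noteq> 0 \<Longrightarrow> (\<lambda>k. G k s) \<longlonglongrightarrow> s" "\<And>s. s \<noteq> 0 \<Longrightarrow> (\<lambda>k. G' k s) \<longlonglongrightarrow> 1"
    by (rule smooth_truncations) blast
  have s: "approximable \<omega> (\<lambda>x. indicator \<omega> x * G k (U x)) (\<lambda>j x. indicator \<omega> x * (G' k (U x) * F j x))" for k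
    by (rule truncation_approximable[OF \<Omega> \<omega> C cU a G(1,2,4,5,7,6,3)])
  have mU: "U \<in> borel_measurable \<mu>" by (rule sq_int_measurable[OF sq(1)])
  have m\<omega>: "indicator \<omega> \<in> borel_measurable \<mu>" using \<omega> by (intro borel_measurable_indicator) simp
  have cG: "continuous_on UNIV (G k)" for k
    using G(1) by (auto intro!: continuous_at_imp_continuous_on DERIV_isCont)
  note mG = borel_measurable_continuous_on[OF cG mU] borel_measurable_continuous_on[OF G(2) mU]
  have U0: "U x \<noteq> 0" if "x \<in> \<omega>" for x using that C(2) by auto
  have b1: "\<bar>indicator \<omega> x\<bar> \<le> (1::real)" for x by (simp add: indicator_def)
  show ?thesis
  proof (rule approximable_lim[OF \<omega> s])
    show "sq_int \<mu> (\<lambda>x. indicator \<omega> x * U x)" by (rule sq_int_mult_bounded[OF sq(1) m\<omega> b1])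
    show "sq_int \<mu> (\<lambda>x. indicator \<omega> x * F j x)" if "j < p" for j
      by (rule sq_int_mult_bounded[OF sq(2)[OF that] m\<omega> b1])
    \<comment> \<open>Writing G k (U) as a bounded coefficient times the fixed function U brings it
      under the product rule for L2 limits; the quotient G k (U) / U tends to 1 where U is
      nonzero.\<close>
    have "L2_lim \<mu> (\<lambda>k x. indicator \<omega> x * (G k (U x) / U x) * U x) (\<lambda>x. indicator \<omega> x * U x)"
    proof (rule L2_lim_mult[OF L2_lim_const sq(1) sq(1) _ m\<omega> _ b1])
      show "(\<lambda>x. indicator \<omega> x * (G k (U x) / U x)) \<in> borel_measurable \<mu>" for k
        by (intro borel_measurable_times m\<omega> borel_measurable_divide mG mU)
      \<comment> \<open>Where U x = 0 the quotient is 0 by the convention on division; elsewhere |G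
        k s| \<le> |s| gives the bound.\<close>
      show "\<bar>indicator \<omega> x * (G k (U x) / U x)\<bar> \<le> 1" for k x
        using G(6)[of k "U x"] by (auto simp: indicator_def abs_divide divide_le_eq)
      show "AE x in \<mu>. U x \<noteq> 0 \<longrightarrow> (\<lambda>k. indicator \<omega> x * (G k (U x) / U x)) \<longlonglongrightarrow> indicator \<omega> x"
      proof (intro AE_I2 impI)
        fix x assume x: "U x \<noteq> 0"
        have "(\<lambda>k. indicator \<omega> x * (G k (U x) / U x)) \<longlonglongrightarrow> indicator \<omega> x * (U x / U x)"
          by (intro tendsto_intros G(8) x)
        then show "(\<lambda>k. indicator \<omega> x * (G k (U x) / U x)) \<longlonglongrightarrow> indicator \<omega> x" using x by simp
      qed
    qed
    moreover have "indicator \<omega> x * (G k (U x) / U x) * U x = indicator \<omega> x * G k (U x)" for k x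
      using U0[of x] by (auto simp: indicator_def)
    ultimately show "L2_lim \<mu> (\<lambda>k x. indicator \<omega> x * G k (U x)) (\<lambda>x. indicator \<omega> x * U x)" by simp
    fix j assume j: "j < p"
    note sF = sq(2)[OF j]
    \<comment> \<open>Here F j is the fixed factor, and the coefficients tend to the indicator at
      every point because U has no zeros on \<omega>; 5 is the uniform bound on G'.\<close>
    have "L2_lim \<mu> (\<lambda>k x. indicator \<omega> x * G' k (U x) * F j x) (\<lambda>x. indicator \<omega> x * F j x)"
    proof (rule L2_lim_mult[OF L2_lim_const sF sF _ m\<omega>, where B = 5])
      show "(\<lambda>x. indicator \<omega> x * G' k (U x)) \<in> borel_measurable \<mu>" for k
        by (intro borel_measurable_times m\<omega> mG)
      show "\<bar>indicator \<omega> x * G' k (U x)\<bar> \<le> 5" "\<bar>indicator \<omega> x\<bar> \<le> (5::real)" for k x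
        using G(7)[of k "U x"] by (auto simp: indicator_def)
      show "AE x in \<mu>. F j x \<noteq> 0 \<longrightarrow> (\<lambda>k. indicator \<omega> x * G' k (U x)) \<longlonglongrightarrow> indicator \<omega> x"
      proof (intro AE_I2 impI)
        fix x
        show "(\<lambda>k. indicator \<omega> x * G' k (U x)) \<longlonglongrightarrow> indicator \<omega> x"
          using G(9)[OF U0[of x]] by (cases "x \<in> \<omega>") auto
      qed
    qed
    then show "L2_lim \<mu> (\<lambda>k x. indicator \<omega> x * (G' k (U x) * F j x)) (\<lambda>x. indicator \<omega> x * F j x)"
      by (simp add: mult.assoc)
  qed
qed

text \<open>Coordinate balls pull back to connected open neighbourhoods, so the manifold is locally
  connected; such a neighbourhood inside S that meets the component lies in it by
  maximality.\<close>

lemma open_component: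
  fixes S :: "'a set"
  assumes S: "open S" and \<omega>: "\<omega> \<in> components S"
  shows "open \<omega>"
proof (subst open_subopen, intro ballI)
  fix x assume x: "x \<in> \<omega>"
  then have xS: "x \<in> S" using in_components_subset[OF \<omega>] by blast
  obtain U h where c: "(U, h) \<in> \<A>" "x \<in> U" by (rule ex_chart)
  have "open (h ` (U \<inter> S))" using chart_image_open[OF c(1) S] .
  then obtain r where r: "r > 0" "ball (h x) r \<subseteq> h ` (U \<inter> S)"
    using c xS open_contains_ball by (metis IntI image_eqI)
  define N where "N = inv_into U h ` ball (h x) r"
  have rU: "ball (h x) r \<subseteq> h ` U" using r(2) by auto
  have NS: "N \<subseteq> S" unfolding N_def using r(2) c by auto
  have N: "N = U \<inter> h -` ball (h x) r"
  proof -
    have "y \<in> N" if "h y \<in> ball (h x) r" "y \<in> U" for y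
      using that c unfolding N_def by (metis chart_inv image_eqI)
    then show ?thesis using rU c unfolding N_def by auto
  qed
  have "open N" unfolding N by (rule continuous_open_preimage[OF chartD(3,1)[OF c(1)]]) simp
  moreover have xN: "x \<in> N" unfolding N using c r(1) by simp
  moreover have "connected N"
    unfolding N_def
    by (rule connected_continuous_image[OF continuous_on_subset[OF chartD(4)[OF c(1)] rU]]) simp
  then have "N \<subseteq> \<omega>"
    using components_maximal[OF \<omega> _ NS] x xN by blast
  ultimately show "\<exists>T. open T \<and> x \<in> T \<and> T \<subseteq> \<omega>" by blast
qed

end

theorem theorem2p2:
  fixes \<A> :: "('a::{t2_space, second_countable_topology}, 'e::euclidean_space) chart set"
    and \<mu> :: "'a measure"
    and p :: nat
    and X :: "nat \<Rightarrow> ('a, 'e) vfield"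
    and \<Omega> \<omega> :: "'a set"
    and u :: "'a \<Rightarrow> real"
  assumes "C1_atlas \<A>"
    and "C1_measure \<A> \<mu>"
    and "\<And>j. j < p \<Longrightarrow> C1_vector_field \<A> UNIV (X j)"
    and "open \<Omega>"
    and "u \<in> S1_0 \<A> \<mu> p X \<Omega>"
    and "continuous_on \<Omega> u"
    and "\<omega> \<in> components {x \<in> \<Omega>. u x \<noteq> 0}"
  shows "restrict u \<omega> \<in> S1_0 \<A> \<mu> p X \<omega>"
proof -
  interpret C1_vector_fields \<A> \<mu> p X
    by unfold_locales (use assms in auto)
  \<comment> \<open>Extension by zero: U agrees with u on \<Omega>, so it keeps continuity and
    nonzero set there, and it is square integrable over the whole manifold.\<close>
  define U where "U x = indicator \<Omega> x * u x" for x
  define S where "S = {x \<in> \<Omega>. u x \<noteq> 0}"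
  have "open (\<Omega> \<inter> u -` (- {0}))"
    by (rule continuous_open_preimage[OF assms(6,4)]) auto
  moreover have "\<Omega> \<inter> u -` (- {0}) = S" unfolding S_def by auto
  ultimately have "open S" by simp
  have \<omega>: "open \<omega>" by (rule open_component[OF \<open>open S\<close>]) (use assms(7) S_def in simp)
  have \<omega>S: "\<omega> \<subseteq> S" using in_components_subset[OF assms(7)] unfolding S_def .
  have "closedin (top_of_set S) \<omega>" using closedin_component[OF assms(7)] unfolding S_def .
  \<comment> \<open>A component is relatively closed in S; the closed set C witnessing this is what
    makes the set K of the cutoff argument compact.\<close>
  then obtain C where C: "closed C" "\<omega> = S \<inter> C" by (auto simp: closedin_closed)
  have SU: "S = {x \<in> \<Omega>. U x \<noteq> 0}" unfolding S_def U_def by auto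
  have cU: "continuous_on \<Omega> U"
    by (rule continuous_on_eq[OF assms(6)]) (simp add: U_def)
  obtain F where "approximable \<Omega> U F"
    using S1_0_imp_approximable[OF assms(4,5)] unfolding U_def by metis
  then have "approximable \<omega> (\<lambda>x. indicator \<omega> x * U x) (\<lambda>j x. indicator \<omega> x * F j x)"
    by (rule component_approximable[OF assms(4) \<omega> C(1) C(2)[unfolded SU] cU])
  \<comment> \<open>\<open>restrict\<close> takes the value \<open>undefined\<close> off \<omega>,
    which the indicator erases.\<close>
  moreover have "(\<lambda>x. indicator \<omega> x * U x) = (\<lambda>x. indicator \<omega> x * restrict u \<omega> x)"
    using \<omega>S unfolding U_def S_def by (auto simp: indicator_def fun_eq_iff)
  ultimately show ?thesis
    using approximable_imp_S1_0[OF \<omega>] by metis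
qed

end
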